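(* Fix $n\ge1$ and $\lambda\in\mathbb C^*$. There are $2n$ linearly independent isomonodromic flows on the $4n$-dimensional manifold $X$ for the deformed polynomial oscillator equation $Y''=Q(x)Y$, $Q=\lambda^{-2}Q_0+\lambda^{-1}Q_1+Q_2$. They (i.e. a basis of the isomonodromic flows) are given, for $i=1,\dots,n$, by $$U_i=U_{i0'}+\lambda U_{i1'},\qquad V_i=V_{i0'}+\lambda V_{i1'},$$ where $$U_{i0'}=-\sum_{j=1}^n\frac{q_j^{i-1}}{2p_j}\frac{\partial}{\partial v_j},\qquad U_{i1'}=\frac{\partial}{\partial b_i},$$ $$V_{i0'}=-2p_i\frac{\partial}{\partial q_i}-\sum_{j\ne i}\Big(\frac{\sum_{k=1}^nT_k(q_i)q_j^{k+n-1}}{2p_j}+\frac{Q_0'(q_j)}{2p_j(q_i-q_j)}+\frac{p_j}{(q_i-q_j)^2}\Big)\frac{\partial}{\partial v_j}$$ $$\qquad-\Big(\frac{\sum_{k=1}^nT_k(q_i)q_i^{k+n-1}}{2p_i}-\frac{Q_0'(q_i)v_i}{p_i}+R'(q_i)-\sum_{j\ne i}\frac{p_j}{(q_i-q_j)^2}\Big)\frac{\partial}{\partial v_i},$$ $$V_{i1'}=\sum_{j=1}^nT_j(q_i)\frac{\partial}{\partial a_j}-2v_i\frac{\partial}{\partial q_i}+\sum_{j\ne i}\frac1{q_i-q_j}\frac{\partial}{\partial q_j}-\sum_{j\ne i}\Big(\frac{3}{2(q_i-q_j)^3}+\frac{v_j}{(q_i-q_j)^2}\Big)\frac{\partial}{\partial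 v_j}$$ $$\qquad+\Big(\sum_{j\ne i}\frac{3}{2(q_i-q_j)^3}+\sum_{j\ne i}\frac{v_j}{(q_i-q_j)^2}-S'(q_i)\Big)\frac{\partial}{\partial v_i},$$ and $$T_j(x)=(2j-1)x^{n-j}+\sum_{k=1}^{n-j-1}(2j+k)\,a_{n-k+1}\,x^{n-j-1-k}.$$
   Context: No summation convention is used; indices and unrestricted sums run over $1,\dots,n$, and $j\ne i$ means sum over $j\in\{1,\dots,n\}\setminus\{i\}$. A prime on a function of $x$ denotes $d/dx$. Let $Q_0(x)=x^{2n+1}+a_nx^{2n-1}+\dots+a_1x^n+b_nx^{n-1}+\dots+b_1$ and let $M\subset\mathbb C^{2n}$ be the open set of $(a,b)$ for which $Q_0$ has simple zeros. $X$ is the $4n$-dimensional complex manifold with local coordinates $(a,b,q,v)$, $q=(q_1,\dots,q_n)$, $v=(v_1,\dots,v_n)$, together with choices of $p_i$ with $p_i^2=Q_0(q_i)$, where $(a,b)\in M$, the $q_i$ are pairwise distinct and $p_i\ne0$. Define $$Q_1(x)=\sum_i\frac{p_i}{x-q_i}+R(x),\quad R(x)=\sum_i\Big(2p_iv_i-\sum_{k\ne i}\frac{p_k}{q_i-q_k}\Big)\prod_{j\ne i}\frac{x-q_j}{q_i-q_j},$$ $$Q_2(x)=\sum_i\frac{3}{4(x-q_i)^2}+\sum_i\frac{v_i}{x-q_i}+S(x),\quad S(x)=\sum_i\Big(v_i^2-\sum_{k\ne i}\frac{3}{4(q_i-q_k)^2}-\sum_{k\ne i}\frac{v_k}{q_i-q_k}\Big)\prod_{j\ne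 i}\frac{x-q_j}{q_i-q_j}.$$ ($R$ is a general polynomial of degree at most $n-1$; $Q_2$ is such that the Laurent expansion of $Q$ at $q_i$ is $\frac{3}{4(x-q_i)^2}+\frac{u_i}{x-q_i}+u_i^2+O(x-q_i)$ with $u_i=p_i/\lambda+v_i$.) A flow (vector field on $X$, for the fixed value of $\lambda$), with flow parameter $t$ and $Q=Q(x,t)$ along it, is isomonodromic if there exists a matrix $B(x,t)$ of functions meromorphic in $x\in\mathbb{CP}^1$ such that the connection $d-\begin{bmatrix}0&1\\Q(x,t)&0\end{bmatrix}dx-B(x,t)\,dt$ is flat. Equivalently there is a function $A(x,t)$ meromorphic in $x$ with $$-2\frac{\partial Q}{\partial t}=\frac{\partial^3A}{\partial x^3}-4Q\frac{\partial A}{\partial x}-2\frac{\partial Q}{\partial x}A .$$ Linear independence is over functions, i.e. pointwise. *)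

theory Defs
  imports
    "HOL-Complex_Analysis.Complex_Analysis"
    "HOL-Library.Function_Algebras"
begin

text \<open>
  All families are functions on \<^typ>\<open>nat\<close> of which only the values at the indices
  \<open>1, \<dots>, n\<close> matter; they are normalised to be zero elsewhere.
\<close>

definition Q0 :: "nat \<Rightarrow> (nat \<Rightarrow> complex) \<Rightarrow> (nat \<Rightarrow> complex) \<Rightarrow> complex poly" where
  "Q0 n a b = monom 1 (2 * n + 1) + (\<Sum>i=1..n. monom (a i) (n + i - 1))
                + (\<Sum>i=1..n. monom (b i) (i - 1))"

definition M_set :: "nat \<Rightarrow> ((nat \<Rightarrow> complex) \<times> (nat \<Rightarrow> complex)) set" where
  "M_set n = {(a, b). rsquarefree (Q0 n a b) \<and> (\<forall>i. i \<notin> {1..n} \<longrightarrow> a i = 0 \<and> b i = 0)}"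

text \<open>A point is a tuple \<open>(a, b, q, v, p)\<close>.\<close>

type_synonym point =
  "(nat \<Rightarrow> complex) \<times> (nat \<Rightarrow> complex) \<times> (nat \<Rightarrow> complex) \<times> (nat \<Rightarrow> complex) \<times> (nat \<Rightarrow> complex)"

definition X_mfd :: "nat \<Rightarrow> point set" where
  "X_mfd n = {(a, b, q, v, p).
      (a, b) \<in> M_set n \<and> inj_on q {1..n} \<and>
      (\<forall>i\<in>{1..n}. p i ^ 2 = poly (Q0 n a b) (q i) \<and> p i \<noteq> 0) \<and>
      (\<forall>i. i \<notin> {1..n} \<longrightarrow> q i = 0 \<and> v i = 0 \<and> p i = 0)}"

datatype coord = Ca nat | Cb nat | Cq nat | Cv nat

definition coords :: "nat \<Rightarrow> coord set" where
  "coords n = Ca ` {1..n} \<union> Cb ` {1..n} \<union> Cq ` {1..n} \<union> Cv ` {1..n}"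

fun coord_val :: "coord \<Rightarrow> point \<Rightarrow> complex" where
  "coord_val (Ca i) (a, b, q, v, p) = a i"
| "coord_val (Cb i) (a, b, q, v, p) = b i"
| "coord_val (Cq i) (a, b, q, v, p) = q i"
| "coord_val (Cv i) (a, b, q, v, p) = v i"

fun root_val :: "nat \<Rightarrow> point \<Rightarrow> complex" where
  "root_val i (a, b, q, v, p) = p i"

definition R_fun ::
  "nat \<Rightarrow> (nat \<Rightarrow> complex) \<Rightarrow> (nat \<Rightarrow> complex) \<Rightarrow> (nat \<Rightarrow> complex) \<Rightarrow> complex \<Rightarrow> complex" where
  "R_fun n q v p x =
    (\<Sum>i=1..n. (2 * p i * v i - (\<Sum>k\<in>{1..n} - {i}. p k / (q i - q k)))
       * (\<Prod>j\<in>{1..n} - {i}. (x - q j) / (q i - q j)))"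

definition Q1 ::
  "nat \<Rightarrow> (nat \<Rightarrow> complex) \<Rightarrow> (nat \<Rightarrow> complex) \<Rightarrow> (nat \<Rightarrow> complex) \<Rightarrow> complex \<Rightarrow> complex" where
  "Q1 n q v p x = (\<Sum>i=1..n. p i / (x - q i)) + R_fun n q v p x"

definition S_fun ::
  "nat \<Rightarrow> (nat \<Rightarrow> complex) \<Rightarrow> (nat \<Rightarrow> complex) \<Rightarrow> complex \<Rightarrow> complex" where
  "S_fun n q v x =
    (\<Sum>i=1..n. (v i ^ 2 - (\<Sum>k\<in>{1..n} - {i}. 3 / (4 * (q i - q k) ^ 2))
                  - (\<Sum>k\<in>{1..n} - {i}. v k / (q i - q k)))
       * (\<Prod>j\<in>{1..n} - {i}. (x - q j) / (q i - q j)))"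

definition Q2 ::
  "nat \<Rightarrow> (nat \<Rightarrow> complex) \<Rightarrow> (nat \<Rightarrow> complex) \<Rightarrow> complex \<Rightarrow> complex" where
  "Q2 n q v x = (\<Sum>i=1..n. 3 / (4 * (x - q i) ^ 2)) + (\<Sum>i=1..n. v i / (x - q i))
                  + S_fun n q v x"

fun Q_pot :: "nat \<Rightarrow> complex \<Rightarrow> point \<Rightarrow> complex \<Rightarrow> complex" where
  "Q_pot n lam (a, b, q, v, p) x =
     poly (Q0 n a b) x / lam ^ 2 + Q1 n q v p x / lam + Q2 n q v x"

text \<open>
  A tangent vector of the manifold is given by its components in the local coordinates
  \<open>(a, b, q, v)\<close>; the \<open>p\<^sub>i\<close> are locally functions of these coordinates.
\<close>

type_synonym tvec = "coord \<Rightarrow> complex"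

definition vscale :: "complex \<Rightarrow> tvec \<Rightarrow> tvec"  (infixr "*\<^sub>T" 75) where
  "c *\<^sub>T w = (\<lambda>k. c * w k)"

interpretation tangent: vector_space vscale
  by unfold_locales (auto simp: vscale_def fun_eq_iff algebra_simps)

definition partial :: "coord \<Rightarrow> tvec"  ("\<partial>") where
  "\<partial> c = (\<lambda>k. if k = c then 1 else 0)"

definition vector_field :: "nat \<Rightarrow> (point \<Rightarrow> tvec) \<Rightarrow> bool" where
  "vector_field n W \<longleftrightarrow> (\<forall>P\<in>X_mfd n. \<forall>c. c \<notin> coords n \<longrightarrow> W P c = 0)"

text \<open>
  \<open>\<gamma>\<close> is a curve in the manifold, defined near the parameter value \<open>t\<close>, whose velocity at \<open>t\<close>
  is \<open>w\<close>. Continuity of the \<open>p\<^sub>i\<close> means that no jump between the two square roots occurs.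
\<close>

definition has_velocity :: "nat \<Rightarrow> (complex \<Rightarrow> point) \<Rightarrow> complex \<Rightarrow> tvec \<Rightarrow> bool" where
  "has_velocity n \<gamma> t w \<longleftrightarrow>
     (\<forall>\<^sub>F s in nhds t. \<gamma> s \<in> X_mfd n) \<and>
     (\<forall>c. ((\<lambda>s. coord_val c (\<gamma> s)) has_field_derivative w c) (at t)) \<and>
     (\<forall>i. isCont (\<lambda>s. root_val i (\<gamma> s)) t)"

definition meromorphic_on_CP1 :: "(complex \<Rightarrow> complex) \<Rightarrow> bool" where
  "meromorphic_on_CP1 f \<longleftrightarrow> f meromorphic_on UNIV \<and> (\<lambda>z. f (inverse z)) meromorphic_on {0}"

text \<open>
  The coefficient of \<open>dx \<and> dt\<close> in the curvature of \<open>d - A(x,t) dx - B(x,t) dt\<close>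
  vanishes at \<open>(x, t)\<close>.
\<close>

definition flat_at ::
  "(complex \<Rightarrow> complex \<Rightarrow> complex^2^2) \<Rightarrow> (complex \<Rightarrow> complex \<Rightarrow> complex^2^2)
     \<Rightarrow> complex \<Rightarrow> complex \<Rightarrow> bool" where
  "flat_at A B x t \<longleftrightarrow>
     (\<chi> k l. deriv (\<lambda>s. A x s $ k $ l) t) - (\<chi> k l. deriv (\<lambda>y. B y t $ k $ l) x)
       + (A x t ** B x t - B x t ** A x t) = 0"

definition companion :: "complex \<Rightarrow> complex^2^2" where
  "companion z = vector [vector [0, 1], vector [z, 0]]"

text \<open>
  Here \<open>B\<close> is a function of \<open>x\<close> and of the point of the manifold; along a flow line \<open>\<gamma>\<close> it
  becomes the matrix \<open>B(x, \<gamma>(t))\<close>. Since flatness involves no derivative of \<open>B\<close> in the flow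
  direction and only the first derivative of \<open>Q\<close>, it is required for every curve \<open>\<gamma>\<close> at every
  parameter value \<open>t\<close> where \<open>\<gamma>\<close> has the velocity prescribed by the vector field, in particular
  everywhere along integral curves. The values of a meromorphic function at its poles being
  meaningless, the equation is required away from the \<open>q\<^sub>i\<close> (the poles of \<open>Q\<close>) and at the points
  where all entries of \<open>B\<close> are analytic.
\<close>

definition isomonodromic :: "nat \<Rightarrow> complex \<Rightarrow> (point \<Rightarrow> tvec) \<Rightarrow> bool" where
  "isomonodromic n lam W \<longleftrightarrow>
     vector_field n W \<and>
     (\<exists>B :: complex \<Rightarrow> point \<Rightarrow> complex^2^2.
        (\<forall>P\<in>X_mfd n. \<forall>k l. meromorphic_on_CP1 (\<lambda>x. B x P $ k $ l)) \<and>
        (\<forall>\<gamma> t. has_velocity n \<gamma> t (W (\<gamma> t)) \<longrightarrow>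
           (\<forall>x. (\<forall>i\<in>{1..n}. x \<noteq> coord_val (Cq i) (\<gamma> t)) \<and>
                (\<forall>k l. (\<lambda>y. B y (\<gamma> t) $ k $ l) analytic_on {x}) \<longrightarrow>
              flat_at (\<lambda>y s. companion (Q_pot n lam (\<gamma> s) y)) (\<lambda>y s. B y (\<gamma> s)) x t)))"

definition T_fun :: "nat \<Rightarrow> (nat \<Rightarrow> complex) \<Rightarrow> nat \<Rightarrow> complex \<Rightarrow> complex" where
  "T_fun n a j x = (2 * of_nat j - 1) * x ^ (n - j)
     + (\<Sum>k=1..n - j - 1. (2 * of_nat j + of_nat k) * a (n - k + 1) * x ^ (n - j - 1 - k))"

fun U0 :: "nat \<Rightarrow> nat \<Rightarrow> point \<Rightarrow> tvec" where
  "U0 n i (a, b, q, v, p) = - (\<Sum>j=1..n. (q j ^ (i - 1) / (2 * p j)) *\<^sub>T \<partial> (Cv j))"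

fun U1 :: "nat \<Rightarrow> nat \<Rightarrow> point \<Rightarrow> tvec" where
  "U1 n i (a, b, q, v, p) = \<partial> (Cb i)"

fun V0 :: "nat \<Rightarrow> nat \<Rightarrow> point \<Rightarrow> tvec" where
  "V0 n i (a, b, q, v, p) =
     (- 2 * p i) *\<^sub>T \<partial> (Cq i)
     - (\<Sum>j\<in>{1..n} - {i}.
          ((\<Sum>k=1..n. T_fun n a k (q i) * q j ^ (k + n - 1)) / (2 * p j)
            + poly (pderiv (Q0 n a b)) (q j) / (2 * p j * (q i - q j))
            + p j / (q i - q j) ^ 2) *\<^sub>T \<partial> (Cv j))
     - ((\<Sum>k=1..n. T_fun n a k (q i) * q i ^ (k + n - 1)) / (2 * p i)
          - poly (pderiv (Q0 n a b)) (q i) * v i / p i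
          + deriv (R_fun n q v p) (q i)
          - (\<Sum>j\<in>{1..n} - {i}. p j / (q i - q j) ^ 2)) *\<^sub>T \<partial> (Cv i)"

fun V1 :: "nat \<Rightarrow> nat \<Rightarrow> point \<Rightarrow> tvec" where
  "V1 n i (a, b, q, v, p) =
     (\<Sum>j=1..n. T_fun n a j (q i) *\<^sub>T \<partial> (Ca j))
     - (2 * v i) *\<^sub>T \<partial> (Cq i)
     + (\<Sum>j\<in>{1..n} - {i}. (1 / (q i - q j)) *\<^sub>T \<partial> (Cq j))
     - (\<Sum>j\<in>{1..n} - {i}.
          (3 / (2 * (q i - q j) ^ 3) + v j / (q i - q j) ^ 2) *\<^sub>T \<partial> (Cv j))
     + ((\<Sum>j\<in>{1..n} - {i}. 3 / (2 * (q i - q j) ^ 3))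
          + (\<Sum>j\<in>{1..n} - {i}. v j / (q i - q j) ^ 2)
          - deriv (S_fun n q v) (q i)) *\<^sub>T \<partial> (Cv i)"

definition U_flow :: "nat \<Rightarrow> complex \<Rightarrow> nat \<Rightarrow> point \<Rightarrow> tvec" where
  "U_flow n lam i P = U0 n i P + lam *\<^sub>T U1 n i P"

definition V_flow :: "nat \<Rightarrow> complex \<Rightarrow> nat \<Rightarrow> point \<Rightarrow> tvec" where
  "V_flow n lam i P = V0 n i P + lam *\<^sub>T V1 n i P"

definition flow_frame :: "nat \<Rightarrow> complex \<Rightarrow> point \<Rightarrow> tvec set" where
  "flow_frame n lam P = (\<lambda>i. U_flow n lam i P) ` {1..n} \<union> (\<lambda>i. V_flow n lam i P) ` {1..n}"

end

theory Submission
  imports Defs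
begin

text \<open>
  With \<open>u\<^sub>i = p\<^sub>i / \<lambda> + v\<^sub>i\<close> the potential is \<open>\<lambda>\<^sup>-\<^sup>2 P(x) + \<Sum>\<^sub>i (3/4 (x - q\<^sub>i)\<^sup>-\<^sup>2 + u\<^sub>i (x - q\<^sub>i)\<^sup>-\<^sup>1) + G(x)\<close>, where
  \<open>P\<close> consists of the powers of \<open>Q\<^sub>0\<close> from \<open>x\<^sup>n\<close> upwards and \<open>G\<close> has degree less than \<open>n\<close> and is
  determined by the condition that the constant term of the Laurent expansion at \<open>q\<^sub>i\<close> is
  \<open>u\<^sub>i\<^sup>2\<close>. So \<open>Q\<close> depends on \<open>(a, q, u)\<close> only, and the flows \<open>U\<^sub>i\<close> span the directions in which
  it is constant.

  Let \<open>A\<close> solve \<open>dQ/dt = Q' A + 2 Q A' - A''' / 2\<close>. The indicial equations show that \<open>A\<close> has no poles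
  except simple ones at the \<open>q\<^sub>i\<close>, and, since \<open>Q\<close> has odd degree at infinity, that \<open>A\<close> vanishes there;
  hence \<open>A = \<Sum>\<^sub>i \<alpha>\<^sub>i / (x - q\<^sub>i)\<close>. Conversely, \<open>A = \<lambda> / (x - q\<^sub>i)\<close> belongs to \<open>V\<^sub>i\<close>: the difference of
  the two sides is regular, vanishes at all \<open>n\<close> points \<open>q\<^sub>j\<close>, and is \<open>O(x\<^sup>n\<^sup>-\<^sup>1)\<close> at infinity, so it is
  zero. The \<open>a\<close>-components \<open>T\<^sub>j(q\<^sub>i)\<close> of the \<open>V\<^sub>i\<close> form, up to a triangular matrix, a Vandermonde matrix,
  which gives linear independence.
\<close>

section \<open>Lagrange interpolation and Liouville's theorem\<close>

text \<open>Flatness involves no derivative of \<open>B\<close> along the flow, so everything is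
  decided at one point: \<open>Qdot\<close> is linear in the tangent vector, and the question is
  which vectors it sends into the span of the \<open>vE i\<close>. The obstacle is that
  \<open>G\<close> is interpolated at moving nodes. Its variation is not computed from that formula.
  Differentiating the relation between \<open>G(q_i)\<close> and \<open>u_i^2\<close> along a curve
  gives \<open>n\<close> values at fixed nodes, which suffice for degree less than \<open>n\<close>.
  The same relation makes the defect vanish at the nodes. Behind the indicial equations: if
  \<open>Q\<close> has double-pole coefficient \<open>kappa\<close>, a pole \<open>(x - z)^m\<close>
  of \<open>A\<close> needs \<open>4 kappa (m - 1) = m (m - 1) (m - 2)\<close>. For
  \<open>kappa = 0\<close> the roots are 0, 1, 2; for \<open>kappa = 3/4\<close> they are -1, 1, 3.
  At infinity, \<open>A ~ x^(-m)\<close> with \<open>m \<le> 0\<close> would force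
  \<open>2 n + 1 = 2 m\<close>. The numbers \<open>T_j(c)\<close> are the coefficients of
  \<open>x^n, ..., x^(2n-1)\<close> in the expansion of \<open>P'/(x - c) - 2 P/(x - c)^2\<close> at
  infinity. Completeness also needs a curve through each point with prescribed velocity, hence the
  openness of the conditions defining the manifold.\<close>

definition lagr :: "nat \<Rightarrow> (nat \<Rightarrow> complex) \<Rightarrow> nat \<Rightarrow> complex \<Rightarrow> complex" where
  "lagr n q i x = (\<Prod>j\<in>{1..n} - {i}. (x - q j) / (q i - q j))"

text \<open>Restricting coefficients instead of \<open>degree\<close> gives a linear space
  containing zero for every \<open>n\<close>. Functions are used because \<open>R_fun\<close> and
  \<open>S_fun\<close> are given as functions, not as polynomials.\<close>

definition polyfun_less :: "nat \<Rightarrow> (complex \<Rightarrow> complex) \<Rightarrow> bool" where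
  "polyfun_less n f \<longleftrightarrow> (\<exists>r. (\<forall>k\<ge>n. coeff r k = 0) \<and> f = poly r)"

lemma polyfun_less_add:
  assumes "polyfun_less n f" "polyfun_less n g"
  shows "polyfun_less n (\<lambda>x. f x + g x)"
proof -
  obtain r s where "\<forall>k\<ge>n. coeff r k = 0" "f = poly r" "\<forall>k\<ge>n. coeff s k = 0" "g = poly s"
    using assms unfolding polyfun_less_def by auto
  then show ?thesis
    unfolding polyfun_less_def by (intro exI[of _ "r + s"]) (auto simp: fun_eq_iff)
qed

lemma polyfun_less_cmult:
  assumes "polyfun_less n f"
  shows "polyfun_less n (\<lambda>x. c * f x)"
proof -
  obtain r where "\<forall>k\<ge>n. coeff r k = 0" "f = poly r"
    using assms unfolding polyfun_less_def by auto
  then show ?thesis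
    unfolding polyfun_less_def by (intro exI[of _ "smult c r"]) (auto simp: fun_eq_iff)
qed

lemma polyfun_less_divide: "polyfun_less n f \<Longrightarrow> polyfun_less n (\<lambda>x. f x / c)"
  using polyfun_less_cmult[of n f "1/c"] by simp

lemma polyfun_less_zero: "polyfun_less n (\<lambda>x. 0)"
  unfolding polyfun_less_def by (intro exI[of _ 0]) auto

lemma polyfun_less_sum:
  "(\<And>i. i \<in> I \<Longrightarrow> polyfun_less n (f i)) \<Longrightarrow> polyfun_less n (\<lambda>x. \<Sum>i\<in>I. f i x)"
  by (induction I rule: infinite_finite_induct) (auto intro: polyfun_less_zero polyfun_less_add)

lemma polyfun_less_power: "k < n \<Longrightarrow> polyfun_less n (\<lambda>x. x ^ k)"
  unfolding polyfun_less_def by (intro exI[of _ "monom 1 k"]) (auto simp: fun_eq_iff poly_monom)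

lemma polyfun_less_lagr:
  assumes "i \<in> {1..n}"
  shows "polyfun_less n (lagr n q i)"
proof -
  define r where "r = (\<Prod>j\<in>{1..n} - {i}. [:- q j / (q i - q j), 1 / (q i - q j):])"
  have deg: "degree [:c, d:] \<le> 1" for c d :: complex
    using degree_pCons_le[of c "[:d:]"] degree_pCons_0[of d] by simp
  have "degree r \<le> (\<Sum>j\<in>{1..n} - {i}. 1)"
    unfolding r_def
    by (rule order_trans[OF degree_prod_sum_le sum_mono]) (simp_all add: deg[unfolded One_nat_def])
  also have "\<dots> < n"
    using assms by auto
  finally have "\<forall>k\<ge>n. coeff r k = 0"
    by (auto intro!: coeff_eq_0)
  moreover have "lagr n q i = poly r"
    by (auto simp: fun_eq_iff lagr_def r_def poly_prod diff_divide_distrib intro!: prod.cong)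
  ultimately show ?thesis
    unfolding polyfun_less_def by blast
qed

lemma polyfun_less_eq:
  assumes "polyfun_less n f" "polyfun_less n g" "\<And>x. x \<in> A \<Longrightarrow> f x = g x" "card A \<ge> n" "n > 0"
  shows "f = g"
proof -
  obtain r s where r: "\<forall>k\<ge>n. coeff r k = 0" "f = poly r" and s: "\<forall>k\<ge>n. coeff s k = 0" "g = poly s"
    using assms unfolding polyfun_less_def by auto
  have "degree r < n" "degree s < n"
    using degree_le[of "n - 1" r] degree_le[of "n - 1" s] r(1) s(1) \<open>n > 0\<close> by auto
  then have "r = s"
    using assms r s by (intro poly_eqI_degree[of A]) auto
  then show ?thesis
    using r s by simp
qed

lemma lagr_at:
  assumes "inj_on q {1..n}" "i \<in> {1..n}" "j \<in> {1..n}"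
  shows "lagr n q i (q j) = (if i = j then 1 else 0)"
proof (cases "i = j")
  case True
  have "q j - q k \<noteq> 0" if "k \<in> {1..n} - {j}" for k
    using that inj_onD[OF assms(1), of j k] assms(3) by auto
  then have "lagr n q j (q j) = 1"
    unfolding lagr_def by (intro prod.neutral) simp
  then show ?thesis
    using True by simp
next
  case False
  then have "j \<in> {1..n} - {i}" "(q j - q j) / (q i - q j) = 0"
    using assms by auto
  then have "lagr n q i (q j) = 0"
    unfolding lagr_def by (intro prod_zero) blast+
  then show ?thesis
    using False by simp
qed

lemma sum_lagr_at:
  assumes "inj_on q {1..n}" "j \<in> {1..n}"
  shows "(\<Sum>i=1..n. c i * lagr n q i (q j)) = c j"
proof -
  have "(\<Sum>i=1..n. c i * lagr n q i (q j)) = (\<Sum>i=1..n. if i = j then c i else 0)"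
    using assms by (intro sum.cong) (auto simp: lagr_at)
  then show ?thesis
    using assms by simp
qed

lemma polyfun_less_sum_lagr: "polyfun_less n (\<lambda>x. \<Sum>i=1..n. c i * lagr n q i x)"
  by (intro polyfun_less_sum polyfun_less_cmult polyfun_less_lagr)

lemma lagr_interpolation:
  assumes "polyfun_less n f" "inj_on q {1..n}" "n > 0"
  shows "f x = (\<Sum>i=1..n. f (q i) * lagr n q i x)"
proof -
  have "f = (\<lambda>x. \<Sum>i=1..n. f (q i) * lagr n q i x)"
  proof (rule polyfun_less_eq[where A = "q ` {1..n}"])
    show "n \<le> card (q ` {1..n})"
      using assms by (simp add: card_image)
  next
    fix x assume "x \<in> q ` {1..n}"
    then show "f x = (\<Sum>i=1..n. f (q i) * lagr n q i x)"
      using assms sum_lagr_at[of q n _ "\<lambda>i. f (q i)"] by auto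
  qed (use assms polyfun_less_sum_lagr in auto)
  then show ?thesis
    by metis
qed

lemma polyfun_less_differentiable:
  assumes "polyfun_less n f"
  shows "(f has_field_derivative deriv f x) (at x)"
proof -
  obtain r where "f = poly r"
    using assms unfolding polyfun_less_def by auto
  then show ?thesis
    using poly_DERIV[of r x] DERIV_imp_deriv by metis
qed

lemma polyfun_less_holomorphic: "polyfun_less n f \<Longrightarrow> f holomorphic_on A"
  using polyfun_less_differentiable
  by (meson field_differentiable_at_within field_differentiable_def holomorphic_on_def)

lemma lagr_has_field_derivative: "i \<in> {1..n} \<Longrightarrow> (lagr n q i has_field_derivative deriv (lagr n q i) x) (at x)"
  using polyfun_less_differentiable polyfun_less_lagr by blast

lemma polyfun_less_deriv:
  assumes "polyfun_less n f"
  shows "polyfun_less n (deriv f)"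
proof -
  obtain r where r: "\<forall>k\<ge>n. coeff r k = 0" "f = poly r"
    using assms unfolding polyfun_less_def by auto
  have "deriv f = poly (pderiv r)"
    using r(2) by (auto intro!: DERIV_imp_deriv poly_DERIV)
  moreover have "\<forall>k\<ge>n. coeff (pderiv r) k = 0"
    using r(1) by (auto simp: coeff_pderiv)
  ultimately show ?thesis
    unfolding polyfun_less_def by blast
qed

lemma power_bigo_power_at_infinity:
  assumes "j \<le> k"
  shows "(\<lambda>x::complex. x ^ j) \<in> O[at_infinity](\<lambda>x. x ^ k)"
proof (rule bigoI[of _ 1])
  have "\<forall>\<^sub>F x::complex in at_infinity. norm x \<ge> 1"
    by (auto simp: eventually_at_infinity)
  then show "\<forall>\<^sub>F x::complex in at_infinity. norm (x ^ j) \<le> 1 * norm (x ^ k)"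
    by eventually_elim (simp add: norm_power power_increasing assms)
qed

lemma polyfun_less_bigo:
  assumes "polyfun_less (Suc k) f"
  shows "f \<in> O[at_infinity](\<lambda>x. x ^ k)"
proof -
  obtain r where r: "\<forall>j\<ge>Suc k. coeff r j = 0" "f = poly r"
    using assms unfolding polyfun_less_def by auto
  have "f = (\<lambda>x. \<Sum>i\<le>degree r. coeff r i * x ^ i)"
    using r by (auto simp: fun_eq_iff poly_altdef)
  also have "\<dots> \<in> O[at_infinity](\<lambda>x. x ^ k)"
  proof (rule big_sum_in_bigo)
    fix i
    show "(\<lambda>x. coeff r i * x ^ i) \<in> O[at_infinity](\<lambda>x. x ^ k)"
      using r(1) by (cases "i \<le> k") (auto intro!: power_bigo_power_at_infinity)
  qed
  finally show ?thesis .
qed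

text \<open>Liouville's theorem, extended over the removable singularities at the nodes.\<close>
lemma zero_of_bigo_vanishing:
  assumes "n > 0" "inj_on q {1..n}"
    and hol: "D holomorphic_on - q ` {1..n}"
    and lim: "\<And>i. i \<in> {1..n} \<Longrightarrow> (D \<longlongrightarrow> 0) (at (q i))"
    and big: "D \<in> O[at_infinity](\<lambda>x. x ^ (n - 1))"
    and x: "x \<notin> q ` {1..n}"
  shows "D x = 0"
proof -
  let ?K = "q ` {1..n}"
  define h where "h = (\<lambda>x. if x \<in> ?K then 0 else D x)"
  have hol_h: "h holomorphic_on UNIV"
  proof (rule no_isolated_singularity'[of ?K])
    fix z assume z: "z \<in> ?K"
    then have "(D \<longlongrightarrow> 0) (at z)"
      using lim by auto
    moreover have "\<forall>\<^sub>F w in at z. D w = h w"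
    proof -
      have "open (- (?K - {z}))"
        by (intro open_Compl finite_imp_closed) auto
      then have "\<forall>\<^sub>F w in at z. w \<in> - (?K - {z}) - {z}"
        using eventually_at_in_open[of "- (?K - {z})" z] by auto
      then show ?thesis
        by eventually_elim (auto simp: h_def)
    qed
    ultimately have "(h \<longlongrightarrow> 0) (at z)"
      using Lim_transform_eventually by blast
    then show "(h \<longlongrightarrow> h z) (at z)"
      using z by (simp add: h_def)
  next
    have "h holomorphic_on - ?K \<longleftrightarrow> D holomorphic_on - ?K"
      by (intro holomorphic_cong) (auto simp: h_def)
    then show "h holomorphic_on UNIV - ?K"
      using hol by (simp add: Compl_eq_Diff_UNIV)
  qed auto
  obtain C where C: "\<forall>\<^sub>F x in at_infinity. norm (D x) \<le> C * norm (x ^ (n - 1))"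
    using landau_o.bigE[OF big] by blast
  then obtain R where R: "\<And>x. norm x \<ge> R \<Longrightarrow> norm (D x) \<le> C * norm x ^ (n - 1)"
    by (auto simp: eventually_at_infinity norm_power)
  \<comment> \<open>\<open>max C 0\<close> keeps the bound valid at the nodes, where
    \<open>h\<close> is 0, whatever the sign of \<open>C\<close>.\<close>
  have C0: "norm (h x) \<le> max C 0 * norm x ^ (n - 1)" if "norm x \<ge> R" for x
  proof (cases "x \<in> ?K")
    case False
    then have "norm (h x) \<le> C * norm x ^ (n - 1)"
      using R[OF that] by (simp add: h_def)
    also have "\<dots> \<le> max C 0 * norm x ^ (n - 1)"
      by (intro mult_right_mono) auto
    finally show ?thesis .
  qed (simp add: h_def)
  have h_eq: "h \<xi> = (\<Sum>k\<le>n - 1. (deriv ^^ k) h 0 / fact k * \<xi> ^ k)" for \<xi>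
    using Liouville_polynomial[OF hol_h C0] by blast
  have "polyfun_less n (\<lambda>\<xi>. \<Sum>k\<le>n - 1. (deriv ^^ k) h 0 / fact k * \<xi> ^ k)"
    using \<open>n > 0\<close> by (intro polyfun_less_sum polyfun_less_cmult polyfun_less_power) auto
  then have poly_h: "polyfun_less n h"
    unfolding h_eq[abs_def, symmetric] .
  have "h = (\<lambda>x. 0)"
    by (rule polyfun_less_eq[OF poly_h polyfun_less_zero, of ?K])
       (use assms in \<open>auto simp: h_def card_image\<close>)
  then show ?thesis
    using x by (metis h_def)
qed

section \<open>The potential and its variation\<close>

definition topP :: "nat \<Rightarrow> (nat \<Rightarrow> complex) \<Rightarrow> complex \<Rightarrow> complex" where
  "topP n a x = x ^ (2 * n + 1) + (\<Sum>j=1..n. a j * x ^ (n + j - 1))"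

definition dtopP :: "nat \<Rightarrow> (nat \<Rightarrow> complex) \<Rightarrow> complex \<Rightarrow> complex" where
  "dtopP n a x = of_nat (2 * n + 1) * x ^ (2 * n) + (\<Sum>j=1..n. a j * (of_nat (n + j - 1) * x ^ (n + j - 2)))"

text \<open>This is \<open>G\<close> of the overview. The \<open>b\<close>-part of \<open>Q0\<close>
  joins \<open>R\<close> and \<open>S\<close> because all three have degree less than
  \<open>n\<close>, so that their sum is determined by its values at the nodes.\<close>

definition lowP ::
  "nat \<Rightarrow> complex \<Rightarrow> (nat \<Rightarrow> complex) \<Rightarrow> (nat \<Rightarrow> complex) \<Rightarrow> (nat \<Rightarrow> complex) \<Rightarrow> (nat \<Rightarrow> complex)
     \<Rightarrow> complex \<Rightarrow> complex" where
  "lowP n lam b q v p x =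
     (\<Sum>j=1..n. b j * x ^ (j - 1)) / lam ^ 2 + R_fun n q v p x / lam + S_fun n q v x"

lemma poly_Q0: "poly (Q0 n a b) x = topP n a x + (\<Sum>j=1..n. b j * x ^ (j - 1))"
  by (simp add: Q0_def topP_def poly_monom poly_sum)

lemma power_has_field_derivative:
  "((\<lambda>x::complex. x ^ k) has_field_derivative of_nat k * x ^ (k - 1)) (at x)"
  by (auto intro!: derivative_eq_intros)

lemma topP_has_field_derivative: "(topP n a has_field_derivative dtopP n a x) (at x)"
proof -
  have "((\<lambda>x. x ^ (2 * n + 1) + (\<Sum>j=1..n. a j * x ^ (n + j - 1))) has_field_derivative
     of_nat (2 * n + 1) * x ^ (2 * n + 1 - 1)
       + (\<Sum>j=1..n. a j * (of_nat (n + j - 1) * x ^ (n + j - 1 - 1)))) (at x)"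
    by (intro DERIV_add DERIV_sum DERIV_cmult power_has_field_derivative)
  then show ?thesis
    unfolding topP_def[abs_def] dtopP_def by (simp add: diff_diff_add numeral_2_eq_2)
qed

text \<open>At \<open>j = 1\<close> the exponent \<open>j - 2\<close> is truncated to 0, which is
  harmless because of the factor \<open>of_nat (j - 1)\<close>.\<close>

lemma poly_pderiv_Q0:
  "poly (pderiv (Q0 n a b)) x = dtopP n a x + (\<Sum>j=1..n. b j * (of_nat (j - 1) * x ^ (j - 2)))"
proof -
  have "((\<lambda>x. topP n a x + (\<Sum>j=1..n. b j * x ^ (j - 1))) has_field_derivative
          dtopP n a x + (\<Sum>j=1..n. b j * (of_nat (j - 1) * x ^ (j - 1 - 1)))) (at x)"
    by (intro DERIV_add DERIV_sum DERIV_cmult power_has_field_derivative topP_has_field_derivative)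
  then have "((\<lambda>x. topP n a x + (\<Sum>j=1..n. b j * x ^ (j - 1))) has_field_derivative
          dtopP n a x + (\<Sum>j=1..n. b j * (of_nat (j - 1) * x ^ (j - 2)))) (at x)"
    by (simp add: diff_diff_add numeral_2_eq_2)
  moreover have "poly (Q0 n a b) = (\<lambda>x. topP n a x + (\<Sum>j=1..n. b j * x ^ (j - 1)))"
    by (simp add: fun_eq_iff poly_Q0)
  ultimately show ?thesis
    using poly_DERIV[of "Q0 n a b" x] by (auto dest: DERIV_unique)
qed

lemma R_fun_eq: "R_fun n q v p x =
    (\<Sum>i=1..n. (2 * p i * v i - (\<Sum>k\<in>{1..n} - {i}. p k / (q i - q k))) * lagr n q i x)"
  by (simp add: R_fun_def lagr_def)

lemma S_fun_eq: "S_fun n q v x =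
    (\<Sum>i=1..n. (v i ^ 2 - (\<Sum>k\<in>{1..n} - {i}. 3 / (4 * (q i - q k) ^ 2))
                  - (\<Sum>k\<in>{1..n} - {i}. v k / (q i - q k))) * lagr n q i x)"
  by (simp add: S_fun_def lagr_def)

lemma polyfun_less_R_fun: "polyfun_less n (R_fun n q v p)"
  unfolding R_fun_eq[abs_def] by (rule polyfun_less_sum_lagr)

lemma polyfun_less_S_fun: "polyfun_less n (S_fun n q v)"
  unfolding S_fun_eq[abs_def] by (rule polyfun_less_sum_lagr)

lemma polyfun_less_lowP: "polyfun_less n (lowP n lam b q v p)"
  unfolding lowP_def[abs_def]
  by (intro polyfun_less_add polyfun_less_divide polyfun_less_sum polyfun_less_cmult
            polyfun_less_power polyfun_less_R_fun polyfun_less_S_fun) auto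

lemma Q_pot_eq:
  "Q_pot n lam (a, b, q, v, p) x =
     topP n a x / lam ^ 2 + (\<Sum>i=1..n. 3 / (4 * (x - q i) ^ 2) + (p i / lam + v i) / (x - q i))
       + lowP n lam b q v p x"
proof -
  have "(\<Sum>i=1..n. 3 / (4 * (x - q i) ^ 2) + (p i / lam + v i) / (x - q i)) =
     (\<Sum>i=1..n. p i / (x - q i)) / lam + (\<Sum>i=1..n. 3 / (4 * (x - q i) ^ 2)) + (\<Sum>i=1..n. v i / (x - q i))"
    by (simp add: sum_divide_distrib sum.distrib add_divide_distrib mult.commute)
  then show ?thesis
    by (simp add: Q1_def Q2_def lowP_def poly_Q0 add_divide_distrib)
qed

text \<open>One point of the manifold is fixed, and every statement about a vector field is reduced
  to its value there.\<close>

locale oscillator =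
  fixes n :: nat and lam :: complex and a b q v p :: "nat \<Rightarrow> complex"
  assumes n_pos: "n > 0" and lam_nz: "lam \<noteq> 0" and pt_in_X: "(a, b, q, v, p) \<in> X_mfd n"
begin

lemma inj_q: "inj_on q {1..n}"
  and p_nz: "i \<in> {1..n} \<Longrightarrow> p i \<noteq> 0"
  and p_square: "i \<in> {1..n} \<Longrightarrow> p i ^ 2 = topP n a (q i) + (\<Sum>j=1..n. b j * q i ^ (j - 1))"
  using pt_in_X by (auto simp: X_mfd_def poly_Q0)

lemma q_diff_nz: "i \<in> {1..n} \<Longrightarrow> j \<in> {1..n} \<Longrightarrow> i \<noteq> j \<Longrightarrow> q i - q j \<noteq> 0"
  using inj_onD[OF inj_q] by auto

definition u :: "nat \<Rightarrow> complex" where "u i = p i / lam + v i"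

abbreviation G :: "complex \<Rightarrow> complex" where "G \<equiv> lowP n lam b q v p"

definition K :: "nat \<Rightarrow> complex \<Rightarrow> complex" where
  "K i x = topP n a x / lam ^ 2
     + (\<Sum>k\<in>{1..n} - {i}. 3 / (4 * (x - q k) ^ 2) + u k / (x - q k)) + G x"

abbreviation Qf :: "complex \<Rightarrow> complex" where "Qf \<equiv> Q_pot n lam (a, b, q, v, p)"

lemma Qf_eq: "Qf x = topP n a x / lam ^ 2 + (\<Sum>i=1..n. 3 / (4 * (x - q i) ^ 2) + u i / (x - q i)) + G x"
  by (simp only: Q_pot_eq u_def)

lemma Qf_split:
  assumes "i \<in> {1..n}"
  shows "Qf x = 3 / (4 * (x - q i) ^ 2) + u i / (x - q i) + K i x"
  using assms unfolding Qf_eq K_def by (subst sum.remove[of _ i]) auto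

text \<open>The node values of the \<open>b\<close>-part, \<open>R_fun\<close> and
  \<open>S_fun\<close> supply the orders \<open>lam^(-2)\<close>, \<open>lam^(-1)\<close> and 1 of
  \<open>u_i^2 = p_i^2 / lam^2 + 2 p_i v_i / lam + v_i^2\<close>; the first uses
  \<open>p_i^2 = Q0(q_i)\<close>. This is the apparent singularity condition.\<close>

lemma G_at:
  assumes i: "i \<in> {1..n}"
  shows "G (q i) = u i ^ 2 - topP n a (q i) / lam ^ 2
           - (\<Sum>k\<in>{1..n} - {i}. 3 / (4 * (q i - q k) ^ 2) + u k / (q i - q k))"
proof -
  have "(\<Sum>j=1..n. b j * q i ^ (j - 1)) = p i ^ 2 - topP n a (q i)"
    using p_square[OF i] by simp
  moreover have "R_fun n q v p (q i) = 2 * p i * v i - (\<Sum>k\<in>{1..n} - {i}. p k / (q i - q k))"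
    unfolding R_fun_eq by (rule sum_lagr_at[OF inj_q i])
  moreover have "S_fun n q v (q i) = v i ^ 2 - (\<Sum>k\<in>{1..n} - {i}. 3 / (4 * (q i - q k) ^ 2))
                  - (\<Sum>k\<in>{1..n} - {i}. v k / (q i - q k))"
    unfolding S_fun_eq by (rule sum_lagr_at[OF inj_q i])
  moreover have "(\<Sum>k\<in>{1..n} - {i}. 3 / (4 * (q i - q k) ^ 2) + u k / (q i - q k)) =
      (\<Sum>k\<in>{1..n} - {i}. p k / (q i - q k)) / lam + (\<Sum>k\<in>{1..n} - {i}. 3 / (4 * (q i - q k) ^ 2))
      + (\<Sum>k\<in>{1..n} - {i}. v k / (q i - q k))"
    by (simp add: u_def sum_divide_distrib sum.distrib add_divide_distrib mult.commute)
  moreover have "u i ^ 2 = p i ^ 2 / lam ^ 2 + 2 * p i * v i / lam + v i ^ 2"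
    using lam_nz by (simp add: u_def power2_eq_square field_simps)
  ultimately show ?thesis
    unfolding lowP_def by (simp add: diff_divide_distrib)
qed

lemma K_at: "i \<in> {1..n} \<Longrightarrow> K i (q i) = u i ^ 2"
  unfolding K_def by (simp add: G_at)

text \<open>The linear coefficient of the Laurent expansion at \<open>q i\<close>, that is, the
  derivative of \<open>K i\<close> there.\<close>

definition c1 :: "nat \<Rightarrow> complex" where
  "c1 i = dtopP n a (q i) / lam ^ 2
     - (\<Sum>k\<in>{1..n} - {i}. 3 / (2 * (q i - q k) ^ 3) + u k / (q i - q k) ^ 2) + deriv G (q i)"

definition da :: "(coord \<Rightarrow> complex) \<Rightarrow> complex \<Rightarrow> complex" where
  "da w x = (\<Sum>j=1..n. w (Ca j) * x ^ (n + j - 1))"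

definition db :: "(coord \<Rightarrow> complex) \<Rightarrow> complex \<Rightarrow> complex" where
  "db w x = (\<Sum>j=1..n. w (Cb j) * x ^ (j - 1))"

text \<open>Implicit differentiation of \<open>p_i^2 = Q0(q_i)\<close>.\<close>

definition dp :: "(coord \<Rightarrow> complex) \<Rightarrow> nat \<Rightarrow> complex" where
  "dp w i = (poly (pderiv (Q0 n a b)) (q i) * w (Cq i) + da w (q i) + db w (q i)) / (2 * p i)"

definition du :: "(coord \<Rightarrow> complex) \<Rightarrow> nat \<Rightarrow> complex" where
  "du w i = dp w i / lam + w (Cv i)"

definition dpol :: "(coord \<Rightarrow> complex) \<Rightarrow> nat \<Rightarrow> complex \<Rightarrow> complex" where
  "dpol w i x = 3 * w (Cq i) / (2 * (x - q i) ^ 3) + u i * w (Cq i) / (x - q i) ^ 2 + du w i / (x - q i)"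

text \<open>Variation of \<open>G\<close> at the fixed point \<open>q i\<close>: the total
  derivative of the right-hand side of \<open>G_at\<close> along the motion, minus the contribution
  \<open>deriv G (q i)\<close> times the velocity of the node. The terms carrying that velocity are
  collected in \<open>c1\<close>.\<close>

definition dG :: "(coord \<Rightarrow> complex) \<Rightarrow> nat \<Rightarrow> complex" where
  "dG w i = 2 * u i * du w i - c1 i * w (Cq i) - da w (q i) / lam ^ 2 - (\<Sum>k\<in>{1..n} - {i}. dpol w k (q i))"

text \<open>The derivative of the potential in the direction of the tangent vector \<open>w\<close>.\<close>
definition Qdot :: "(coord \<Rightarrow> complex) \<Rightarrow> complex \<Rightarrow> complex" where
  "Qdot w x = da w x / lam ^ 2 + (\<Sum>i=1..n. dpol w i x) + (\<Sum>i=1..n. dG w i * lagr n q i x)"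

end

text \<open>The difference quotient of \<open>g = f^2\<close> is divided by
  \<open>f s + f t\<close>, which tends to \<open>2 * f t\<close>. Continuity of \<open>f\<close> at
  \<open>t\<close> is what keeps the branch.\<close>

lemma has_field_derivative_square_root:
  fixes f g :: "complex \<Rightarrow> complex"
  assumes g: "(g has_field_derivative d) (at t)" and fg: "\<forall>\<^sub>F s in nhds t. f s ^ 2 = g s"
    and f: "isCont f t" "f t \<noteq> 0"
  shows "(f has_field_derivative d / (2 * f t)) (at t)"
proof -
  have lim: "((\<lambda>s. f s + f t) \<longlongrightarrow> 2 * f t) (at t)"
    using f(1) tendsto_add[of f "f t" "at t" "\<lambda>_. f t" "f t"] by (simp add: isCont_def)
  have "((\<lambda>s. (g s - g t) / (s - t) / (f s + f t)) \<longlongrightarrow> d / (2 * f t)) (at t)"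
    using g f(2) lim by (intro tendsto_divide) (auto simp: has_field_derivative_iff)
  moreover have "\<forall>\<^sub>F s in at t. (g s - g t) / (s - t) / (f s + f t) = (f s - f t) / (s - t)"
  proof -
    have "\<forall>\<^sub>F s in at t. f s + f t \<noteq> 0"
      using lim f(2) by (intro tendsto_imp_eventually_ne[OF lim]) auto
    moreover have "\<forall>\<^sub>F s in at t. f s ^ 2 = g s"
      using fg by (simp add: eventually_at_filter eventually_mono)
    ultimately show ?thesis
    proof eventually_elim
      case (elim s)
      have "f t ^ 2 = g t"
        using fg eventually_nhds_x_imp_x by blast
      then have "g s - g t = (f s - f t) * (f s + f t)"
        using elim by (simp add: power2_eq_square algebra_simps flip: elim)
      then show ?case
        using elim by simp
    qed
  qed
  ultimately show ?thesis
    unfolding has_field_derivative_iff by (rule Lim_transform_eventually)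
qed

lemma field_differentiable_prod:
  fixes f :: "'i \<Rightarrow> complex \<Rightarrow> complex"
  assumes "\<And>i. i \<in> I \<Longrightarrow> f i field_differentiable (at x)"
  shows "(\<lambda>x. \<Prod>i\<in>I. f i x) field_differentiable (at x)"
  using assms by (induction I rule: infinite_finite_induct) (auto intro!: field_differentiable_mult)

text \<open>Only existence of the derivative is extracted from the explicit formula; its value is
  found later from the node conditions, so the moving Lagrange products are never differentiated
  explicitly.\<close>

lemma lowP_field_differentiable:
  fixes B Q V P :: "complex \<Rightarrow> nat \<Rightarrow> complex"
  assumes "\<And>i. i \<in> {1..n} \<Longrightarrow> (\<lambda>s. B s i) field_differentiable at t"
    "\<And>i. i \<in> {1..n} \<Longrightarrow> (\<lambda>s. Q s i) field_differentiable at t"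
    "\<And>i. i \<in> {1..n} \<Longrightarrow> (\<lambda>s. V s i) field_differentiable at t"
    "\<And>i. i \<in> {1..n} \<Longrightarrow> (\<lambda>s. P s i) field_differentiable at t"
    and inj: "inj_on (Q t) {1..n}"
  shows "(\<lambda>s. lowP n lam (B s) (Q s) (V s) (P s) x) field_differentiable at t"
proof -
  have nz: "Q t i - Q t j \<noteq> 0" if "i \<in> {1..n}" "j \<in> {1..n} - {i}" for i j
    using inj_onD[OF inj, of i j] that by auto
  have power: "(\<lambda>s. f s ^ k) field_differentiable at t" if "f field_differentiable at t"
    for f :: "complex \<Rightarrow> complex" and k
    using that by (induction k) (auto intro!: field_differentiable_mult)
  have lagr: "(\<lambda>s. lagr n (Q s) i x) field_differentiable at t" if "i \<in> {1..n}" for i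
    unfolding lagr_def
    using that nz assms
    by (intro field_differentiable_prod field_differentiable_divide field_differentiable_diff) auto
  have pole: "(\<lambda>s. f s / (Q s i - Q s j)) field_differentiable at t"
    if "i \<in> {1..n}" "j \<in> {1..n} - {i}" "f field_differentiable at t" for i j f
    using that nz assms by (intro field_differentiable_divide field_differentiable_diff) auto
  have pole2: "(\<lambda>s. 3 / (4 * (Q s i - Q s j) ^ 2)) field_differentiable at t"
    if "i \<in> {1..n}" "j \<in> {1..n} - {i}" for i j
    using that nz[OF that] assms
    by (intro field_differentiable_divide field_differentiable_mult power field_differentiable_diff) auto
  have div: "(\<lambda>s. f s / c) field_differentiable at t" if "f field_differentiable at t"
    for f :: "complex \<Rightarrow> complex" and c
    using field_differentiable_mult[OF that, of "\<lambda>_. 1/c"] by simp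
  show ?thesis
    unfolding lowP_def R_fun_eq S_fun_eq
    by (intro field_differentiable_add field_differentiable_sum field_differentiable_mult
          field_differentiable_diff div lagr pole pole2 power assms) auto
qed

lemma has_velocityD:
  assumes "has_velocity n \<gamma> t w"
    and "A = (\<lambda>s i. coord_val (Ca i) (\<gamma> s))" "B = (\<lambda>s i. coord_val (Cb i) (\<gamma> s))"
      "Q = (\<lambda>s i. coord_val (Cq i) (\<gamma> s))" "V = (\<lambda>s i. coord_val (Cv i) (\<gamma> s))"
      "P = (\<lambda>s i. root_val i (\<gamma> s))"
  shows "\<And>s. \<gamma> s = (A s, B s, Q s, V s, P s)"
    and "\<forall>\<^sub>F s in nhds t. (A s, B s, Q s, V s, P s) \<in> X_mfd n"
    and "\<And>i. ((\<lambda>s. A s i) has_field_derivative w (Ca i)) (at t)"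
    and "\<And>i. ((\<lambda>s. B s i) has_field_derivative w (Cb i)) (at t)"
    and "\<And>i. ((\<lambda>s. Q s i) has_field_derivative w (Cq i)) (at t)"
    and "\<And>i. ((\<lambda>s. V s i) has_field_derivative w (Cv i)) (at t)"
    and "\<And>i. isCont (\<lambda>s. P s i) t"
proof -
  show eq: "\<gamma> s = (A s, B s, Q s, V s, P s)" for s
    by (cases "\<gamma> s") (simp add: assms fun_eq_iff)
  show "\<forall>\<^sub>F s in nhds t. (A s, B s, Q s, V s, P s) \<in> X_mfd n"
    using assms(1) by (simp add: has_velocity_def flip: eq)
qed (use assms in \<open>auto simp: has_velocity_def\<close>)

context oscillator
begin

lemma sum_lagr_deriv:
  assumes "polyfun_less n f"
  shows "(\<Sum>k=1..n. f (q k) * deriv (lagr n q k) x) = deriv f x"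
proof -
  have "((\<lambda>y. \<Sum>k=1..n. f (q k) * lagr n q k y) has_field_derivative
          (\<Sum>k=1..n. f (q k) * deriv (lagr n q k) x)) (at x)"
    by (intro DERIV_sum DERIV_cmult lagr_has_field_derivative) auto
  then show ?thesis
    unfolding lagr_interpolation[OF assms inj_q n_pos, symmetric] by (rule DERIV_imp_deriv[symmetric])
qed

text \<open>
  The polynomial part is interpolated at the nodes \<open>q\<^sub>i\<close> of the base point; its derivative
  there follows from the apparent singularity condition \<open>K_at\<close> along the curve.
\<close>
lemma Q_pot_has_field_derivative:
  assumes vel: "has_velocity n \<gamma> t w" and pt: "\<gamma> t = (a, b, q, v, p)" and x: "x \<notin> q ` {1..n}"
  shows "((\<lambda>s. Q_pot n lam (\<gamma> s) x) has_field_derivative Qdot w x) (at t)"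
proof -
  define A where "A = (\<lambda>s i. coord_val (Ca i) (\<gamma> s))"
  define B where "B = (\<lambda>s i. coord_val (Cb i) (\<gamma> s))"
  define C where "C = (\<lambda>s i. coord_val (Cq i) (\<gamma> s))"
  define V where "V = (\<lambda>s i. coord_val (Cv i) (\<gamma> s))"
  define P where "P = (\<lambda>s i. root_val i (\<gamma> s))"
  note vels = has_velocityD[OF vel A_def B_def C_def V_def P_def]
  have at_t: "A t = a" "B t = b" "C t = q" "V t = v" "P t = p"
    by (simp_all add: A_def B_def C_def V_def P_def pt)
  note dA = vels(3) and dB = vels(4) and dC = vels(5) and dV = vels(6)
  have near: "\<forall>\<^sub>F s in nhds t. oscillator n lam (A s) (B s) (C s) (V s) (P s)"
    using vels(2) by eventually_elim (simp add: oscillator_def n_pos lam_nz)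

  have dtop: "((\<lambda>s. topP n (A s) (y s)) has_field_derivative dtopP n a (y t) * d + da w (y t)) (at t)"
    if "(y has_field_derivative d) (at t)" for y :: "complex \<Rightarrow> complex" and d
  proof -
    have 1: "((\<lambda>s. y s ^ k) has_field_derivative of_nat k * y t ^ (k - 1) * d) (at t)" for k
      using DERIV_chain2[OF power_has_field_derivative that] .
    have "((\<lambda>s. topP n (A s) (y s)) has_field_derivative
        of_nat (2 * n + 1) * y t ^ (2 * n + 1 - 1) * d
        + (\<Sum>j=1..n. w (Ca j) * y t ^ (n + j - 1) + of_nat (n + j - 1) * y t ^ (n + j - 1 - 1) * d * A t j)) (at t)"
      unfolding topP_def by (intro DERIV_add DERIV_sum DERIV_mult dA 1)
    moreover have "of_nat (2 * n + 1) * y t ^ (2 * n + 1 - 1) * d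
        + (\<Sum>j=1..n. w (Ca j) * y t ^ (n + j - 1) + of_nat (n + j - 1) * y t ^ (n + j - 1 - 1) * d * A t j)
        = dtopP n a (y t) * d + da w (y t)"
      by (simp add: dtopP_def da_def at_t sum.distrib distrib_left distrib_right sum_distrib_left sum_distrib_right
            diff_diff_add numeral_2_eq_2 mult_ac)
    ultimately show ?thesis
      by simp
  qed

  have dP: "((\<lambda>s. P s i) has_field_derivative dp w i) (at t)" if i: "i \<in> {1..n}" for i
  proof -
    have 1: "((\<lambda>s. C s i ^ k) has_field_derivative of_nat k * q i ^ (k - 1) * w (Cq i)) (at t)" for k
      using DERIV_chain2[OF power_has_field_derivative dC[of i]] by (simp add: at_t)
    have "((\<lambda>s. topP n (A s) (C s i) + (\<Sum>j=1..n. B s j * C s i ^ (j - 1))) has_field_derivative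
        (dtopP n a (q i) * w (Cq i) + da w (q i))
        + (\<Sum>j=1..n. w (Cb j) * C t i ^ (j - 1) + of_nat (j - 1) * q i ^ (j - 1 - 1) * w (Cq i) * B t j)) (at t)"
      using dtop[OF dC[of i]] by (intro DERIV_add DERIV_sum DERIV_mult dB 1) (simp add: at_t)
    moreover have "(dtopP n a (q i) * w (Cq i) + da w (q i))
        + (\<Sum>j=1..n. w (Cb j) * C t i ^ (j - 1) + of_nat (j - 1) * q i ^ (j - 1 - 1) * w (Cq i) * B t j)
        = poly (pderiv (Q0 n a b)) (q i) * w (Cq i) + da w (q i) + db w (q i)"
      by (simp add: poly_pderiv_Q0 db_def at_t sum.distrib distrib_left distrib_right sum_distrib_left sum_distrib_right
            diff_diff_add numeral_2_eq_2 mult_ac)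
    ultimately have "((\<lambda>s. topP n (A s) (C s i) + (\<Sum>j=1..n. B s j * C s i ^ (j - 1))) has_field_derivative
        poly (pderiv (Q0 n a b)) (q i) * w (Cq i) + da w (q i) + db w (q i)) (at t)"
      by (simp only:)
    then have "((\<lambda>s. P s i) has_field_derivative
       (poly (pderiv (Q0 n a b)) (q i) * w (Cq i) + da w (q i) + db w (q i)) / (2 * P t i)) (at t)"
    proof (rule has_field_derivative_square_root)
      show "\<forall>\<^sub>F s in nhds t. P s i ^ 2 = topP n (A s) (C s i) + (\<Sum>j=1..n. B s j * C s i ^ (j - 1))"
        using near by eventually_elim (rule oscillator.p_square[OF _ i])
      show "P t i \<noteq> 0"
        using p_nz[OF i] by (simp add: at_t)
    qed (rule vels(7))
    then show ?thesis
      by (simp add: dp_def at_t)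
  qed

  define U where "U = (\<lambda>s i. P s i / lam + V s i)"
  have U_t: "U t = u"
    by (simp add: U_def u_def at_t fun_eq_iff)
  have dU: "((\<lambda>s. U s i) has_field_derivative du w i) (at t)" if "i \<in> {1..n}" for i
    unfolding U_def du_def by (intro DERIV_add DERIV_cdivide dP dV that)
  have dpolar: "((\<lambda>s. 3 / (4 * (y s - C s k) ^ 2) + U s k / (y s - C s k)) has_field_derivative
       dpol w k (y t) - (3 / (2 * (y t - q k) ^ 3) + u k / (y t - q k) ^ 2) * d) (at t)"
    if "k \<in> {1..n}" "(y has_field_derivative d) (at t)" "y t \<noteq> q k" for y :: "complex \<Rightarrow> complex" and d k
  proof -
    have nz: "y t - q k \<noteq> 0"
      using that by simp
    have dz: "((\<lambda>s. y s - C s k) has_field_derivative d - w (Cq k)) (at t)"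
      by (intro DERIV_diff that dC)
    have "((\<lambda>z::complex. 3 / (4 * z ^ 2)) has_field_derivative - 3 / (2 * z ^ 3)) (at z)" if "z \<noteq> 0" for z
      using that by (auto intro!: derivative_eq_intros simp: field_simps power2_eq_square power3_eq_cube)
    then have "((\<lambda>s. 3 / (4 * (y s - C s k) ^ 2)) has_field_derivative
        - 3 / (2 * (y t - C t k) ^ 3) * (d - w (Cq k))) (at t)"
      using nz by (intro DERIV_chain2[where f = "\<lambda>z. 3 / (4 * z ^ 2)"] dz) (simp add: at_t)
    then have "((\<lambda>s. 3 / (4 * (y s - C s k) ^ 2) + U s k / (y s - C s k)) has_field_derivative
       - 3 / (2 * (y t - C t k) ^ 3) * (d - w (Cq k))
       + (du w k * (y t - C t k) - U t k * (d - w (Cq k))) / ((y t - C t k) * (y t - C t k))) (at t)"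
      using nz by (intro DERIV_add DERIV_divide dU[OF that(1)] dz) (simp_all add: at_t)
    then have "((\<lambda>s. 3 / (4 * (y s - C s k) ^ 2) + U s k / (y s - C s k)) has_field_derivative
       - 3 / (2 * (y t - q k) ^ 3) * (d - w (Cq k))
       + (du w k * (y t - q k) - u k * (d - w (Cq k))) / (y t - q k) ^ 2) (at t)"
      by (simp only: at_t U_t power2_eq_square)
    moreover have "- 3 / (2 * z ^ 3) * (d - e) + (f * z - g * (d - e)) / z ^ 2
       = 3 * e / (2 * z ^ 3) + g * e / z ^ 2 + f / z - (3 / (2 * z ^ 3) + g / z ^ 2) * d"
      if "z \<noteq> 0" for z e f g :: complex
      using that by (simp add: field_simps power2_eq_square power3_eq_cube)
    ultimately show ?thesis
      unfolding dpol_def using nz by (simp only: not_False_eq_True)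
  qed

  define L where "L = (\<lambda>s. lowP n lam (B s) (C s) (V s) (P s))"
  have L_t: "L t = G"
    by (simp add: L_def at_t)
  have poly_L: "polyfun_less n (L s)" for s
    unfolding L_def by (rule polyfun_less_lowP)
  define D where "D = (\<lambda>y. deriv (\<lambda>s. L s y) t)"
  have dL: "((\<lambda>s. L s y) has_field_derivative D y) (at t)" for y
  proof -
    have "(\<lambda>s. L s y) field_differentiable at t"
      unfolding L_def
    proof (rule lowP_field_differentiable)
      show "inj_on (C t) {1..n}"
        by (simp only: at_t inj_q)
    qed (use dB dC dV dP field_differentiable_def in blast)+
    then show ?thesis
      unfolding D_def by (simp add: DERIV_deriv_iff_field_differentiable)
  qed
  have interp: "L s y = (\<Sum>k=1..n. L s (q k) * lagr n q k y)" for s y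
    by (rule lagr_interpolation[OF poly_L inj_q n_pos])
  have D_interp: "D y = (\<Sum>k=1..n. D (q k) * lagr n q k y)" for y
  proof -
    have "((\<lambda>s. \<Sum>k=1..n. L s (q k) * lagr n q k y) has_field_derivative
        (\<Sum>k=1..n. D (q k) * lagr n q k y)) (at t)"
      by (intro DERIV_sum DERIV_cmult_right dL)
    then show ?thesis
      using dL[of y] interp[of _ y] DERIV_unique by fastforce
  qed
  have dG: "D (q i) = dG w i" if i: "i \<in> {1..n}" for i
  proof -
    have "((\<lambda>s. \<Sum>k=1..n. L s (q k) * lagr n q k (C s i)) has_field_derivative
        (\<Sum>k=1..n. D (q k) * lagr n q k (C t i) + deriv (lagr n q k) (C t i) * w (Cq i) * L t (q k))) (at t)"
      by (intro DERIV_sum DERIV_mult dL DERIV_chain2[OF lagr_has_field_derivative dC])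
    also have "(\<Sum>k=1..n. D (q k) * lagr n q k (C t i) + deriv (lagr n q k) (C t i) * w (Cq i) * L t (q k))
        = D (q i) + (\<Sum>k=1..n. G (q k) * deriv (lagr n q k) (q i)) * w (Cq i)"
      by (subst D_interp) (simp add: sum.distrib at_t L_t sum_distrib_left sum_distrib_right mult_ac)
    also have "\<dots> = D (q i) + deriv G (q i) * w (Cq i)"
      by (simp only: sum_lagr_deriv[OF polyfun_less_lowP])
    finally have 1: "((\<lambda>s. L s (C s i)) has_field_derivative D (q i) + deriv G (q i) * w (Cq i)) (at t)"
      by (simp only: interp[symmetric])
    have "((\<lambda>s. U s i ^ 2 - topP n (A s) (C s i) / lam ^ 2
           - (\<Sum>k\<in>{1..n} - {i}. 3 / (4 * (C s i - C s k) ^ 2) + U s k / (C s i - C s k)))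
        has_field_derivative of_nat 2 * U t i ^ (2 - 1) * du w i
          - (dtopP n a (C t i) * w (Cq i) + da w (C t i)) / lam ^ 2
          - (\<Sum>k\<in>{1..n} - {i}. dpol w k (C t i)
               - (3 / (2 * (C t i - q k) ^ 3) + u k / (C t i - q k) ^ 2) * w (Cq i))) (at t)"
    proof (intro DERIV_diff DERIV_sum DERIV_cdivide dtop dC)
      show "((\<lambda>s. (U s i)\<^sup>2) has_field_derivative of_nat 2 * U t i ^ (2 - 1) * du w i) (at t)"
        by (rule DERIV_chain2[OF power_has_field_derivative dU[OF i]])
    next
      fix k assume "k \<in> {1..n} - {i}"
      then show "((\<lambda>s. 3 / (4 * (C s i - C s k)\<^sup>2) + U s k / (C s i - C s k)) has_field_derivative
            dpol w k (C t i) - (3 / (2 * (C t i - q k) ^ 3) + u k / (C t i - q k)\<^sup>2) * w (Cq i)) (at t)"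
        using q_diff_nz[of i k] i by (intro dpolar dC) (auto simp: at_t)
    qed
    moreover have "\<forall>\<^sub>F s in nhds t. L s (C s i) = U s i ^ 2 - topP n (A s) (C s i) / lam ^ 2
           - (\<Sum>k\<in>{1..n} - {i}. 3 / (4 * (C s i - C s k) ^ 2) + U s k / (C s i - C s k))"
      using near
    proof eventually_elim
      case (elim s)
      then interpret s: oscillator n lam "A s" "B s" "C s" "V s" "P s" .
      show ?case
        using s.G_at[OF i] by (simp add: L_def U_def s.u_def)
    qed
    ultimately have "((\<lambda>s. L s (C s i)) has_field_derivative of_nat 2 * U t i ^ (2 - 1) * du w i
          - (dtopP n a (C t i) * w (Cq i) + da w (C t i)) / lam ^ 2
          - (\<Sum>k\<in>{1..n} - {i}. dpol w k (C t i)
               - (3 / (2 * (C t i - q k) ^ 3) + u k / (C t i - q k) ^ 2) * w (Cq i))) (at t)"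
      by (subst DERIV_cong_ev[OF refl _ refl])
    with 1 have "D (q i) + deriv G (q i) * w (Cq i) = of_nat 2 * U t i ^ (2 - 1) * du w i
          - (dtopP n a (C t i) * w (Cq i) + da w (C t i)) / lam ^ 2
          - (\<Sum>k\<in>{1..n} - {i}. dpol w k (C t i)
               - (3 / (2 * (C t i - q k) ^ 3) + u k / (C t i - q k) ^ 2) * w (Cq i))"
      by (rule DERIV_unique)
    also have "\<dots> = 2 * u i * du w i
          - dtopP n a (q i) / lam ^ 2 * w (Cq i) - da w (q i) / lam ^ 2
          - (\<Sum>k\<in>{1..n} - {i}. dpol w k (q i))
          + (\<Sum>k\<in>{1..n} - {i}. 3 / (2 * (q i - q k) ^ 3) + u k / (q i - q k) ^ 2) * w (Cq i)"
      by (simp add: at_t U_t sum_subtractf sum_distrib_right add_divide_distrib)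
    finally show ?thesis
      by (simp add: dG_def c1_def algebra_simps)
  qed
  have "((\<lambda>s. topP n (A s) x / lam ^ 2
            + (\<Sum>i=1..n. 3 / (4 * (x - C s i) ^ 2) + U s i / (x - C s i)) + L s x)
        has_field_derivative (dtopP n a x * 0 + da w x) / lam ^ 2
          + (\<Sum>i=1..n. dpol w i x - (3 / (2 * (x - q i) ^ 3) + u i / (x - q i) ^ 2) * 0) + D x) (at t)"
    using x by (intro DERIV_add DERIV_sum DERIV_cdivide dtop[of "\<lambda>_. x"] dL dpolar[of _ "\<lambda>_. x"]) auto
  moreover have "D x = (\<Sum>i=1..n. dG w i * lagr n q i x)"
    using D_interp[of x] dG by simp
  ultimately show ?thesis
    unfolding vels(1) Q_pot_eq Qdot_def U_def L_def by (simp only: mult_zero_right add_0 diff_0_right)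
qed

end

section \<open>Growth at infinity\<close>

lemma cmult_bigo:
  fixes f :: "complex \<Rightarrow> complex"
  shows "f \<in> O[F](g) \<Longrightarrow> (\<lambda>x. c * f x) \<in> O[F](g)"
  by (cases "c = 0") auto

lemma inverse_diff_bigo: "(\<lambda>x::complex. 1 / (x - c)) \<in> O[at_infinity](\<lambda>x. 1 / x)"
proof (rule bigoI_tendsto)
  have "filterlim (\<lambda>x::complex. x - c) at_infinity at_infinity"
    using tendsto_add_filterlim_at_infinity[OF tendsto_const[of "- c"] filterlim_ident] by simp
  then have "((\<lambda>x. 1 + c / (x - c)) \<longlongrightarrow> 1 + 0) at_infinity"
    by (intro tendsto_intros tendsto_divide_0[OF tendsto_const])
  moreover have "\<forall>\<^sub>F x in at_infinity. 1 + c / (x - c) = 1 / (x - c) / (1 / x)"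
    using eventually_not_equal_at_infinity[of 0] eventually_not_equal_at_infinity[of c]
    by eventually_elim (simp add: field_simps)
  ultimately show "((\<lambda>x. 1 / (x - c) / (1 / x)) \<longlongrightarrow> 1) at_infinity"
    by (simp add: tendsto_cong)
  show "\<forall>\<^sub>F x::complex in at_infinity. 1 / x \<noteq> 0"
    using eventually_not_equal_at_infinity[of 0] by eventually_elim simp
qed

lemma inverse_bigo_1: "(\<lambda>x::complex. 1 / x) \<in> O[at_infinity](\<lambda>_. 1)"
  by (rule bigoI_tendsto[of _ _ 0]) (auto intro!: tendsto_divide_0[OF tendsto_const] filterlim_ident)

lemma one_bigo_power: "(\<lambda>_. 1) \<in> O[at_infinity](\<lambda>x::complex. x ^ k)"
  using power_bigo_power_at_infinity[of 0 k] by simp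

lemma pole_bigo_1: "(\<lambda>x::complex. w / (x - c) ^ m) \<in> O[at_infinity](\<lambda>_. 1)"
proof -
  have "(\<lambda>x::complex. 1 / (x - c)) \<in> O[at_infinity](\<lambda>_. 1)"
    using inverse_diff_bigo inverse_bigo_1 by (rule landau_o.big_trans)
  then have "(\<lambda>x::complex. (1 / (x - c)) ^ m) \<in> O[at_infinity](\<lambda>_. 1 ^ m)"
    by (rule landau_o.big_power)
  then have "(\<lambda>x::complex. w * (1 / (x - c)) ^ m) \<in> O[at_infinity](\<lambda>_. 1)"
    by simp
  then show ?thesis
    by (simp add: power_divide)
qed

lemma pole_bigo: "(\<lambda>x::complex. w / (x - c) ^ m) \<in> O[at_infinity](\<lambda>x. x ^ k)"
  using pole_bigo_1 one_bigo_power by (rule landau_o.big_trans)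

lemma mult_pole_bigo:
  assumes "f \<in> O[at_infinity](\<lambda>x::complex. x ^ k)"
  shows "(\<lambda>x. f x / (x - c) ^ m) \<in> O[at_infinity](\<lambda>x. x ^ k)"
  using landau_o.big_mult[OF assms pole_bigo_1[of 1 c m]] by simp

lemma divide_square_bigo:
  assumes "f \<in> O[at_infinity](\<lambda>x::complex. x ^ (k + 2))"
  shows "(\<lambda>x. f x / (x - c) ^ 2) \<in> O[at_infinity](\<lambda>x. x ^ k)"
proof -
  have "(\<lambda>x. f x * (1 / (x - c)) ^ 2) \<in> O[at_infinity](\<lambda>x. x ^ (k + 2) * (1 / x) ^ 2)"
    by (intro landau_o.big_mult assms landau_o.big_power inverse_diff_bigo)
  also have "(\<lambda>x::complex. x ^ (k + 2) * (1 / x) ^ 2) \<in> \<Theta>[at_infinity](\<lambda>x. x ^ k)"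
    using eventually_not_equal_at_infinity[of 0]
    by (intro bigthetaI_cong, eventually_elim) (simp add: power_add power_divide power2_eq_square)
  finally show ?thesis
    by (simp add: power_divide)
qed

text \<open>
  For \<open>P = x\<^sup>N\<close> and \<open>A = 1 / (x - c)\<close> this is the expansion of \<open>(x - c)\<^sup>2 (P' A + 2 P A')\<close> at
  infinity, truncated after \<open>M\<close> terms.
\<close>
lemma power_remainder:
  fixes x c :: complex
  assumes "M + 1 \<le> N"
  shows "of_nat N * x ^ (N - 1) * (x - c) - 2 * x ^ N
      - (x - c) ^ 2 * (\<Sum>m<M. (of_nat N - 2 - 2 * of_nat m) * c ^ m * x ^ (N - 2 - m))
    = (of_nat N - 2 - 2 * of_nat M) * c ^ M * x ^ (N - M) - (of_nat N - 2 * of_nat M) * c ^ Suc M * x ^ (N - 1 - M)"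
  using assms
proof (induction M)
  case 0
  then obtain N' where "N = Suc N'"
    by (cases N) auto
  then show ?case
    by (simp add: algebra_simps)
next
  case (Suc M)
  then obtain r where r: "N = M + 2 + r"
    using le_Suc_ex[of "M + 2" N] by (auto simp: add.commute)
  have "x ^ (N - M) = x ^ 2 * x ^ r" "x ^ (N - 1 - M) = x * x ^ r" "x ^ (N - 2 - M) = x ^ r"
    "x ^ (N - Suc M) = x * x ^ r" "x ^ (N - 1 - Suc M) = x ^ r" "c ^ Suc M = c * c ^ M" "c ^ Suc (Suc M) = c ^ 2 * c ^ M"
    by (auto simp: r power_add power2_eq_square)
  then show ?case
    using Suc by (simp add: algebra_simps power2_eq_square)
qed

definition Tsum :: "nat \<Rightarrow> (nat \<Rightarrow> complex) \<Rightarrow> complex \<Rightarrow> complex \<Rightarrow> complex" where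
  "Tsum n a c x = (\<Sum>j=1..n. T_fun n a j c * x ^ (n + j - 1))"

text \<open>Regrouped by the monomials of \<open>topP\<close>: the first sum comes from
  \<open>x^(2n+1)\<close>, the \<open>l\<close>-th term of the second from
  \<open>a l * x^(n+l-1)\<close>. In each, the expansion stops at the power
  \<open>x^n\<close>.\<close>

lemma Tsum_eq:
  "Tsum n a c x = (\<Sum>m<n. (of_nat (2 * n + 1) - 2 - 2 * of_nat m) * c ^ m * x ^ (2 * n + 1 - 2 - m))
     + (\<Sum>l=1..n. a l * (\<Sum>m<l - 2. (of_nat (n + l - 1) - 2 - 2 * of_nat m) * c ^ m * x ^ (n + l - 1 - 2 - m)))"
proof -
  have "(\<Sum>j=1..n. (2 * of_nat j - 1) * c ^ (n - j) * x ^ (n + j - 1))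
      = (\<Sum>m<n. (of_nat (2 * n + 1) - 2 - 2 * of_nat m) * c ^ m * x ^ (2 * n + 1 - 2 - m))"
    by (rule sum.reindex_bij_witness[of _ "\<lambda>m. n - m" "\<lambda>j. n - j"])
       (auto simp: of_nat_diff algebra_simps intro!: arg_cong[of _ _ "\<lambda>k. x ^ k"])
  moreover have "(\<Sum>j=1..n. (\<Sum>k=1..n - j - 1. (2 * of_nat j + of_nat k) * a (n - k + 1) * c ^ (n - j - 1 - k)) * x ^ (n + j - 1))
      = (\<Sum>l=1..n. a l * (\<Sum>m<l - 2. (of_nat (n + l - 1) - 2 - 2 * of_nat m) * c ^ m * x ^ (n + l - 1 - 2 - m)))"
    (is "?L = ?R")
  proof -
    have "?L = (\<Sum>(j, k)\<in>Sigma {1..n} (\<lambda>j. {1..n - j - 1}).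
        (2 * of_nat j + of_nat k) * a (n - k + 1) * c ^ (n - j - 1 - k) * x ^ (n + j - 1))"
      by (simp add: sum_distrib_right sum.Sigma)
    also have "\<dots> = (\<Sum>(l, m)\<in>Sigma {1..n} (\<lambda>l. {..<l - 2}).
        a l * ((of_nat (n + l - 1) - 2 - 2 * of_nat m) * c ^ m * x ^ (n + l - 1 - 2 - m)))"
    \<comment> \<open>The coefficient \<open>a (n - k + 1)\<close> makes
      \<open>l = n + 1 - k\<close>, and the power of \<open>c\<close> makes
      \<open>m = n - j - 1 - k\<close>.\<close>
    proof (rule sum.reindex_bij_witness[of _ "\<lambda>(l, m). (l - 2 - m, n + 1 - l)" "\<lambda>(j, k). (n + 1 - k, n - j - 1 - k)"]; clarify)
      fix j k assume jk: "j \<in> {1..n}" "k \<in> {1..n - j - 1}"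
      define m where "m = n - j - 1 - k"
      have n: "n = m + j + 1 + k"
        using jk by (auto simp: m_def)
      have *: "n - k + 1 = m + j + 2" "n + 1 - k = m + j + 2" "n - j - 1 - k = m"
          "n + (m + j + 2) - 1 - 2 - m = n + j - 1"
        using n jk by auto
      have "n + (m + j + 2) - 1 = 2 * m + 2 * j + 2 + k"
        using n by simp
      then have "(of_nat (n + (m + j + 2) - 1) :: complex) - 2 - 2 * of_nat m = 2 * of_nat j + of_nat k"
        by (simp only:) simp
      then show "a (n + 1 - k) * ((of_nat (n + (n + 1 - k) - 1) - 2 - 2 * of_nat (n - j - 1 - k))
            * c ^ (n - j - 1 - k) * x ^ (n + (n + 1 - k) - 1 - 2 - (n - j - 1 - k)))
          = (2 * of_nat j + of_nat k) * a (n - k + 1) * c ^ (n - j - 1 - k) * x ^ (n + j - 1)"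
        unfolding * by simp
    qed auto
    also have "\<dots> = ?R"
      unfolding sum_distrib_left by (rule sum.Sigma[symmetric]) auto
    finally show ?thesis .
  qed
  ultimately show ?thesis
    unfolding Tsum_def T_fun_def by (simp only: distrib_right sum.distrib)
qed

text \<open>After \<open>N - 1 - n\<close> terms only the powers \<open>n + 1\<close> and
  \<open>n\<close> remain. For \<open>N = n\<close> the subtraction truncates to 0 terms, and the
  remainder has even lower degree.\<close>

lemma power_remainder_bigo:
  fixes c :: complex
  assumes "n \<le> N" "n > 0"
  shows "(\<lambda>x. of_nat N * x ^ (N - 1) * (x - c) - 2 * x ^ N
      - (x - c) ^ 2 * (\<Sum>m<N - 1 - n. (of_nat N - 2 - 2 * of_nat m) * c ^ m * x ^ (N - 2 - m)))
    \<in> O[at_infinity](\<lambda>x. x ^ (n + 1))"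
proof -
  have "N - 1 - n + 1 \<le> N"
    using assms by simp
  note eq = power_remainder[OF this]
  have "(\<lambda>x. w * x ^ (N - (N - 1 - n)) - w' * x ^ (N - 1 - (N - 1 - n))) \<in> O[at_infinity](\<lambda>x. x ^ (n + 1))"
    for w w' :: complex
    using assms by (intro sum_in_bigo cmult_bigo power_bigo_power_at_infinity) auto
  then show ?thesis
    unfolding eq .
qed

text \<open>The origin of \<open>T_fun\<close>: these \<open>a\<close>-components absorb exactly the
  part of \<open>P' A + 2 P A'\<close>, for \<open>A = 1 / (x - c)\<close>, that exceeds the order
  \<open>x^(n-1)\<close>. Dividing by \<open>(x - c)^2\<close> turns the remainder of order
  \<open>n + 1\<close> into order \<open>n - 1\<close>.\<close>

lemma topP_remainder_bigo:
  assumes "n > 0"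
  shows "(\<lambda>x. dtopP n a x / (x - c) - 2 * topP n a x / (x - c) ^ 2 - Tsum n a c x)
    \<in> O[at_infinity](\<lambda>x. x ^ (n - 1))"
proof -
  define r where "r = (\<lambda>N x. of_nat N * x ^ (N - 1) * (x - c) - 2 * x ^ N
      - (x - c) ^ 2 * (\<Sum>m<N - 1 - n. (of_nat N - 2 - 2 * of_nat m) * c ^ m * x ^ (N - 2 - m)))"
  have eq: "dtopP n a x * (x - c) - 2 * topP n a x - (x - c) ^ 2 * Tsum n a c x
      = r (2 * n + 1) x + (\<Sum>l=1..n. a l * r (n + l - 1) x)" for x
  proof -
    define S where "S = (\<lambda>N. \<Sum>m<N - 1 - n. (of_nat N - 2 - 2 * of_nat m) * c ^ m * x ^ (N - 2 - m))"
    have 1: "Tsum n a c x = S (2 * n + 1) + (\<Sum>l=1..n. a l * S (n + l - 1))"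
    proof -
      have "2 * n + 1 - 1 - n = n" "n + l - 1 - 1 - n = l - 2" for l
        by auto
      then show ?thesis
        unfolding Tsum_eq S_def by (simp only:)
    qed
    have 2: "r N x = of_nat N * x ^ (N - 1) * (x - c) - 2 * x ^ N - (x - c) ^ 2 * S N" for N
      by (simp add: r_def S_def)
    have 3: "(\<Sum>l=1..n. a l * (f l * y - 2 * g l - z * h l)) =
        (\<Sum>l=1..n. a l * f l) * y - 2 * (\<Sum>l=1..n. a l * g l) - z * (\<Sum>l=1..n. a l * h l)"
      for f g h y z
      by (simp add: sum_distrib_left sum_distrib_right sum_subtractf sum.distrib algebra_simps)
    have 4: "2 * n + 1 - 1 = 2 * n" "n + l - 1 - 1 = n + l - 2" for l
      by auto
    show ?thesis
      unfolding 1 2 3 4 dtopP_def topP_def by (simp add: algebra_simps)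
  qed
  have "(\<lambda>x. r (2 * n + 1) x + (\<Sum>l=1..n. a l * r (n + l - 1) x)) \<in> O[at_infinity](\<lambda>x. x ^ (n + 1))"
    unfolding r_def
    by (intro sum_in_bigo big_sum_in_bigo cmult_bigo power_remainder_bigo) (use assms in auto)
  moreover have "n - 1 + 2 = n + 1"
    using assms by simp
  ultimately have "(\<lambda>x. dtopP n a x * (x - c) - 2 * topP n a x - (x - c) ^ 2 * Tsum n a c x)
      \<in> O[at_infinity](\<lambda>x. x ^ (n - 1 + 2))"
    by (simp only: eq)
  then have "(\<lambda>x. (dtopP n a x * (x - c) - 2 * topP n a x - (x - c) ^ 2 * Tsum n a c x) / (x - c) ^ 2)
      \<in> O[at_infinity](\<lambda>x. x ^ (n - 1))"
    by (rule divide_square_bigo)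
  also have "?this \<longleftrightarrow> ?thesis"
    using eventually_not_equal_at_infinity[of c]
    by (intro landau_o.big.in_cong, eventually_elim)
       (simp add: diff_divide_distrib power2_eq_square)
  finally show ?thesis .
qed

section \<open>Local expansions at apparent singularities\<close>

text \<open>The numerator annihilates the Taylor terms of orders 0, 1 and 2. With
  \<open>f = f(z) + f'(z) y + y^2 k\<close> and \<open>y = x - z\<close> it equals
  \<open>y^3 k'\<close>.\<close>

lemma taylor_quotient_tendsto_0:
  fixes f :: "complex \<Rightarrow> complex"
  assumes "f analytic_on {z}"
  shows "((\<lambda>x. (deriv f x * (x - z) - 2 * f x + 2 * f z + deriv f z * (x - z)) / (x - z) ^ 2) \<longlongrightarrow> 0) (at z)"
proof -
  obtain S where S: "open S" "z \<in> S" "f holomorphic_on S"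
    using assms by (auto simp: analytic_at)
  define g where "g = (\<lambda>x. if x = z then deriv f z else (f x - f z) / (x - z))"
  have g: "g holomorphic_on S"
    unfolding g_def using S by (intro pole_lemma) (auto simp: interior_open)
  define k where "k = (\<lambda>x. if x = z then deriv g z else (g x - g z) / (x - z))"
  have k: "k holomorphic_on S"
    unfolding k_def using S g by (intro pole_lemma) (auto simp: interior_open)
  have f_eq: "f x = f z + (x - z) * deriv f z + (x - z) ^ 2 * k x" for x
  proof -
    have "f x = f z + (x - z) * g x" "g x = g z + (x - z) * k x" "g z = deriv f z"
      by (auto simp: k_def g_def)
    then show ?thesis
      by (simp add: power2_eq_square algebra_simps)
  qed
  have k': "(k has_field_derivative deriv k x) (at x)" if "x \<in> S" for x
    using holomorphic_derivI[OF k S(1) that] by simp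
  have "deriv f x = deriv f z + 2 * (x - z) * k x + (x - z) ^ 2 * deriv k x" if "x \<in> S" for x
  proof (rule DERIV_imp_deriv)
    have "((\<lambda>x. f z + (x - z) * deriv f z + (x - z) ^ 2 * k x) has_field_derivative
        deriv f z + 2 * (x - z) * k x + (x - z) ^ 2 * deriv k x) (at x)"
      by (auto intro!: derivative_eq_intros k' that)
    then show "(f has_field_derivative deriv f z + 2 * (x - z) * k x + (x - z) ^ 2 * deriv k x) (at x)"
      by (simp only: f_eq[symmetric])
  qed
  note f'_eq = this
  have "continuous_on S (deriv k)"
    using k S(1) holomorphic_deriv holomorphic_on_imp_continuous_on by blast
  then have "isCont (deriv k) z"
    using S continuous_on_eq_continuous_at by blast
  then have "((\<lambda>x. (x - z) * deriv k x) \<longlongrightarrow> (z - z) * deriv k z) (at z)"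
    by (intro tendsto_intros) (auto simp: isCont_def)
  then have "((\<lambda>x. (x - z) * deriv k x) \<longlongrightarrow> 0) (at z)"
    by simp
  moreover have "\<forall>\<^sub>F x in at z. (x - z) * deriv k x =
      (deriv f x * (x - z) - 2 * f x + 2 * f z + deriv f z * (x - z)) / (x - z) ^ 2"
  proof -
    have "\<forall>\<^sub>F x in at z. x \<in> S - {z}"
      using S by (intro eventually_at_in_open) auto
    then show ?thesis
    proof eventually_elim
      case (elim x)
      have "f' * y - 2 * fx + 2 * fz + D * y = y ^ 3 * k'"
        if "fx = fz + y * D + y ^ 2 * kx" "f' = D + 2 * y * kx + y ^ 2 * k'" for f' fx fz D kx k' y :: complex
        unfolding that by (simp add: algebra_simps power2_eq_square power3_eq_cube)
      from this[OF f_eq f'_eq]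
      have "deriv f x * (x - z) - 2 * f x + 2 * f z + deriv f z * (x - z) = (x - z) ^ 3 * deriv k x"
        using elim by blast
      then show ?case
        using elim by (simp add: power2_eq_square power3_eq_cube)
    qed
  qed
  ultimately show ?thesis
    by (rule Lim_transform_eventually)
qed

text \<open>
  In the next two lemmas \<open>Q\<close> is given by its Laurent expansion at an apparent singularity \<open>z\<close>
  and \<open>A\<close> is \<open>1 / (x - c)\<close>, first with \<open>c = z - d\<close>, then with \<open>c = z\<close>.
\<close>
lemma flow_defect_tendsto_0_other:
  fixes z d U k1 :: complex
  assumes d: "d \<noteq> 0" and K: "(K \<longlongrightarrow> U ^ 2) (at z)" and K': "(K' \<longlongrightarrow> k1) (at z)"
    and L: "(L \<longlongrightarrow> 2 * U * (3 / (2 * d ^ 3) - U / d ^ 2) + k1 / d) (at z)"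
  shows "((\<lambda>x. (- 3 / (2 * (x - z) ^ 3) - U / (x - z) ^ 2 + K' x) / (x - (z - d))
      - 2 * (3 / (4 * (x - z) ^ 2) + U / (x - z) + K x) / (x - (z - d)) ^ 2 + 3 / (x - (z - d)) ^ 4
      - (3 * (- 1 / d) / (2 * (x - z) ^ 3) + U * (- 1 / d) / (x - z) ^ 2
          + (3 / (2 * d ^ 3) - U / d ^ 2) / (x - z) + L x)) \<longlongrightarrow> 0) (at z)"
proof -
  \<comment> \<open>What remains of the polar contributions after the poles at \<open>z\<close>
    cancel: the constant \<open>3 * U / d ^ 3\<close> is split off, and a factor
    \<open>x - z\<close> is taken out of the rest.\<close>
  define W where "W = (\<lambda>x. (- 5 * U / (x - (z - d)) + 3 / 2 / (x - (z - d)) ^ 2 + 2 * U * (x - z) / (x - (z - d)) ^ 2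
     - 9 / (x - (z - d)) ^ 2 + 9 * (x - z) / (x - (z - d)) ^ 3 - 3 * (x - z) ^ 2 / (x - (z - d)) ^ 4) / d ^ 3)"
  have nz: "z - (z - d) \<noteq> 0"
    using d by simp
  have "((\<lambda>x. (x - z) * W x + 3 * U / d ^ 3 + K' x / (x - (z - d)) - 2 * K x / (x - (z - d)) ^ 2 - L x) \<longlongrightarrow>
     (z - z) * W z + 3 * U / d ^ 3 + k1 / (z - (z - d)) - 2 * U ^ 2 / (z - (z - d)) ^ 2
        - (2 * U * (3 / (2 * d ^ 3) - U / d ^ 2) + k1 / d)) (at z)"
    unfolding W_def using nz d by (intro tendsto_intros K K' L) auto
  \<comment> \<open>The limit \<open>U ^ 2\<close> of \<open>K\<close> enters here:
    \<open>- 2 * U ^ 2 / d ^ 2\<close> cancels against the product of \<open>2 * U\<close> with the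
    \<open>U\<close>-part of the residue.\<close>
  also have "(z - z) * W z + 3 * U / d ^ 3 + k1 / (z - (z - d)) - 2 * U ^ 2 / (z - (z - d)) ^ 2
        - (2 * U * (3 / (2 * d ^ 3) - U / d ^ 2) + k1 / d) = 0"
    using d by (simp add: field_simps power2_eq_square power3_eq_cube)
  finally have lim: "((\<lambda>x. (x - z) * W x + 3 * U / d ^ 3 + K' x / (x - (z - d)) - 2 * K x / (x - (z - d)) ^ 2 - L x) \<longlongrightarrow> 0) (at z)" .
  \<comment> \<open>The prescribed coefficients \<open>- 1 / d\<close> and
    \<open>3 / (2 * d ^ 3) - U / d ^ 2\<close> make the poles of orders 3, 2 and 1 cancel. The
    identity is checked after multiplication by \<open>2 * d ^ 3 * y ^ 3 * s ^ 4\<close>.\<close>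
  have alg: "(- 3 / (2 * y ^ 3) - U / y ^ 2) / s - 2 * (3 / (4 * y ^ 2) + U / y) / s ^ 2 + 3 / s ^ 4
      - (3 * (- 1 / d) / (2 * y ^ 3) + U * (- 1 / d) / y ^ 2 + (3 / (2 * d ^ 3) - U / d ^ 2) / y)
    = y * ((- 5 * U / s + 3 / 2 / s ^ 2 + 2 * U * y / s ^ 2
     - 9 / s ^ 2 + 9 * y / s ^ 3 - 3 * y ^ 2 / s ^ 4) / d ^ 3) + 3 * U / d ^ 3"
    if y: "y \<noteq> 0" and s: "s \<noteq> 0" and "s = y + d" for y s
  proof -
    have "2 * d ^ 3 * y ^ 3 * s ^ 4 * ((- 3 / (2 * y ^ 3) - U / y ^ 2) / s - 2 * (3 / (4 * y ^ 2) + U / y) / s ^ 2 + 3 / s ^ 4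
      - (3 * (- 1 / d) / (2 * y ^ 3) + U * (- 1 / d) / y ^ 2 + (3 / (2 * d ^ 3) - U / d ^ 2) / y))
      = (- 3 * d ^ 3 * s ^ 3 - 2 * U * y * d ^ 3 * s ^ 3) - (3 * y * d ^ 3 * s ^ 2 + 4 * U * y ^ 2 * d ^ 3 * s ^ 2) + 6 * d ^ 3 * y ^ 3
        + 3 * d ^ 2 * s ^ 4 + 2 * U * d ^ 2 * y * s ^ 4 - (3 - 2 * U * d) * y ^ 2 * s ^ 4"
      using y s d by (simp add: field_simps power2_eq_square power3_eq_cube power4_eq_xxxx)
    also have "\<dots> = y ^ 4 * (- 10 * U * s ^ 3 + 3 * s ^ 2 + 4 * U * y * s ^ 2 - 18 * s ^ 2 + 18 * y * s - 6 * y ^ 2)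
        + 6 * U * y ^ 3 * s ^ 4"
      unfolding \<open>s = y + d\<close> by (simp add: algebra_simps power2_eq_square power3_eq_cube power4_eq_xxxx)
    also have "\<dots> = 2 * d ^ 3 * y ^ 3 * s ^ 4 * (y * ((- 5 * U / s + 3 / 2 / s ^ 2 + 2 * U * y / s ^ 2
     - 9 / s ^ 2 + 9 * y / s ^ 3 - 3 * y ^ 2 / s ^ 4) / d ^ 3) + 3 * U / d ^ 3)"
      using y s d by (simp add: field_simps power2_eq_square power3_eq_cube power4_eq_xxxx)
    finally show ?thesis
      using y s d by simp
  qed
  show ?thesis
  proof (rule Lim_transform_eventually[OF lim])
    have "\<forall>\<^sub>F x in at z. x \<noteq> z \<and> x \<noteq> z - d"
      by (intro eventually_conj eventually_neq_at_within)
    then show "\<forall>\<^sub>F x in at z. (x - z) * W x + 3 * U / d ^ 3 + K' x / (x - (z - d)) - 2 * K x / (x - (z - d)) ^ 2 - L x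
      = (- 3 / (2 * (x - z) ^ 3) - U / (x - z) ^ 2 + K' x) / (x - (z - d))
      - 2 * (3 / (4 * (x - z) ^ 2) + U / (x - z) + K x) / (x - (z - d)) ^ 2 + 3 / (x - (z - d)) ^ 4
      - (3 * (- 1 / d) / (2 * (x - z) ^ 3) + U * (- 1 / d) / (x - z) ^ 2
          + (3 / (2 * d ^ 3) - U / d ^ 2) / (x - z) + L x)"
    proof eventually_elim
      case (elim x)
      have "x - z \<noteq> 0" "x - (z - d) \<noteq> 0" "x - (z - d) = (x - z) + d"
        using elim by auto
      note alg_x = alg[OF this]
      have "(s1 + k') / s - 2 * (s2 + k) / t + r - (s3 + l) = (s1 / s - 2 * s2 / t + r - s3) + k' / s - 2 * k / t - l"
        for s1 s2 s3 k k' l s t r :: complex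
        by (simp add: add_divide_distrib distrib_left)
      then show ?case
        unfolding W_def by (simp only: alg_x)
    qed
  qed
qed

lemma flow_defect_tendsto_0_self:
  fixes z U k1 :: complex
  assumes K: "K analytic_on {z}" "K z = U ^ 2" and K': "\<forall>\<^sub>F x in at z. K' x = deriv K x" and k1: "k1 = deriv K z"
    and L: "(L \<longlongrightarrow> 0) (at z)"
  shows "((\<lambda>x. (- 3 / (2 * (x - z) ^ 3) - U / (x - z) ^ 2 + K' x) / (x - z)
      - 2 * (3 / (4 * (x - z) ^ 2) + U / (x - z) + K x) / (x - z) ^ 2 + 3 / (x - z) ^ 4
      - (3 * (- 2 * U) / (2 * (x - z) ^ 3) + U * (- 2 * U) / (x - z) ^ 2 + (- k1) / (x - z) + L x)) \<longlongrightarrow> 0) (at z)"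
proof -
  have lim: "((\<lambda>x. (deriv K x * (x - z) - 2 * K x + 2 * K z + deriv K z * (x - z)) / (x - z) ^ 2 - L x) \<longlongrightarrow> 0) (at z)"
    using tendsto_diff[OF taylor_quotient_tendsto_0[OF K(1)] L] by simp
  \<comment> \<open>The poles of orders 4 and 3 cancel outright. The double pole cancels only
    because \<open>K z = U ^ 2\<close>, which makes the remaining expression the Taylor quotient of
    the preceding limit.\<close>
  have alg: "(- 3 / (2 * y ^ 3) - U / y ^ 2 + k') / y
      - 2 * (3 / (4 * y ^ 2) + U / y + k) / y ^ 2 + 3 / y ^ 4
      - (3 * (- 2 * U) / (2 * y ^ 3) + U * (- 2 * U) / y ^ 2 + (- k1) / y + l)
    = (k' * y - 2 * k + 2 * U ^ 2 + k1 * y) / y ^ 2 - l" if "y \<noteq> 0" for y k k' l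
    using that by (simp add: field_simps power2_eq_square power3_eq_cube power4_eq_xxxx)
  show ?thesis
  proof (rule Lim_transform_eventually[OF lim])
    show "\<forall>\<^sub>F x in at z. (deriv K x * (x - z) - 2 * K x + 2 * K z + deriv K z * (x - z)) / (x - z) ^ 2 - L x
      = (- 3 / (2 * (x - z) ^ 3) - U / (x - z) ^ 2 + K' x) / (x - z)
      - 2 * (3 / (4 * (x - z) ^ 2) + U / (x - z) + K x) / (x - z) ^ 2 + 3 / (x - z) ^ 4
      - (3 * (- 2 * U) / (2 * (x - z) ^ 3) + U * (- 2 * U) / (x - z) ^ 2 + (- k1) / (x - z) + L x)"
      using K' eventually_neq_at_within[of z z UNIV]
    proof eventually_elim
      case (elim x)
      then have "x - z \<noteq> 0"
        by simp
      then show ?case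
        using alg[of "x - z" "K' x" "K x" "L x"] elim(1) K(2) k1 by simp
    qed
  qed
qed

section \<open>The flows\<close>

lemma sum_vscale_partial:
  assumes "finite I"
  shows "(\<Sum>j\<in>I. c j *\<^sub>T \<partial> (C j)) k = (\<Sum>j\<in>I. if k = C j then c j else 0)"
  using assms by (induction I rule: finite_induct) (auto simp: vscale_def partial_def)

lemma sum_tvec_apply: "(\<Sum>j\<in>I. f j) k = (\<Sum>j\<in>I. f j k)" for f :: "'i \<Rightarrow> tvec"
  by (induction I rule: infinite_finite_induct) auto

lemma vscale_apply: "(c *\<^sub>T w) k = c * w k"
  by (simp add: vscale_def)

lemma partial_apply: "\<partial> c k = (if k = c then 1 else 0)"
  by (simp add: partial_def)

context oscillator
begin

abbreviation pt :: point where "pt \<equiv> (a, b, q, v, p)"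

lemma U_flow_components:
  assumes "i \<in> {1..n}"
  shows "U_flow n lam i pt (Ca j) = 0" "U_flow n lam i pt (Cq j) = 0"
    "U_flow n lam i pt (Cb j) = (if j = i then lam else 0)"
    "U_flow n lam i pt (Cv j) = (if j \<in> {1..n} then - (q j ^ (i - 1) / (2 * p j)) else 0)"
  using assms by (auto simp: U_flow_def sum_vscale_partial vscale_apply partial_apply if_distrib[of "\<lambda>f. f _"] cong: if_cong)

lemma V_flow_components:
  assumes i: "i \<in> {1..n}"
  shows "V_flow n lam i pt (Ca j) = (if j \<in> {1..n} then lam * T_fun n a j (q i) else 0)"
    and "V_flow n lam i pt (Cb j) = 0"
    and "V_flow n lam i pt (Cq j) =
      (if j = i then - 2 * lam * u i else if j \<in> {1..n} then lam / (q i - q j) else 0)"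
    and "j \<noteq> i \<Longrightarrow> V_flow n lam i pt (Cv j) =
      (if j \<in> {1..n} then
        - (Tsum n a (q i) (q j) / (2 * p j)
            + poly (pderiv (Q0 n a b)) (q j) / (2 * p j * (q i - q j)) + p j / (q i - q j) ^ 2)
        - lam * (3 / (2 * (q i - q j) ^ 3) + v j / (q i - q j) ^ 2) else 0)"
    and "V_flow n lam i pt (Cv i) =
        - (Tsum n a (q i) (q i) / (2 * p i)
            - poly (pderiv (Q0 n a b)) (q i) * v i / p i
            + deriv (R_fun n q v p) (q i) - (\<Sum>j\<in>{1..n} - {i}. p j / (q i - q j) ^ 2))
        + lam * ((\<Sum>j\<in>{1..n} - {i}. 3 / (2 * (q i - q j) ^ 3))
          + (\<Sum>j\<in>{1..n} - {i}. v j / (q i - q j) ^ 2) - deriv (S_fun n q v) (q i))"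
proof -
  have *: "(\<Sum>k=1..n. T_fun n a k y * x ^ (k + n - 1)) = Tsum n a y x" for x y
    by (simp add: Tsum_def add.commute)
  have lam_u: "lam * u i = p i + lam * v i"
    using lam_nz by (simp add: u_def distrib_left)
  show "V_flow n lam i pt (Ca j) = (if j \<in> {1..n} then lam * T_fun n a j (q i) else 0)"
    "V_flow n lam i pt (Cb j) = 0"
    by (simp_all add: V_flow_def sum_vscale_partial vscale_apply partial_apply)
  show "V_flow n lam i pt (Cq j) =
      (if j = i then - 2 * lam * u i else if j \<in> {1..n} then lam / (q i - q j) else 0)"
  proof (cases "j = i")
    case True
    have "V_flow n lam i pt (Cq i) = - 2 * p i + lam * (- 2 * v i)"
      by (simp add: V_flow_def sum_vscale_partial vscale_apply partial_apply)
    also have "\<dots> = - 2 * (lam * u i)"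
      unfolding lam_u by (simp add: algebra_simps)
    finally show ?thesis
      using True by (simp add: mult.assoc)
  next
    case False
    then show ?thesis
      by (simp add: V_flow_def sum_vscale_partial vscale_apply partial_apply)
  qed
  show "j \<noteq> i \<Longrightarrow> V_flow n lam i pt (Cv j) =
      (if j \<in> {1..n} then
        - (Tsum n a (q i) (q j) / (2 * p j)
            + poly (pderiv (Q0 n a b)) (q j) / (2 * p j * (q i - q j)) + p j / (q i - q j) ^ 2)
        - lam * (3 / (2 * (q i - q j) ^ 3) + v j / (q i - q j) ^ 2) else 0)"
    by (simp add: V_flow_def sum_vscale_partial vscale_apply partial_apply * del: One_nat_def)
  show "V_flow n lam i pt (Cv i) =
        - (Tsum n a (q i) (q i) / (2 * p i)
            - poly (pderiv (Q0 n a b)) (q i) * v i / p i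
            + deriv (R_fun n q v p) (q i) - (\<Sum>j\<in>{1..n} - {i}. p j / (q i - q j) ^ 2))
        + lam * ((\<Sum>j\<in>{1..n} - {i}. 3 / (2 * (q i - q j) ^ 3))
          + (\<Sum>j\<in>{1..n} - {i}. v j / (q i - q j) ^ 2) - deriv (S_fun n q v) (q i))"
    by (simp add: V_flow_def sum_vscale_partial vscale_apply partial_apply * del: One_nat_def)
qed

section \<open>Laurent expansions of the potential and of its variation at the nodes\<close>

definition dK :: "nat \<Rightarrow> complex \<Rightarrow> complex" where
  "dK i x = dtopP n a x / lam ^ 2
     - (\<Sum>k\<in>{1..n} - {i}. 3 / (2 * (x - q k) ^ 3) + u k / (x - q k) ^ 2) + deriv G x"

definition dQf :: "complex \<Rightarrow> complex" where
  "dQf x = dtopP n a x / lam ^ 2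
     - (\<Sum>k=1..n. 3 / (2 * (x - q k) ^ 3) + u k / (x - q k) ^ 2) + deriv G x"

lemma dK_at: "dK i (q i) = c1 i"
  by (simp add: dK_def c1_def)

lemma dQf_split: "i \<in> {1..n} \<Longrightarrow> dQf x = - 3 / (2 * (x - q i) ^ 3) - u i / (x - q i) ^ 2 + dK i x"
  unfolding dQf_def dK_def by (subst sum.remove[of _ i]) (auto simp: algebra_simps)

lemma polar_has_field_derivative:
  fixes x c w :: complex
  assumes "x \<noteq> c"
  shows "((\<lambda>x. 3 / (4 * (x - c) ^ 2) + w / (x - c)) has_field_derivative
     - (3 / (2 * (x - c) ^ 3) + w / (x - c) ^ 2)) (at x)"
proof -
  have nz: "x - c \<noteq> 0"
    using assms by simp
  have 1: "((\<lambda>z::complex. 3 / (4 * z ^ 2) + w / z) has_field_derivative - (3 / (2 * z ^ 3) + w / z ^ 2)) (at z)"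
    if "z \<noteq> 0" for z
    using that by (auto intro!: derivative_eq_intros simp: field_simps power2_eq_square power3_eq_cube)
  have "((\<lambda>x. x - c) has_field_derivative 1) (at x)"
    by (auto intro!: derivative_eq_intros)
  from DERIV_chain2[where g = "\<lambda>x. x - c", OF 1[OF nz] this] show ?thesis
    by (simp only: mult_1_right)
qed

lemma K_has_field_derivative:
  assumes "x \<notin> q ` ({1..n} - {i})"
  shows "(K i has_field_derivative dK i x) (at x)"
proof -
  have "((\<lambda>x. topP n a x / lam ^ 2 + (\<Sum>k\<in>{1..n} - {i}. 3 / (4 * (x - q k) ^ 2) + u k / (x - q k)) + G x)
     has_field_derivative dtopP n a x / lam ^ 2
       + (\<Sum>k\<in>{1..n} - {i}. - (3 / (2 * (x - q k) ^ 3) + u k / (x - q k) ^ 2)) + deriv G x) (at x)"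
    using assms
    by (intro DERIV_add DERIV_cdivide DERIV_sum topP_has_field_derivative polar_has_field_derivative
          polyfun_less_differentiable[OF polyfun_less_lowP]) auto
  then show ?thesis
    unfolding K_def[abs_def] dK_def by (simp only: sum_negf add_uminus_conv_diff)
qed

lemma Qf_has_field_derivative:
  assumes "x \<notin> q ` {1..n}"
  shows "(Qf has_field_derivative dQf x) (at x)"
proof -
  have "((\<lambda>x. topP n a x / lam ^ 2 + (\<Sum>k=1..n. 3 / (4 * (x - q k) ^ 2) + u k / (x - q k)) + G x)
     has_field_derivative dtopP n a x / lam ^ 2
       + (\<Sum>k=1..n. - (3 / (2 * (x - q k) ^ 3) + u k / (x - q k) ^ 2)) + deriv G x) (at x)"
    using assms
    by (intro DERIV_add DERIV_cdivide DERIV_sum topP_has_field_derivative polar_has_field_derivative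
          polyfun_less_differentiable[OF polyfun_less_lowP]) auto
  then show ?thesis
    unfolding Qf_eq[abs_def] dQf_def by (simp only: sum_negf add_uminus_conv_diff)
qed

lemma open_avoiding_nodes: "open (- q ` ({1..n} - J))"
  by (intro open_Compl finite_imp_closed) auto

lemma eventually_avoiding_nodes:
  assumes "z \<notin> q ` ({1..n} - J)"
  shows "\<forall>\<^sub>F x in at z. x \<notin> q ` ({1..n} - J)"
  using eventually_at_in_open'[OF open_avoiding_nodes, of z J] assms by auto

lemma node_notin: "i \<in> {1..n} \<Longrightarrow> q i \<notin> q ` ({1..n} - {i})"
  using inj_on_image_mem_iff[OF inj_q, of i "{1..n} - {i}"] by simp

lemma K_analytic:
  assumes "i \<in> {1..n}"
  shows "K i analytic_on {q i}"
proof -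
  have "K i holomorphic_on - q ` ({1..n} - {i})"
    unfolding holomorphic_on_def field_differentiable_def
    using K_has_field_derivative has_field_derivative_at_within by blast
  then show ?thesis
    using open_avoiding_nodes node_notin[OF assms] by (auto simp: analytic_at)
qed

lemma dtopP_isCont: "isCont (dtopP n a) x"
  unfolding dtopP_def[abs_def] by (intro continuous_intros)

lemma polyfun_less_isCont: "polyfun_less m f \<Longrightarrow> isCont f x"
  using polyfun_less_differentiable DERIV_isCont by blast

lemma dK_isCont:
  assumes "i \<in> {1..n}"
  shows "isCont (dK i) (q i)"
  unfolding dK_def[abs_def] using q_diff_nz[OF assms]
  by (intro continuous_intros dtopP_isCont polyfun_less_isCont[OF polyfun_less_deriv[OF polyfun_less_lowP]])
     (auto simp: lam_nz)

definition Ldot :: "tvec \<Rightarrow> nat \<Rightarrow> complex \<Rightarrow> complex" where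
  "Ldot w i x = da w x / lam ^ 2 + (\<Sum>k\<in>{1..n} - {i}. dpol w k x) + (\<Sum>k=1..n. dG w k * lagr n q k x)"

lemma Qdot_split: "i \<in> {1..n} \<Longrightarrow> Qdot w x = dpol w i x + Ldot w i x"
  unfolding Qdot_def Ldot_def by (subst sum.remove[of _ i]) auto

text \<open>The linearised condition \<open>K_i(q_i) = u_i^2\<close>; the \<open>c1\<close> term
  accounts for the motion of the node itself. The remaining terms of \<open>dG\<close> are there to
  cancel the other parts of \<open>Ldot\<close>.\<close>

lemma Ldot_at: "i \<in> {1..n} \<Longrightarrow> Ldot w i (q i) = 2 * u i * du w i - c1 i * w (Cq i)"
  unfolding Ldot_def by (subst sum_lagr_at[OF inj_q]) (auto simp: dG_def)

lemma dpol_isCont: "x \<noteq> q k \<Longrightarrow> isCont (dpol w k) x"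
  unfolding dpol_def[abs_def] by (intro continuous_intros) auto

lemma da_isCont: "isCont (da w) x"
  unfolding da_def[abs_def] by (intro continuous_intros)

lemma Ldot_isCont:
  assumes "x \<notin> q ` ({1..n} - {i})"
  shows "isCont (Ldot w i) x"
  unfolding Ldot_def[abs_def] using assms
  by (intro continuous_intros da_isCont dpol_isCont polyfun_less_isCont[OF polyfun_less_lagr]) (auto simp: lam_nz)

lemma Qdot_add: "Qdot (\<lambda>k. w k + w' k) x = Qdot w x + Qdot w' x"
proof -
  have da: "da (\<lambda>k. w k + w' k) y = da w y + da w' y" for y
    by (simp add: da_def distrib_right sum.distrib)
  have db: "db (\<lambda>k. w k + w' k) y = db w y + db w' y" for y
    by (simp add: db_def distrib_right sum.distrib)
  have "dp (\<lambda>k. w k + w' k) i = dp w i + dp w' i" for i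
    by (simp add: dp_def da db add_divide_distrib distrib_left)
  then have du: "du (\<lambda>k. w k + w' k) i = du w i + du w' i" for i
    by (simp add: du_def add_divide_distrib)
  have dpol: "dpol (\<lambda>k. w k + w' k) i y = dpol w i y + dpol w' i y" for i y
    by (simp add: dpol_def du add_divide_distrib distrib_left)
  have dG: "dG (\<lambda>k. w k + w' k) i = dG w i + dG w' i" for i
    by (simp add: dG_def du da dpol sum.distrib add_divide_distrib distrib_left)
  show ?thesis
    by (simp add: Qdot_def da dpol dG sum.distrib add_divide_distrib distrib_right)
qed

lemma Qdot_scale: "Qdot (\<lambda>k. c * w k) x = c * Qdot w x"
proof -
  have da: "da (\<lambda>k. c * w k) y = c * da w y" for y
    by (simp add: da_def sum_distrib_left mult.assoc)
  have db: "db (\<lambda>k. c * w k) y = c * db w y" for y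
    by (simp add: db_def sum_distrib_left mult.assoc)
  have "dp (\<lambda>k. c * w k) i = c * dp w i" for i
    by (simp add: dp_def da db algebra_simps)
  then have du: "du (\<lambda>k. c * w k) i = c * du w i" for i
    by (simp add: du_def algebra_simps)
  have dpol: "dpol (\<lambda>k. c * w k) i y = c * dpol w i y" for i y
    by (simp add: dpol_def du algebra_simps)
  have dG: "dG (\<lambda>k. c * w k) i = c * dG w i" for i
    by (simp add: dG_def du da dpol algebra_simps sum_distrib_left)
  show ?thesis
    by (simp add: Qdot_def da dpol dG algebra_simps sum_distrib_left)
qed

lemma Qdot_zero: "Qdot (\<lambda>k. 0) x = 0"
  using Qdot_scale[of 0 "\<lambda>_. 0"] by simp

lemma Qdot_sum: "Qdot (\<lambda>k. \<Sum>i\<in>I. f i * w i k) x = (\<Sum>i\<in>I. f i * Qdot (w i) x)"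
  by (induction I rule: infinite_finite_induct) (auto simp: Qdot_zero Qdot_add Qdot_scale)

text \<open>Moving \<open>b_i\<close> changes \<open>p_j / lam\<close> by
  \<open>q_j^(i-1) / (2 p_j)\<close>, and the \<open>v_j\<close>-component of the flow is chosen to
  undo this.\<close>

lemma du_U_flow:
  assumes "i \<in> {1..n}" "j \<in> {1..n}"
  shows "du (U_flow n lam i pt) j = 0"
proof -
  have "db (U_flow n lam i pt) (q j) = (\<Sum>k=1..n. if k = i then lam * q j ^ (k - 1) else 0)"
    unfolding db_def by (intro sum.cong) (auto simp: U_flow_components(3)[OF assms(1)])
  also have "\<dots> = lam * q j ^ (i - 1)"
    using assms by simp
  finally show ?thesis
    using assms lam_nz by (simp add: du_def dp_def da_def U_flow_components)
qed

lemma Qdot_U_flow: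
  assumes "i \<in> {1..n}"
  shows "Qdot (U_flow n lam i pt) x = 0"
proof -
  have da: "da (U_flow n lam i pt) y = 0" for y
    by (simp add: da_def U_flow_components[OF assms])
  have dpol: "dpol (U_flow n lam i pt) j y = 0" if "j \<in> {1..n}" for j y
    by (simp only: dpol_def du_U_flow[OF assms that] U_flow_components(2)[OF assms]) simp
  have "dG (U_flow n lam i pt) j = 0" if "j \<in> {1..n}" for j
    using that by (simp add: dG_def du_U_flow[OF assms that] U_flow_components(2)[OF assms] da dpol)
  then show ?thesis
    by (simp add: Qdot_def da dpol)
qed

text \<open>The terms of \<open>V0\<close> with \<open>T_fun\<close> and the derivative of
  \<open>Q0\<close> cancel the induced change of \<open>p_j / lam\<close>. The terms left over
  combine \<open>p_j\<close> and \<open>lam * v_j\<close> into \<open>lam * u_j\<close> and form the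
  residue at \<open>q_j\<close> demanded by \<open>A = lam / (x - q_i)\<close>.\<close>

lemma du_V_flow_other:
  assumes "i \<in> {1..n}" "j \<in> {1..n}" "j \<noteq> i"
  shows "du (V_flow n lam i pt) j = lam * (3 / (2 * (q j - q i) ^ 3) - u j / (q j - q i) ^ 2)"
proof -
  define d where "d = q i - q j"
  have d: "d \<noteq> 0" "p j \<noteq> 0" "q j - q i = - d"
    using q_diff_nz p_nz assms by (auto simp: d_def)
  have "da (V_flow n lam i pt) (q j) = lam * Tsum n a (q i) (q j)"
    by (simp add: da_def Tsum_def V_flow_components[OF assms(1)] sum_distrib_left mult.assoc)
  moreover have "db (V_flow n lam i pt) (q j) = 0"
    by (simp add: db_def V_flow_components[OF assms(1)])
  ultimately have "du (V_flow n lam i pt) j =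
      (poly (pderiv (Q0 n a b)) (q j) * (lam / d) + lam * Tsum n a (q i) (q j)) / (2 * p j) / lam
      + (- (Tsum n a (q i) (q j) / (2 * p j) + poly (pderiv (Q0 n a b)) (q j) / (2 * p j * d) + p j / d ^ 2)
        - lam * (3 / (2 * d ^ 3) + v j / d ^ 2))"
    unfolding du_def dp_def V_flow_components(3)[OF assms(1)] V_flow_components(4)[OF assms(1,3)]
    using assms by (simp add: d_def)
  also have "\<dots> = - p j / d ^ 2 - lam * (3 / (2 * d ^ 3) + v j / d ^ 2)"
    using d lam_nz by (simp add: add_divide_distrib)
  also have "\<dots> = lam * (3 / (2 * (- d) ^ 3) - u j / (- d) ^ 2)"
    using lam_nz by (simp add: u_def algebra_simps add_divide_distrib)
  finally show ?thesis
    unfolding d(3) .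
qed

text \<open>The change of \<open>p_i / lam\<close> due to the motion of \<open>q_i\<close> is
  \<open>- Q0'(q_i) u_i / p_i\<close>. Its part with \<open>v_i\<close> is cancelled in
  \<open>V0\<close>; the other part, \<open>- Q0'(q_i) / lam\<close>, supplies both
  \<open>dtopP\<close> and the \<open>b\<close>-part of \<open>deriv G\<close> in
  \<open>c1\<close>.\<close>

lemma du_V_flow_self:
  assumes "i \<in> {1..n}"
  shows "du (V_flow n lam i pt) i = - lam * c1 i"
proof -
  have p: "p i \<noteq> 0"
    using p_nz assms by auto
  define s1 where "s1 = (\<Sum>j\<in>{1..n} - {i}. p j / (q i - q j) ^ 2)"
  define s2 where "s2 = (\<Sum>j\<in>{1..n} - {i}. 3 / (2 * (q i - q j) ^ 3))"
  define s3 where "s3 = (\<Sum>j\<in>{1..n} - {i}. v j / (q i - q j) ^ 2)"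
  define d0 where "d0 = poly (pderiv (Q0 n a b)) (q i)"
  define t where "t = Tsum n a (q i) (q i)"
  have "da (V_flow n lam i pt) (q i) = lam * t"
    by (simp add: da_def Tsum_def t_def V_flow_components[OF assms] sum_distrib_left mult.assoc)
  moreover have "db (V_flow n lam i pt) (q i) = 0"
    by (simp add: db_def V_flow_components[OF assms])
  ultimately have 1: "du (V_flow n lam i pt) i = (d0 * (- 2 * lam * u i) + lam * t) / (2 * p i) / lam
    + (- (t / (2 * p i) - d0 * v i / p i + deriv (R_fun n q v p) (q i) - s1) + lam * (s2 + s3 - deriv (S_fun n q v) (q i)))"
    unfolding du_def dp_def V_flow_components(3,5)[OF assms]
    by (simp add: d0_def t_def s1_def s2_def s3_def)
  have "(G has_field_derivative
      (\<Sum>j=1..n. b j * (of_nat (j - 1) * q i ^ (j - 1 - 1))) / lam ^ 2 + deriv (R_fun n q v p) (q i) / lam + deriv (S_fun n q v) (q i)) (at (q i))"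
    unfolding lowP_def[abs_def]
    by (intro DERIV_add DERIV_cdivide DERIV_sum DERIV_cmult power_has_field_derivative
       polyfun_less_differentiable[OF polyfun_less_R_fun] polyfun_less_differentiable[OF polyfun_less_S_fun])
  then have G': "deriv G (q i) = (\<Sum>j=1..n. b j * (of_nat (j - 1) * q i ^ (j - 2))) / lam ^ 2
      + deriv (R_fun n q v p) (q i) / lam + deriv (S_fun n q v) (q i)"
    using DERIV_imp_deriv by (simp add: diff_diff_add numeral_2_eq_2)
  have "(\<Sum>k\<in>{1..n} - {i}. 3 / (2 * (q i - q k) ^ 3) + u k / (q i - q k) ^ 2) = s2 + s1 / lam + s3"
    by (simp add: s1_def s2_def s3_def u_def sum.distrib add_divide_distrib sum_divide_distrib mult.commute)
  then have 2: "c1 i = d0 / lam ^ 2 - (s2 + s1 / lam + s3) + deriv (R_fun n q v p) (q i) / lam + deriv (S_fun n q v) (q i)"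
    unfolding c1_def G' d0_def poly_pderiv_Q0 by (simp add: add_divide_distrib)
  show ?thesis
    unfolding 1 2 u_def using p lam_nz by (simp add: field_simps power2_eq_square)
qed

text \<open>The right-hand side \<open>Q' A + 2 Q A' - A''' / 2\<close> of the isomonodromy equation for \<open>A = 1 / (x - q\<^sub>i)\<close>.\<close>
definition vE :: "nat \<Rightarrow> complex \<Rightarrow> complex" where
  "vE i x = dQf x / (x - q i) - 2 * Qf x / (x - q i) ^ 2 + 3 / (x - q i) ^ 4"

lemma nodes_open: "open (- q ` {1..n})"
  using open_avoiding_nodes[of "{}"] by simp

lemma Qf_holomorphic: "Qf holomorphic_on - q ` {1..n}"
  unfolding holomorphic_on_def field_differentiable_def
  using Qf_has_field_derivative has_field_derivative_at_within by blast

lemma dQf_holomorphic: "dQf holomorphic_on - q ` {1..n}"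
proof -
  have "deriv Qf holomorphic_on - q ` {1..n}"
    by (intro holomorphic_deriv Qf_holomorphic nodes_open)
  moreover have "deriv Qf x = dQf x" if "x \<in> - q ` {1..n}" for x
    using that Qf_has_field_derivative by (intro DERIV_imp_deriv) auto
  ultimately show ?thesis
    by (rule holomorphic_transform)
qed

lemma Qdot_holomorphic: "Qdot w holomorphic_on - q ` {1..n}"
  unfolding Qdot_def[abs_def] da_def dpol_def using lam_nz
  by (intro holomorphic_intros polyfun_less_holomorphic[OF polyfun_less_lagr]) auto

lemma vE_holomorphic: "i \<in> {1..n} \<Longrightarrow> vE i holomorphic_on - q ` {1..n}"
  unfolding vE_def[abs_def]
  by (intro holomorphic_intros Qf_holomorphic dQf_holomorphic) auto

text \<open>Pole terms and polynomials of degree less than \<open>n\<close> already have order at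
  most \<open>x^(n-1)\<close>. Only \<open>topP\<close> can exceed it, and there the
  \<open>a\<close>-components subtract \<open>Tsum\<close>. The factor \<open>1 / lam\<close>
  normalises to \<open>A = 1 / (x - q_i)\<close>.\<close>

lemma defect_bigo:
  assumes i: "i \<in> {1..n}"
  shows "(\<lambda>x. vE i x - Qdot (\<lambda>k. 1 / lam * V_flow n lam i pt k) x) \<in> O[at_infinity](\<lambda>x. x ^ (n - 1))"
proof -
  define w where "w = (\<lambda>k. 1 / lam * V_flow n lam i pt k)"
  define N where "N = (\<lambda>x. (\<Sum>k=1..n. 3 / (4 * (x - q k) ^ 2) + u k / (x - q k)) + G x)"
  define N' where "N' = (\<lambda>x. deriv G x - (\<Sum>k=1..n. 3 / (2 * (x - q k) ^ 3) + u k / (x - q k) ^ 2))"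
  let ?O = "O[at_infinity](\<lambda>x::complex. x ^ (n - 1))"
  have pole1: "(\<lambda>x. e / (x - z)) \<in> ?O" for e z :: complex
    using pole_bigo[of e z 1] by simp
  have pole2: "(\<lambda>x. e / (c * (x - z) ^ m)) \<in> ?O" for e z c :: complex and m
    using pole_bigo[of "e / c" z m] by simp
  have poly: "f \<in> ?O" if "polyfun_less n f" for f
    using polyfun_less_bigo[of "n - 1" f] that n_pos by simp
  have N: "N \<in> ?O"
    unfolding N_def by (intro sum_in_bigo big_sum_in_bigo pole1 pole2 poly polyfun_less_lowP)
  have N': "N' \<in> ?O"
    unfolding N'_def by (intro sum_in_bigo big_sum_in_bigo pole2 pole_bigo poly polyfun_less_deriv polyfun_less_lowP)
  have da: "da w x = Tsum n a (q i) x" for x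
    using lam_nz by (simp add: da_def Tsum_def w_def V_flow_components[OF i])
  have eq: "vE i x - Qdot w x =
      1 / lam ^ 2 * (dtopP n a x / (x - q i) - 2 * topP n a x / (x - q i) ^ 2 - Tsum n a (q i) x)
      + N' x / (x - q i) ^ 1 - 2 * (N x / (x - q i) ^ 2) + 3 / (x - q i) ^ 4
      - (\<Sum>k=1..n. dpol w k x) - (\<Sum>k=1..n. dG w k * lagr n q k x)" for x
  proof -
    have 1: "Qf x = topP n a x / lam ^ 2 + N x"
      by (simp only: Qf_eq N_def add.assoc)
    have 2: "dQf x = dtopP n a x / lam ^ 2 + N' x"
      by (simp only: dQf_def N'_def algebra_simps)
    have 3: "(l1 / m + n') / y - 2 * (l2 / m + n1) / y ^ 2 + r - (t / m + s1 + s2)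
        = 1 / m * (l1 / y - 2 * l2 / y ^ 2 - t) + n' / y ^ 1 - 2 * (n1 / y ^ 2) + r - s1 - s2"
      for l1 l2 m n1 n' y t r s1 s2 :: complex
      by (simp add: algebra_simps add_divide_distrib)
    show ?thesis
      unfolding vE_def 1 2 Qdot_def da 3 ..
  qed
  have dpol: "dpol w k \<in> ?O" for k
    unfolding dpol_def[abs_def] by (intro sum_in_bigo pole1 pole2 pole_bigo)
  show ?thesis
    unfolding w_def[symmetric] eq
    by (intro sum_in_bigo cmult_bigo topP_remainder_bigo n_pos mult_pole_bigo N N' pole_bigo
          big_sum_in_bigo dpol poly polyfun_less_lagr)
qed

text \<open>The velocities of the node \<open>q_j\<close> and of \<open>u_j\<close> are precisely
  the polar coefficients in the two local expansions, and \<open>Ldot_at\<close> provides the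
  matching regular part.\<close>

lemma defect_tendsto_0:
  assumes i: "i \<in> {1..n}" and j: "j \<in> {1..n}"
  shows "((\<lambda>x. vE i x - Qdot (\<lambda>k. 1 / lam * V_flow n lam i pt k) x) \<longlongrightarrow> 0) (at (q j))"
proof -
  define w where "w = (\<lambda>k. 1 / lam * V_flow n lam i pt k)"
  have L: "(Ldot w j \<longlongrightarrow> 2 * u j * du w j - c1 j * w (Cq j)) (at (q j))"
    using Ldot_isCont[OF node_notin[OF j], of w] Ldot_at[OF j, of w] by (simp add: isCont_def)
  have du: "du w k = 1 / lam * du (V_flow n lam i pt) k" for k
    unfolding w_def du_def dp_def da_def db_def by (simp add: sum_distrib_left algebra_simps)
  have K: "(K j \<longlongrightarrow> u j ^ 2) (at (q j))"
    using K_has_field_derivative[OF node_notin[OF j], THEN DERIV_isCont] K_at[OF j] by (simp add: isCont_def)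
  have K': "(dK j \<longlongrightarrow> c1 j) (at (q j))"
    using dK_isCont[OF j] by (simp add: isCont_def dK_at)
  show ?thesis
  proof (cases "j = i")
    case True
    have wq: "w (Cq i) = - 2 * u i" and wu: "du w i = - c1 i"
      using lam_nz i by (simp_all add: du) (simp_all add: w_def V_flow_components[OF i] du_V_flow_self[OF i])
    have "((\<lambda>x. (- 3 / (2 * (x - q i) ^ 3) - u i / (x - q i) ^ 2 + dK i x) / (x - q i)
      - 2 * (3 / (4 * (x - q i) ^ 2) + u i / (x - q i) + K i x) / (x - q i) ^ 2 + 3 / (x - q i) ^ 4
      - (3 * (- 2 * u i) / (2 * (x - q i) ^ 3) + u i * (- 2 * u i) / (x - q i) ^ 2 + (- c1 i) / (x - q i) + Ldot w i x)) \<longlongrightarrow> 0) (at (q i))"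
    proof (rule flow_defect_tendsto_0_self)
      show "K i analytic_on {q i}" "K i (q i) = u i ^ 2"
        using K_analytic K_at i by auto
      have deriv_K: "dK i x = deriv (K i) x" if "x \<notin> q ` ({1..n} - {i})" for x
        using K_has_field_derivative[OF that] by (metis DERIV_imp_deriv)
      show "\<forall>\<^sub>F x in at (q i). dK i x = deriv (K i) x"
        using eventually_avoiding_nodes[OF node_notin[OF i]] by eventually_elim (rule deriv_K)
      show "c1 i = deriv (K i) (q i)"
        using deriv_K[OF node_notin[OF i]] by (simp add: dK_at)
      \<comment> \<open>The two terms of \<open>Ldot_at\<close> cancel:
        \<open>2 u_i (- c1 i) - c1 i (- 2 u_i) = 0\<close>.\<close>
      show "(Ldot w i \<longlongrightarrow> 0) (at (q i))"
        using L unfolding True wq wu by (simp add: mult_ac)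
    qed
    then show ?thesis
      unfolding w_def[symmetric] True vE_def dQf_split[OF i] Qf_split[OF i] Qdot_split[OF i] dpol_def wq wu .
  next
    case False
    define d where "d = q j - q i"
    have d: "d \<noteq> 0" and qi: "q i = q j - d"
      using q_diff_nz[OF j i] False by (auto simp: d_def)
    have wq: "w (Cq j) = - 1 / d" and wu: "du w j = 3 / (2 * d ^ 3) - u j / d ^ 2"
    proof -
      have "q i - q j = - d"
        by (simp add: d_def)
      then show "w (Cq j) = - 1 / d"
        using lam_nz False j d by (simp add: w_def V_flow_components(3)[OF i])
      show "du w j = 3 / (2 * d ^ 3) - u j / d ^ 2"
        using lam_nz unfolding du du_V_flow_other[OF i j False] d_def by simp
    qed
    have "((\<lambda>x. (- 3 / (2 * (x - q j) ^ 3) - u j / (x - q j) ^ 2 + dK j x) / (x - (q j - d))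
      - 2 * (3 / (4 * (x - q j) ^ 2) + u j / (x - q j) + K j x) / (x - (q j - d)) ^ 2 + 3 / (x - (q j - d)) ^ 4
      - (3 * (- 1 / d) / (2 * (x - q j) ^ 3) + u j * (- 1 / d) / (x - q j) ^ 2
          + (3 / (2 * d ^ 3) - u j / d ^ 2) / (x - q j) + Ldot w j x)) \<longlongrightarrow> 0) (at (q j))"
    proof (rule flow_defect_tendsto_0_other[OF d K K'])
      have "2 * u j * du w j - c1 j * w (Cq j) = 2 * u j * (3 / (2 * d ^ 3) - u j / d ^ 2) + c1 j / d"
        unfolding wq wu by simp
      then show "(Ldot w j \<longlongrightarrow> 2 * u j * (3 / (2 * d ^ 3) - u j / d ^ 2) + c1 j / d) (at (q j))"
        using L by (simp only:)
    qed
    then show ?thesis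
      unfolding w_def[symmetric] vE_def dQf_split[OF j] Qf_split[OF j] Qdot_split[OF j] dpol_def wq wu qi[symmetric] .
  qed
qed

lemma Qdot_V_flow:
  assumes i: "i \<in> {1..n}" and x: "x \<notin> q ` {1..n}"
  shows "Qdot (V_flow n lam i pt) x = lam * vE i x"
proof -
  have "vE i x - Qdot (\<lambda>k. 1 / lam * V_flow n lam i pt k) x = 0"
    by (rule zero_of_bigo_vanishing[OF n_pos inj_q _ defect_tendsto_0[OF i] defect_bigo[OF i] x])
       (intro holomorphic_intros vE_holomorphic Qdot_holomorphic i)
  then show ?thesis
    using lam_nz unfolding Qdot_scale by (simp add: field_simps)
qed

section \<open>Kernel of the variation, and spanning and independence of the flows at a
  point\<close>

lemma da_eq_0_imp:
  assumes "polyfun_less n f" "\<And>x. x \<notin> q ` {1..n} \<Longrightarrow> da w x = f x" "j \<in> {1..n}"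
  shows "w (Ca j) = 0"
proof -
  obtain s where s: "\<forall>k\<ge>n. coeff s k = 0" "f = poly s"
    using assms unfolding polyfun_less_def by auto
  define r where "r = (\<Sum>j=1..n. monom (w (Ca j)) (n + j - 1))"
  have "infinite (- q ` {1..n})"
    unfolding Compl_eq_Diff_UNIV by (intro Diff_infinite_finite infinite_UNIV_char_0) simp
  moreover have "- q ` {1..n} \<subseteq> {x. poly (r - s) x = 0}"
    using assms(2) s(2) by (auto simp: r_def da_def poly_sum poly_monom)
  ultimately have "infinite {x. poly (r - s) x = 0}"
    using finite_subset by blast
  then have "r = s"
    using poly_roots_finite[of "r - s"] by auto
  \<comment> \<open>The powers in \<open>da\<close> start at \<open>x^n\<close>, where the
    coefficients of \<open>s\<close> already vanish.\<close>
  moreover have "n \<le> n + j - 1"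
    using assms(3) by auto
  ultimately have "coeff r (n + j - 1) = 0"
    using s(1) by blast
  moreover have "coeff r (n + j - 1) = (\<Sum>k=1..n. if k = j then w (Ca k) else 0)"
    unfolding r_def coeff_sum coeff_monom using assms(3) by (intro sum.cong) auto
  ultimately show ?thesis
    using assms(3) by simp
qed

text \<open>The polar coefficients give the velocities of \<open>q\<close> and then of
  \<open>u\<close>; without poles, the degree separates the \<open>a\<close>-part from the
  interpolated part. The condition on the \<open>b\<close>-components removes the directions
  \<open>U_i\<close>: it makes \<open>dp\<close> vanish, so that \<open>du = 0\<close> forces the
  \<open>v\<close>-components to vanish.\<close>

lemma Qdot_eq_0_imp:
  assumes Qdot: "\<And>x. x \<notin> q ` {1..n} \<Longrightarrow> Qdot w x = 0" and b: "\<And>j. j \<in> {1..n} \<Longrightarrow> w (Cb j) = 0"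
    and j: "j \<in> {1..n}"
  shows "w (Ca j) = 0" "w (Cq j) = 0" "w (Cv j) = 0"
proof -
  have ev: "\<forall>\<^sub>F x in at (q i). dpol w i x + Ldot w i x = 0 \<and> x \<noteq> q i" if i: "i \<in> {1..n}" for i
  proof -
    have "\<forall>\<^sub>F x in at (q i). x \<noteq> q i \<and> x \<notin> q ` ({1..n} - {i})"
      by (intro eventually_conj eventually_neq_at_within eventually_avoiding_nodes node_notin i)
    then show ?thesis
      by eventually_elim (use Qdot Qdot_split[OF i] in auto)
  qed
  have L: "(Ldot w i \<longlongrightarrow> Ldot w i (q i)) (at (q i))" if "i \<in> {1..n}" for i
    using Ldot_isCont[OF node_notin[OF that]] by (simp add: isCont_def)
  have q0: "w (Cq i) = 0" if i: "i \<in> {1..n}" for i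
  proof -
    \<comment> \<open>Multiplication by \<open>(x - q i) ^ 3\<close> isolates the coefficient of the
      triple pole in the limit.\<close>
    have "((\<lambda>x. 3 * w (Cq i) / 2 + u i * w (Cq i) * (x - q i) + du w i * (x - q i) ^ 2 + Ldot w i x * (x - q i) ^ 3) \<longlongrightarrow>
       3 * w (Cq i) / 2 + u i * w (Cq i) * (q i - q i) + du w i * (q i - q i) ^ 2 + Ldot w i (q i) * (q i - q i) ^ 3) (at (q i))"
      by (intro tendsto_intros L i) auto
    moreover have "\<forall>\<^sub>F x in at (q i). 3 * w (Cq i) / 2 + u i * w (Cq i) * (x - q i) + du w i * (x - q i) ^ 2 + Ldot w i x * (x - q i) ^ 3 = 0"
      using ev[OF i]
    proof eventually_elim
      case (elim x)
      have "3 * e / 2 + f * y + g * y ^ 2 + l * y ^ 3 = y ^ 3 * (3 * e / (2 * y ^ 3) + f / y ^ 2 + g / y + l)"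
        if "y \<noteq> 0" for y e f g l :: complex
        using that by (simp add: field_simps power2_eq_square power3_eq_cube)
      from this[of "x - q i"] show ?case
        using elim by (simp add: dpol_def)
    qed
    ultimately have "3 * w (Cq i) / 2 + u i * w (Cq i) * (q i - q i) + du w i * (q i - q i) ^ 2 + Ldot w i (q i) * (q i - q i) ^ 3 = 0"
      using tendsto_unique[OF at_neq_bot _ tendsto_eventually] by blast
    then show ?thesis
      by simp
  qed
  have u0: "du w i = 0" if i: "i \<in> {1..n}" for i
  proof -
    have "((\<lambda>x. du w i + Ldot w i x * (x - q i)) \<longlongrightarrow> du w i + Ldot w i (q i) * (q i - q i)) (at (q i))"
      by (intro tendsto_intros L i)
    moreover have "\<forall>\<^sub>F x in at (q i). du w i + Ldot w i x * (x - q i) = 0"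
      using ev[OF i]
    proof eventually_elim
      case (elim x)
      have "du w i + Ldot w i x * (x - q i) = (x - q i) * (du w i / (x - q i) + Ldot w i x)"
        using elim by (simp add: distrib_left mult.commute)
      then show ?case
        using elim by (simp add: dpol_def q0[OF i])
    qed
    ultimately have "du w i + Ldot w i (q i) * (q i - q i) = 0"
      using tendsto_unique[OF at_neq_bot _ tendsto_eventually] by blast
    then show ?thesis
      by simp
  qed
  have dpol0: "dpol w i x = 0" if "i \<in> {1..n}" for i x
    unfolding dpol_def q0[OF that] u0[OF that] by simp
  have a0: "w (Ca i) = 0" if i: "i \<in> {1..n}" for i
  proof (rule da_eq_0_imp[OF _ _ i])
    show "polyfun_less n (\<lambda>x. lam ^ 2 * (\<Sum>k=1..n. (- dG w k) * lagr n q k x))"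
      by (intro polyfun_less_cmult polyfun_less_sum_lagr)
    show "da w x = lam ^ 2 * (\<Sum>k=1..n. (- dG w k) * lagr n q k x)" if "x \<notin> q ` {1..n}" for x
    proof -
      have "da w x / lam ^ 2 + (\<Sum>k=1..n. dG w k * lagr n q k x) = 0"
        using Qdot[OF that] unfolding Qdot_def by (simp add: dpol0)
      then show ?thesis
        using lam_nz by (simp add: sum_negf field_simps eq_neg_iff_add_eq_0)
    qed
  qed
  show "w (Ca j) = 0" "w (Cq j) = 0"
    using a0 q0 j by auto
  have "dp w j = 0"
    unfolding dp_def da_def db_def using a0 b q0 j by simp
  then show "w (Cv j) = 0"
    using u0[OF j] unfolding du_def by simp
qed

lemma flow_frame_support:
  assumes i: "i \<in> {1..n}" and c: "c \<notin> coords n"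
  shows "U_flow n lam i pt c = 0 \<and> V_flow n lam i pt c = 0"
proof (cases c)
  case (Ca j)
  then show ?thesis
    using c U_flow_components(1)[OF i, of j] V_flow_components(1)[OF i, of j] by (auto simp: coords_def)
next
  case (Cb j)
  then have "j \<noteq> i"
    using c i by (auto simp: coords_def)
  then show ?thesis
    using Cb U_flow_components(3)[OF i, of j] V_flow_components(2)[OF i, of j] by simp
next
  case (Cq j)
  then have "j \<notin> {1..n}" "j \<noteq> i"
    using c i by (auto simp: coords_def)
  then show ?thesis
    using Cq U_flow_components(2)[OF i, of j] V_flow_components(3)[OF i, of j] by (auto split: if_splits)
next
  case (Cv j)
  then have "j \<notin> {1..n}" "j \<noteq> i"
    using c i by (auto simp: coords_def)
  then show ?thesis
    using Cv U_flow_components(4)[OF i, of j] V_flow_components(4)[OF i, of j] by (auto split: if_splits)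
qed

text \<open>The \<open>V_i\<close> have no \<open>b\<close>-components and the \<open>U_i\<close> do
  not change the potential, so the two sets of coefficients can be chosen independently. The
  difference from \<open>w\<close> then lies in the trivial kernel of
  \<open>Qdot_eq_0_imp\<close>.\<close>

lemma flow_combination:
  assumes supp: "\<And>c. c \<notin> coords n \<Longrightarrow> w c = 0"
    and eq: "\<And>x. x \<notin> q ` {1..n} \<Longrightarrow> Qdot w x = (\<Sum>i=1..n. \<alpha> i * vE i x)"
  shows "w = (\<Sum>i=1..n. (w (Cb i) / lam) *\<^sub>T U_flow n lam i pt) + (\<Sum>i=1..n. (\<alpha> i / lam) *\<^sub>T V_flow n lam i pt)"
proof -
  define wU where "wU = (\<lambda>k. \<Sum>i=1..n. w (Cb i) / lam * U_flow n lam i pt k)"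
  define wV where "wV = (\<lambda>k. \<Sum>i=1..n. \<alpha> i / lam * V_flow n lam i pt k)"
  define w' where "w' = (\<lambda>k. w k + (-1) * (wU k + wV k))"
  have QU: "Qdot wU x = 0" for x
    unfolding wU_def Qdot_sum by (simp add: Qdot_U_flow)
  have QV: "Qdot wV x = (\<Sum>i=1..n. \<alpha> i * vE i x)" if "x \<notin> q ` {1..n}" for x
    unfolding wV_def Qdot_sum
  proof (rule sum.cong)
    fix i assume "i \<in> {1..n}"
    then show "\<alpha> i / lam * Qdot (V_flow n lam i pt) x = \<alpha> i * vE i x"
      using Qdot_V_flow that lam_nz by simp
  qed simp
  have Q': "Qdot w' x = 0" if "x \<notin> q ` {1..n}" for x
    unfolding w'_def Qdot_add Qdot_scale QU QV[OF that] eq[OF that] by simp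
  have b': "w' (Cb j) = 0" if j: "j \<in> {1..n}" for j
  proof -
    have "wU (Cb j) = (\<Sum>i=1..n. if i = j then w (Cb i) else 0)"
      unfolding wU_def using lam_nz by (intro sum.cong) (simp_all add: U_flow_components)
    then have "wU (Cb j) = w (Cb j)"
      using j by simp
    moreover have "wV (Cb j) = 0"
      unfolding wV_def by (simp add: V_flow_components)
    ultimately show ?thesis
      by (simp add: w'_def)
  qed
  have "w' c = 0" for c
  proof (cases "c \<in> coords n")
    case True
    then obtain j where "j \<in> {1..n}" "c \<in> {Ca j, Cb j, Cq j, Cv j}"
      by (auto simp: coords_def simp del: atLeastAtMost_iff)
    then show ?thesis
      using Qdot_eq_0_imp[of w' j, OF Q' b'] b'[of j] by blast
  next
    case False
    have "U_flow n lam i pt c = 0 \<and> V_flow n lam i pt c = 0" if "i \<in> {1..n}" for i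
      using flow_frame_support[OF that False] .
    then have "wU c = 0" "wV c = 0"
      unfolding wU_def wV_def by simp_all
    then show ?thesis
      using supp[OF False] by (simp add: w'_def)
  qed
  then have "w c + (-1) * (wU c + wV c) = 0" for c
    unfolding w'_def .
  then have w_eq: "w c = wU c + wV c" for c
    by (metis eq_neg_iff_add_eq_0 minus_minus mult_minus1)
  have U_eq: "(\<Sum>i=1..n. (w (Cb i) / lam) *\<^sub>T U_flow n lam i pt) = wU"
    and V_eq: "(\<Sum>i=1..n. (\<alpha> i / lam) *\<^sub>T V_flow n lam i pt) = wV"
    by (simp_all add: fun_eq_iff wU_def wV_def sum_tvec_apply vscale_apply)
  show ?thesis
    unfolding U_eq V_eq by (rule ext) (simp only: w_eq plus_fun_apply)
qed

text \<open>\<open>T_fun n a j\<close> is \<open>2 j - 1\<close> times \<open>x^(n-j)\<close> plus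
  lower powers, so induction on the exponent shows that the weights \<open>g\<close> annihilate all
  powers below \<open>n\<close>. Pairing them with a Lagrange polynomial then isolates
  \<open>g i\<close>; this replaces the Vandermonde determinant.\<close>

lemma T_fun_combination_imp:
  assumes T: "\<And>j. j \<in> {1..n} \<Longrightarrow> (\<Sum>i=1..n. g i * T_fun n a j (q i)) = 0" and i: "i \<in> {1..n}"
  shows "g i = 0"
proof -
  have pow: "(\<Sum>i=1..n. g i * q i ^ m) = 0" if "m < n" for m
    using that
  proof (induction m rule: less_induct)
    case (less m)
    define j where "j = n - m"
    have j: "j \<in> {1..n}" "n - j = m" "n - j - 1 = m - 1"
      using less.prems by (auto simp: j_def)
    have "(\<Sum>i=1..n. g i * T_fun n a j (q i)) =
      (2 * of_nat j - 1) * (\<Sum>i=1..n. g i * q i ^ m)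
        + (\<Sum>k=1..m - 1. (2 * of_nat j + of_nat k) * a (n - k + 1) * (\<Sum>i=1..n. g i * q i ^ (m - 1 - k)))"
      unfolding T_fun_def j(2,3) distrib_left sum.distrib sum_distrib_left
      by (subst sum.swap[of _ "{1..n}"]) (simp add: mult_ac)
    also have "(\<Sum>k=1..m - 1. (2 * of_nat j + of_nat k) * a (n - k + 1) * (\<Sum>i=1..n. g i * q i ^ (m - 1 - k))) = 0"
    proof (intro sum.neutral ballI)
      fix k assume "k \<in> {1..m - 1}"
      then have "m - 1 - k < m"
        by auto
      then show "(2 * of_nat j + of_nat k) * a (n - k + 1) * (\<Sum>i=1..n. g i * q i ^ (m - 1 - k)) = 0"
        using less.IH less.prems by simp
    qed
    finally have "(2 * of_nat j - 1) * (\<Sum>i=1..n. g i * q i ^ m) = 0"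
      using T[OF j(1)] by simp
    \<comment> \<open>The leading coefficient is nonzero by parity.\<close>
    moreover have "(2 * of_nat j - 1 :: complex) \<noteq> 0"
    proof
      assume "(2 * of_nat j - 1 :: complex) = 0"
      then have "of_nat (2 * j) = (of_nat 1 :: complex)"
        by simp
      then have "2 * j = 1"
        by (simp only: of_nat_eq_iff)
      then show False
        by presburger
    qed
    ultimately show ?case
      by simp
  qed
  obtain s where s: "\<forall>k\<ge>n. coeff s k = 0" "lagr n q i = poly s"
    using polyfun_less_lagr[OF i] unfolding polyfun_less_def by auto
  have "g i = (\<Sum>k=1..n. g k * lagr n q i (q k))"
  proof -
    have "(\<Sum>k=1..n. g k * lagr n q i (q k)) = (\<Sum>k=1..n. if k = i then g k else 0)"
      using lagr_at[OF inj_q i] by (intro sum.cong) auto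
    then show ?thesis
      using i by simp
  qed
  also have "\<dots> = (\<Sum>k=1..n. g k * (\<Sum>m\<le>degree s. coeff s m * q k ^ m))"
    unfolding s(2) poly_altdef ..
  also have "\<dots> = (\<Sum>m\<le>degree s. coeff s m * (\<Sum>k=1..n. g k * q k ^ m))"
    unfolding sum_distrib_left by (subst sum.swap) (simp add: mult_ac)
  also have "\<dots> = 0"
    using pow s(1) by (intro sum.neutral) (metis mult_eq_0_iff not_le)
  finally show ?thesis .
qed

text \<open>The \<open>a\<close>-components see only the \<open>V_i\<close>, the
  \<open>b\<close>-components only the \<open>U_i\<close>.\<close>

lemma flow_frame_coefficients_0:
  assumes "(\<Sum>i=1..n. f i *\<^sub>T U_flow n lam i pt) + (\<Sum>i=1..n. g i *\<^sub>T V_flow n lam i pt) = 0" and i: "i \<in> {1..n}"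
  shows "f i = 0" "g i = 0"
proof -
  have comp: "(\<Sum>i=1..n. f i * U_flow n lam i pt c) + (\<Sum>i=1..n. g i * V_flow n lam i pt c) = 0" for c
    using fun_cong[OF assms(1), of c] by (simp add: sum_tvec_apply vscale_apply)
  show "g i = 0"
  proof (rule T_fun_combination_imp[OF _ i])
    fix j assume j: "j \<in> {1..n}"
    have "(\<Sum>i=1..n. g i * V_flow n lam i pt (Ca j)) = 0"
      using comp[of "Ca j"] by (simp add: U_flow_components)
    moreover have "(\<Sum>i=1..n. g i * V_flow n lam i pt (Ca j)) = lam * (\<Sum>i=1..n. g i * T_fun n a j (q i))"
      unfolding sum_distrib_left using j by (intro sum.cong) (auto simp: V_flow_components)
    ultimately show "(\<Sum>i=1..n. g i * T_fun n a j (q i)) = 0"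
      using lam_nz by simp
  qed
  have "(\<Sum>j=1..n. f j * U_flow n lam j pt (Cb i)) = 0"
    using comp[of "Cb i"] by (simp add: V_flow_components)
  moreover have "(\<Sum>j=1..n. f j * U_flow n lam j pt (Cb i)) = (\<Sum>j=1..n. if j = i then f j * lam else 0)"
    by (intro sum.cong) (auto simp: U_flow_components)
  ultimately show "f i = 0"
    using i lam_nz by simp
qed

end

section \<open>Curves with prescribed velocity\<close>

text \<open>A compactness argument instead of the discriminant: double roots for parameters tending
  to 0 stay bounded because the polynomial is monic, and a subsequence converges to a double root of
  the unperturbed polynomial.\<close>

lemma eventually_rsquarefree_Q0:
  assumes "rsquarefree (Q0 n a b)"
  shows "\<forall>\<^sub>F s in nhds (0::complex). rsquarefree (Q0 n (\<lambda>i. a i + s * a' i) (\<lambda>i. b i + s * b' i))"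
proof (rule ccontr)
  define P where "P = (\<lambda>s. Q0 n (\<lambda>i. a i + s * a' i) (\<lambda>i. b i + s * b' i))"
  assume "\<not> ?thesis"
  then have "\<exists>s. dist s 0 < d \<and> \<not> rsquarefree (P s)" if "d > 0" for d
    using that unfolding eventually_nhds_metric P_def by blast
  then have "\<exists>s x. norm s < d \<and> poly (P s) x = 0 \<and> poly (pderiv (P s)) x = 0" if "d > 0" for d
    using that unfolding rsquarefree_roots by (metis dist_0_norm dist_commute)
  then have "\<exists>s x. norm s < 1 / Suc k \<and> poly (P s) x = 0 \<and> poly (pderiv (P s)) x = 0" for k :: nat
    by simp
  then obtain s x where sx: "\<And>k. norm (s k) < 1 / Suc k" "\<And>k. poly (P (s k)) (x k) = 0"
      "\<And>k. poly (pderiv (P (s k))) (x k) = 0"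
    by metis
  \<comment> \<open>\<open>C\<close> bounds the sum of the norms of all non-leading coefficients for
    parameters of norm at most 1. A root of norm above 1 of the monic polynomial therefore has norm
    at most \<open>C\<close>.\<close>
  define C where "C = (\<Sum>i=1..n. norm (a i) + norm (a' i)) + (\<Sum>i=1..n. norm (b i) + norm (b' i))"
  have C0: "C \<ge> 0"
    unfolding C_def by (intro add_nonneg_nonneg sum_nonneg) auto
  have bound: "norm (x k) \<le> max 1 C" for k
  proof (cases "norm (x k) \<le> 1")
    case False
    let ?r = "norm (x k)"
    have s1: "norm (s k) \<le> 1"
      using sx(1)[of k] by (smt (verit) divide_le_eq_1 of_nat_0_less_iff of_nat_Suc of_nat_0_le_iff zero_less_Suc)
    have mono_bound: "norm ((c + s k * c') * x k ^ j) \<le> (norm c + norm c') * ?r ^ (2 * n)" if "j \<le> 2 * n" for c c' j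
    proof -
      have "norm (c + s k * c') \<le> norm c + norm c'"
        using norm_triangle_ineq[of c "s k * c'"] mult_right_mono[OF s1, of "norm c'"]
        by (simp add: norm_mult)
      moreover have "?r ^ j \<le> ?r ^ (2 * n)"
        using False that by (intro power_increasing) auto
      ultimately show ?thesis
        unfolding norm_mult norm_power by (intro mult_mono) auto
    qed
    have "x k ^ (2 * n + 1) = - ((\<Sum>i=1..n. (a i + s k * a' i) * x k ^ (n + i - 1)) + (\<Sum>i=1..n. (b i + s k * b' i) * x k ^ (i - 1)))"
      using sx(2)[of k] unfolding P_def poly_Q0 topP_def by (simp only: eq_neg_iff_add_eq_0 add.assoc)
    then have "?r ^ (2 * n + 1) \<le> norm (\<Sum>i=1..n. (a i + s k * a' i) * x k ^ (n + i - 1)) + norm (\<Sum>i=1..n. (b i + s k * b' i) * x k ^ (i - 1))"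
      unfolding norm_power[symmetric] by (simp only: norm_minus_cancel norm_triangle_ineq)
    also have "\<dots> \<le> (\<Sum>i=1..n. (norm (a i) + norm (a' i)) * ?r ^ (2 * n)) + (\<Sum>i=1..n. (norm (b i) + norm (b' i)) * ?r ^ (2 * n))"
      by (intro add_mono sum_norm_le mono_bound) auto
    also have "\<dots> = C * ?r ^ (2 * n)"
      by (simp add: C_def sum_distrib_right distrib_right)
    finally have "?r * ?r ^ (2 * n) \<le> C * ?r ^ (2 * n)"
      by simp
    moreover have "?r ^ (2 * n) > 0"
      using False by (intro zero_less_power) auto
    ultimately have "?r \<le> C"
      using mult_le_cancel_right_pos by blast
    then show ?thesis
      by simp
  qed simp
  obtain l r where lr: "strict_mono r" "(x \<circ> r) \<longlonglongrightarrow> l"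
    using bound compact_cball[of "0::complex" "max 1 C"] unfolding compact_def
    by (metis mem_cball_0)
  have "s \<longlonglongrightarrow> 0"
    using sx(1) by (intro LIMSEQ_norm_0)
  then have "(s \<circ> r) \<longlonglongrightarrow> 0"
    using LIMSEQ_subseq_LIMSEQ lr(1) by blast
  note lim = this[unfolded o_def] lr(2)[unfolded o_def]
  have "(\<lambda>k. poly (P (s (r k))) (x (r k))) \<longlonglongrightarrow> poly (P 0) l"
    unfolding P_def poly_Q0 topP_def using lim by (intro tendsto_intros) auto
  moreover have "(\<lambda>k. poly (pderiv (P (s (r k)))) (x (r k))) \<longlonglongrightarrow> poly (pderiv (P 0)) l"
    unfolding P_def poly_pderiv_Q0 dtopP_def using lim by (intro tendsto_intros) auto
  ultimately have "poly (P 0) l = 0" "poly (pderiv (P 0)) l = 0"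
    using sx(2,3) by (simp_all add: LIMSEQ_const_iff)
  moreover have "P 0 = Q0 n a b"
    by (simp add: P_def)
  ultimately show False
    using assms by (auto simp: rsquarefree_roots)
qed

context oscillator
begin

text \<open>\<open>isomonodromic\<close> constrains a field only along curves that have its
  velocity, so such a curve must exist before the condition says anything at a point. An affine path
  in the coordinates works because the defining conditions of the manifold are open.\<close>

lemma velocity_curve_exists:
  assumes supp: "\<And>c. c \<notin> coords n \<Longrightarrow> w c = 0"
  obtains \<gamma> where "\<gamma> 0 = pt" "has_velocity n \<gamma> 0 w"
proof -
  define as where "as = (\<lambda>s i. a i + s * w (Ca i))"
  define bs where "bs = (\<lambda>s i. b i + s * w (Cb i))"
  define qs where "qs = (\<lambda>s i. q i + s * w (Cq i))"
  define vs where "vs = (\<lambda>s i. v i + s * w (Cv i))"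
  define h where "h = (\<lambda>s i. poly (Q0 n (as s) (bs s)) (qs s i))"
  \<comment> \<open>The quotient under the root equals 1 at \<open>s = 0\<close>, away from the
    branch cut of \<open>csqrt\<close>; the factor \<open>p i\<close> selects the given
    sign.\<close>
  define ps where "ps = (\<lambda>s i. p i * csqrt (h s i / p i ^ 2))"
  define \<gamma> where "\<gamma> = (\<lambda>s. (as s, bs s, qs s, vs s, ps s))"
  have h0: "h 0 i = p i ^ 2" if "i \<in> {1..n}" for i
    using p_square[OF that] by (simp add: h_def poly_Q0 as_def bs_def qs_def)
  have h_cont: "isCont (\<lambda>s. h s i) s" for i s
    unfolding h_def poly_Q0 topP_def as_def bs_def qs_def by (intro continuous_intros)
  have outside: "a i = 0" "b i = 0" "q i = 0" "v i = 0" "p i = 0" if "i \<notin> {1..n}" for i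
    using pt_in_X that unfolding X_mfd_def M_set_def by blast+
  have w_outside: "w (Ca i) = 0" "w (Cb i) = 0" "w (Cq i) = 0" "w (Cv i) = 0" if "i \<notin> {1..n}" for i
    using that by (auto intro!: supp simp: coords_def)
  have ps0: "ps 0 = p"
  proof
    fix i show "ps 0 i = p i"
      using h0[of i] p_nz[of i] outside(5)[of i] by (cases "i \<in> {1..n}") (simp_all add: ps_def)
  qed
  have \<gamma>0: "\<gamma> 0 = pt"
    by (simp add: \<gamma>_def as_def bs_def qs_def vs_def ps0)
  have ps_cont: "isCont (\<lambda>s. ps s i) 0" for i
  proof (cases "i \<in> {1..n}")
    case True
    have "isCont (\<lambda>s. csqrt (h s i / p i ^ 2)) 0"
    proof (rule isCont_o2[where g = csqrt])
      show "isCont (\<lambda>s. h s i / p i ^ 2) 0"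
        using p_nz[OF True] by (intro continuous_intros h_cont) auto
      show "isCont csqrt (h 0 i / p i ^ 2)"
        using p_nz[OF True] h0[OF True] by (intro continuous_at_csqrt) (auto simp: complex_nonpos_Reals_iff)
    qed
    then show ?thesis
      unfolding ps_def by (intro continuous_intros)
  next
    case False
    then show ?thesis
      using outside by (simp add: ps_def)
  qed
  have ev_rsq: "\<forall>\<^sub>F s in nhds 0. rsquarefree (Q0 n (as s) (bs s))"
    unfolding as_def bs_def using pt_in_X
    by (intro eventually_rsquarefree_Q0) (auto simp: X_mfd_def M_set_def)
  have ev_ne: "\<forall>\<^sub>F s in nhds 0. f s \<noteq> 0" if "isCont f 0" "f 0 \<noteq> 0" for f :: "complex \<Rightarrow> complex"
    using that by (simp add: isCont_def tendsto_imp_eventually_ne eventually_nhds_conv_at)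
  have "\<forall>\<^sub>F s in nhds 0. qs s i - qs s j \<noteq> 0" if "i \<in> {1..n}" "j \<in> {1..n}" "i \<noteq> j" for i j
    unfolding qs_def using q_diff_nz[OF that] by (intro ev_ne continuous_intros) auto
  then have "\<forall>\<^sub>F s in nhds 0. \<forall>i\<in>{1..n}. \<forall>j\<in>{1..n}. i \<noteq> j \<longrightarrow> qs s i - qs s j \<noteq> 0"
    by (intro eventually_ball_finite ballI) (auto simp: eventually_mono)
  then have ev_inj: "\<forall>\<^sub>F s in nhds 0. inj_on (qs s) {1..n}"
    by eventually_elim (force simp: inj_on_def)
  have "\<forall>\<^sub>F s in nhds 0. h s i \<noteq> 0" if "i \<in> {1..n}" for i
    using h0[OF that] p_nz[OF that] by (intro ev_ne h_cont) simp
  then have ev_h: "\<forall>\<^sub>F s in nhds 0. \<forall>i\<in>{1..n}. h s i \<noteq> 0"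
    by (intro eventually_ball_finite ballI) auto
  have "\<forall>\<^sub>F s in nhds 0. \<gamma> s \<in> X_mfd n"
    using ev_rsq ev_inj ev_h
  proof eventually_elim
    case (elim s)
    have p_sq: "ps s i ^ 2 = h s i" if "i \<in> {1..n}" for i
      using p_nz[OF that] by (simp add: ps_def power_mult_distrib)
    then have "ps s i \<noteq> 0" if "i \<in> {1..n}" for i
      using elim(3) that by (metis power_zero_numeral)
    moreover have "(as s, bs s) \<in> M_set n"
      using elim(1) outside w_outside by (auto simp: M_set_def as_def bs_def simp del: atLeastAtMost_iff)
    moreover have "\<forall>i. i \<notin> {1..n} \<longrightarrow> qs s i = 0 \<and> vs s i = 0 \<and> ps s i = 0"
      using outside w_outside by (auto simp: qs_def vs_def ps_def simp del: atLeastAtMost_iff)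
    ultimately show ?case
      using elim(2) p_sq unfolding \<gamma>_def X_mfd_def h_def by auto
  qed
  moreover have "((\<lambda>s. coord_val c (\<gamma> s)) has_field_derivative w c) (at 0)" for c
    by (cases c; auto simp: \<gamma>_def as_def bs_def qs_def vs_def intro!: derivative_eq_intros)
  moreover have "isCont (\<lambda>s. root_val i (\<gamma> s)) 0" for i
    using ps_cont[of i] by (simp add: \<gamma>_def)
  ultimately have "has_velocity n \<gamma> 0 w"
    unfolding has_velocity_def by blast
  then show thesis
    using that \<gamma>0 by blast
qed

end

section \<open>Solutions of the isomonodromy equation\<close>

text \<open>Keeping a holomorphic factor and its value at \<open>z\<close> tracks the leading
  coefficient through differentiation without Laurent series. The factor may vanish at
  \<open>z\<close>, so the step can be iterated even when an exponent becomes 0.\<close>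

lemma deriv_powi_factor:
  fixes F g :: "complex \<Rightarrow> complex"
  assumes S: "open S" "z \<in> S" and g: "g holomorphic_on S" and F: "\<And>x. x \<in> S - {z} \<Longrightarrow> F x = g x * (x - z) powi m"
  obtains g1 where "g1 holomorphic_on S" "g1 z = of_int m * g z"
    "\<And>x. x \<in> S - {z} \<Longrightarrow> deriv F x = g1 x * (x - z) powi (m - 1)"
proof
  show "(\<lambda>x. of_int m * g x + (x - z) * deriv g x) holomorphic_on S"
    using S g by (intro holomorphic_intros)
  show "of_int m * g z + (z - z) * deriv g z = of_int m * g z"
    by simp
  fix x assume x: "x \<in> S - {z}"
  then have nz: "x - z \<noteq> 0"
    by simp
  have "(g has_field_derivative deriv g x) (at x)"
    using holomorphic_derivI[OF g S(1)] x by blast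
  moreover have "((\<lambda>x. (x - z) powi m) has_field_derivative of_int m * (x - z) powi (m - 1)) (at x)"
    using nz by (auto intro!: derivative_eq_intros)
  ultimately have "((\<lambda>x. g x * (x - z) powi m) has_field_derivative
      deriv g x * (x - z) powi m + of_int m * (x - z) powi (m - 1) * g x) (at x)"
    by (rule DERIV_mult)
  moreover have "\<forall>\<^sub>F y in nhds x. F y = g y * (y - z) powi m"
    by (rule eventually_mono[OF eventually_nhds_in_open[of "S - {z}" x]]) (use S x F in auto)
  ultimately have "(F has_field_derivative
      deriv g x * (x - z) powi m + of_int m * (x - z) powi (m - 1) * g x) (at x)"
    by (subst DERIV_cong_ev[OF refl _ refl])
  then have "deriv F x = deriv g x * (x - z) powi m + of_int m * (x - z) powi (m - 1) * g x"
    by (rule DERIV_imp_deriv)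
  also have "(x - z) powi m = (x - z) * (x - z) powi (m - 1)"
    using power_int_add[of "x - z" 1 "m - 1"] nz by simp
  finally show "deriv F x = (of_int m * g x + (x - z) * deriv g x) * (x - z) powi (m - 1)"
    by (simp add: algebra_simps)
qed

lemma third_deriv_powi_factor:
  fixes F g :: "complex \<Rightarrow> complex"
  assumes S: "open S" "z \<in> S" and g: "g holomorphic_on S" and F: "\<And>x. x \<in> S - {z} \<Longrightarrow> F x = g x * (x - z) powi m"
  obtains g1 g3 where "g1 holomorphic_on S" "g1 z = of_int m * g z"
    "\<And>x. x \<in> S - {z} \<Longrightarrow> deriv F x = g1 x * (x - z) powi (m - 1)"
    "g3 holomorphic_on S" "g3 z = of_int (m * (m - 1) * (m - 2)) * g z"
    "\<And>x. x \<in> S - {z} \<Longrightarrow> (deriv ^^ 3) F x = g3 x * (x - z) powi (m - 3)"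
proof -
  obtain g1 where g1: "g1 holomorphic_on S" "g1 z = of_int m * g z"
    "\<And>x. x \<in> S - {z} \<Longrightarrow> deriv F x = g1 x * (x - z) powi (m - 1)"
    using deriv_powi_factor[OF S g F] by blast
  obtain g2 where g2: "g2 holomorphic_on S" "g2 z = of_int (m - 1) * g1 z"
    "\<And>x. x \<in> S - {z} \<Longrightarrow> deriv (deriv F) x = g2 x * (x - z) powi (m - 1 - 1)"
    using deriv_powi_factor[OF S g1(1,3)] by blast
  obtain g3 where g3: "g3 holomorphic_on S" "g3 z = of_int (m - 1 - 1) * g2 z"
    "\<And>x. x \<in> S - {z} \<Longrightarrow> deriv (deriv (deriv F)) x = g3 x * (x - z) powi (m - 1 - 1 - 1)"
    using deriv_powi_factor[OF S g2(1,3)] by blast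
  show thesis
  proof
    show "g3 z = of_int (m * (m - 1) * (m - 2)) * g z"
      unfolding g3(2) g2(2) g1(2) by simp
    show "(deriv ^^ 3) F x = g3 x * (x - z) powi (m - 3)" if "x \<in> S - {z}" for x
      using g3(3)[OF that] by (simp add: numeral_3_eq_3)
  qed fact+
qed

lemma meromorphic_factor:
  assumes "f meromorphic_on {z}" "\<not> (\<forall>\<^sub>F x in at z. f x = 0)"
  obtains g m S where "open S" "z \<in> S" "g holomorphic_on S" "g z \<noteq> (0::complex)"
    "\<And>x. x \<in> S - {z} \<Longrightarrow> f x = g x * (x - z) powi m"
proof -
  have "\<exists>\<^sub>F x in at z. f x \<noteq> 0"
    using assms(2) by (simp add: frequently_def)
  then have "zor_poly f z z \<noteq> 0 \<and> (\<exists>r>0. zor_poly f z holomorphic_on cball z r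
    \<and> (\<forall>w\<in>cball z r - {z}. f w = zor_poly f z w * (w - z) powi zorder f z \<and> zor_poly f z w \<noteq> 0))"
    using assms(1) by (intro zorder_exist) (auto simp: meromorphic_at_iff)
  then obtain r where r: "zor_poly f z z \<noteq> 0" "r > 0" "zor_poly f z holomorphic_on cball z r"
    "\<forall>w\<in>cball z r - {z}. f w = zor_poly f z w * (w - z) powi zorder f z"
    by blast
  show thesis
  proof (rule that[of "ball z r" "zor_poly f z" "zorder f z"])
    show "zor_poly f z holomorphic_on ball z r"
      using r(3) ball_subset_cball holomorphic_on_subset by blast
  qed (use r in auto)
qed

lemma tendsto_powi_pos:
  fixes z :: complex
  assumes "m > 0"
  shows "((\<lambda>x. (x - z) powi m) \<longlongrightarrow> 0) (at z)"
proof -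
  have "((\<lambda>x. (x - z) ^ nat m) \<longlongrightarrow> (z - z) ^ nat m) (at z)"
    by (intro tendsto_intros)
  then show ?thesis
    using assms by (simp add: power_int_def zero_power)
qed

text \<open>The indicial equation of \<open>D = Q' A + 2 Q A' - A''' / 2\<close> at a point where \<open>Q\<close> has a pole of order at most 2.\<close>
lemma indicial_equation:
  fixes A D Q Q' g :: "complex \<Rightarrow> complex"
  assumes S: "open S" "z \<in> S" and g: "g holomorphic_on S" "g z \<noteq> 0"
    and A: "\<And>x. x \<in> S - {z} \<Longrightarrow> A x = g x * (x - z) powi m" and m: "m < 0"
    and Q: "((\<lambda>x. Q x * (x - z) ^ 2) \<longlongrightarrow> \<kappa>) (at z)"
    and Q': "((\<lambda>x. Q' x * (x - z) ^ 3) \<longlongrightarrow> - 2 * \<kappa>) (at z)"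
    and D: "((\<lambda>x. D x * (x - z) ^ 3) \<longlongrightarrow> \<rho>) (at z)"
    and eq: "\<forall>\<^sub>F x in at z. D x = Q' x * A x + 2 * Q x * deriv A x - (deriv ^^ 3) A x / 2"
  shows "4 * \<kappa> * (of_int m - 1) = of_int (m * (m - 1) * (m - 2))"
proof -
  obtain g1 g3 where g1: "g1 holomorphic_on S" "g1 z = of_int m * g z"
    "\<And>x. x \<in> S - {z} \<Longrightarrow> deriv A x = g1 x * (x - z) powi (m - 1)"
    and g3: "g3 holomorphic_on S" "g3 z = of_int (m * (m - 1) * (m - 2)) * g z"
    "\<And>x. x \<in> S - {z} \<Longrightarrow> (deriv ^^ 3) A x = g3 x * (x - z) powi (m - 3)"
    using third_deriv_powi_factor[OF S g(1) A] by blast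
  have cont: "(f \<longlongrightarrow> f z) (at z)" if "f holomorphic_on S" for f
    using that S by (meson continuous_on_eq_continuous_at holomorphic_on_imp_continuous_on isCont_def)
  \<comment> \<open>The equation is multiplied by \<open>(x - z)^(3-m)\<close>. Since
    \<open>m < 0\<close>, this kills the contribution of \<open>D\<close>, whose pole has order at
    most 3.\<close>
  have "((\<lambda>x. Q' x * (x - z) ^ 3 * g x + 2 * (Q x * (x - z) ^ 2) * g1 x - g3 x / 2 - D x * (x - z) ^ 3 * (x - z) powi (- m))
     \<longlongrightarrow> - 2 * \<kappa> * g z + 2 * \<kappa> * g1 z - g3 z / 2 - \<rho> * 0) (at z)"
    using m by (intro tendsto_intros Q Q' D cont g g1 g3 tendsto_powi_pos) auto
  moreover have "\<forall>\<^sub>F x in at z. Q' x * (x - z) ^ 3 * g x + 2 * (Q x * (x - z) ^ 2) * g1 x - g3 x / 2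
      - D x * (x - z) ^ 3 * (x - z) powi (- m) = 0"
    using eq eventually_at_in_open[OF S]
  proof eventually_elim
    case (elim x)
    define y where "y = x - z"
    have y: "y \<noteq> 0"
      using elim by (simp add: y_def)
    have pw: "y powi m * y powi (- m) = 1"
      using y by (simp add: power_int_minus)
    have "y powi (m - 1) * y = y powi m" "y powi (m - 3) * y ^ 3 = y powi m"
      using power_int_add[of y "m - 1" 1] power_int_add[of y "m - 3" 3] y by simp_all
    note pws = this
    have "D x * y ^ 3 * y powi (- m) = (Q' x * (g x * y powi m) + 2 * Q x * (g1 x * y powi (m - 1)) - g3 x * y powi (m - 3) / 2) * y ^ 3 * y powi (- m)"
      using elim A g1(3) g3(3) by (simp add: y_def)
    also have "\<dots> = Q' x * y ^ 3 * g x * (y powi m * y powi (- m)) + 2 * (Q x * y ^ 2) * g1 x * ((y powi (m - 1) * y) * y powi (- m))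
        - g3 x / 2 * ((y powi (m - 3) * y ^ 3) * y powi (- m))"
      by (simp add: algebra_simps power2_eq_square power3_eq_cube)
    also have "\<dots> = Q' x * y ^ 3 * g x + 2 * (Q x * y ^ 2) * g1 x - g3 x / 2"
      unfolding pws pw by simp
    finally show ?case
      by (simp add: y_def)
  qed
  ultimately have "- 2 * \<kappa> * g z + 2 * \<kappa> * g1 z - g3 z / 2 - \<rho> * 0 = 0"
    using tendsto_unique[OF at_neq_bot _ tendsto_eventually] by blast
  moreover have "g z * (4 * \<kappa> * (of_int m - 1) - of_int (m * (m - 1) * (m - 2)))
      = 2 * (- 2 * \<kappa> * g z + 2 * \<kappa> * g1 z - g3 z / 2 - \<rho> * 0)"
  proof -
    have "G * (4 * \<kappa> * (i - 1) - M) = 2 * (- 2 * \<kappa> * G + 2 * \<kappa> * (i * G) - M * G / 2 - \<rho> * 0)" for G i M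
      by (simp add: algebra_simps)
    then show ?thesis
      unfolding g1(2) g3(2) .
  qed
  ultimately have "g z * (4 * \<kappa> * (of_int m - 1) - of_int (m * (m - 1) * (m - 2))) = 0"
    by simp
  then show ?thesis
    using g(2) by simp
qed

text \<open>The analogous computation at infinity, in the coordinate \<open>z = 1 / x\<close>, for \<open>Q \<sim> \<mu> x\<^sup>N\<close>.\<close>
lemma indicial_equation_infinity:
  fixes A D Q Q' g :: "complex \<Rightarrow> complex"
  assumes S: "open S" "0 \<in> S" and g: "g holomorphic_on S" "g 0 \<noteq> 0"
    and A: "\<And>z. z \<in> S - {0} \<Longrightarrow> A (inverse z) = g z * z powi m" and m: "m \<le> 0" and N: "N > 0"
    and ana: "\<And>z. z \<in> S - {0} \<Longrightarrow> A analytic_on {inverse z}"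
    and Q: "((\<lambda>z. Q (inverse z) * z ^ N) \<longlongrightarrow> \<mu>) (at 0)"
    and Q': "((\<lambda>z. Q' (inverse z) * z ^ (N - 1)) \<longlongrightarrow> of_nat N * \<mu>) (at 0)"
    and D: "((\<lambda>z. D (inverse z) * z ^ (N - 1)) \<longlongrightarrow> 0) (at 0)"
    and eq: "\<forall>\<^sub>F z in at 0. D (inverse z) = Q' (inverse z) * A (inverse z) + 2 * Q (inverse z) * deriv A (inverse z)
                - (deriv ^^ 3) A (inverse z) / 2"
    and \<mu>: "\<mu> \<noteq> 0"
  shows "int N = 2 * m"
proof -
  \<comment> \<open>In the coordinate \<open>z = 1 / x\<close> one has
    \<open>d/dx = - z^2 d/dz\<close>, so each derivative raises the exponent by one and multiplies
    the leading coefficient by \<open>- k\<close>.\<close>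
  have step: "\<exists>h1. h1 holomorphic_on S \<and> h1 0 = - of_int k * h 0 \<and>
      (\<forall>z\<in>S - {0}. deriv B (inverse z) = h1 z * z powi (k + 1))"
    if h: "h holomorphic_on S" and B: "\<And>z. z \<in> S - {0} \<Longrightarrow> B (inverse z) = h z * z powi k"
      and ana: "\<And>z. z \<in> S - {0} \<Longrightarrow> B analytic_on {inverse z}" for B h :: "complex \<Rightarrow> complex" and k
  proof -
    have "B (inverse z) = h z * (z - 0) powi k" if "z \<in> S - {0}" for z
      using B[OF that] by simp
    from deriv_powi_factor[of S 0 h "\<lambda>z. B (inverse z)", OF S h this]
    obtain h1 where h1: "h1 holomorphic_on S" "h1 0 = of_int k * h 0"
      "\<And>z. z \<in> S - {0} \<Longrightarrow> deriv (\<lambda>z. B (inverse z)) z = h1 z * (z - 0) powi (k - 1)"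
      by blast
    have "deriv B (inverse z) = - h1 z * z powi (k + 1)" if z: "z \<in> S - {0}" for z
    proof -
      have "(B has_field_derivative deriv B (inverse z)) (at (inverse z))"
        using ana[OF z] analytic_on_imp_differentiable_at DERIV_deriv_iff_field_differentiable by blast
      moreover have "(inverse has_field_derivative - inverse (z ^ 2)) (at z)"
        using z DERIV_inverse[of z UNIV] by (simp add: numeral_2_eq_2)
      ultimately have "((\<lambda>z. B (inverse z)) has_field_derivative deriv B (inverse z) * - inverse (z ^ 2)) (at z)"
        by (rule DERIV_chain2)
      then have "deriv B (inverse z) * - inverse (z ^ 2) = h1 z * z powi (k - 1)"
        using h1(3)[OF z] DERIV_imp_deriv by fastforce
      moreover have "deriv B (inverse z) = - (deriv B (inverse z) * - inverse (z ^ 2)) * z ^ 2"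
        using z by simp
      ultimately have "deriv B (inverse z) = - h1 z * (z powi (k - 1) * z ^ 2)"
        by simp
      also have "z powi (k - 1) * z ^ 2 = z powi (k + 1)"
        using power_int_add[of z "k - 1" 2] z by (simp add: add.commute)
      finally show ?thesis .
    qed
    then show ?thesis
      using h1 by (intro exI[of _ "\<lambda>z. - h1 z"]) (auto intro!: holomorphic_intros)
  qed
  have ana_deriv: "deriv B analytic_on {inverse z}" if "B analytic_on {inverse z}" for B z
    using that analytic_deriv by blast
  obtain g1 where g1: "g1 holomorphic_on S" "g1 0 = - of_int m * g 0"
    "\<And>z. z \<in> S - {0} \<Longrightarrow> deriv A (inverse z) = g1 z * z powi (m + 1)"
    using step[OF g(1) A ana] by blast
  obtain g2 where g2: "g2 holomorphic_on S"
    "\<And>z. z \<in> S - {0} \<Longrightarrow> deriv (deriv A) (inverse z) = g2 z * z powi (m + 1 + 1)"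
    using step[OF g1(1,3) ana_deriv[OF ana]] by blast
  obtain g3 where g3: "g3 holomorphic_on S"
    "\<And>z. z \<in> S - {0} \<Longrightarrow> deriv (deriv (deriv A)) (inverse z) = g3 z * z powi (m + 1 + 1 + 1)"
    using step[OF g2(1,2) ana_deriv[OF ana_deriv[OF ana]]] by blast
  have cont: "(f \<longlongrightarrow> f 0) (at 0)" if "f holomorphic_on S" for f
    using that S by (meson continuous_on_eq_continuous_at holomorphic_on_imp_continuous_on isCont_def)
  \<comment> \<open>A finite limit is enough, be it 1 or 0, because it multiplies a term of
    \<open>D\<close> that tends to 0.\<close>
  obtain l where l: "((\<lambda>z::complex. z powi (- m)) \<longlongrightarrow> l) (at 0)"
  proof (cases "m = 0")
    case True
    then show ?thesis
      using that[of 1] by simp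
  next
    case False
    then show ?thesis
      using that[of 0] m tendsto_powi_pos[of "- m" 0] by simp
  qed
  \<comment> \<open>The equation is multiplied by \<open>z^(N-1-m)\<close>. The third derivative
    gains \<open>z^(N+2)\<close> and disappears, leaving the balance \<open>N - 2 m\<close> of the
    two potential terms.\<close>
  have "((\<lambda>z. Q' (inverse z) * z ^ (N - 1) * g z + 2 * (Q (inverse z) * z ^ N) * g1 z
       - g3 z * z ^ (N + 2) / 2 - D (inverse z) * z ^ (N - 1) * z powi (- m))
     \<longlongrightarrow> of_nat N * \<mu> * g 0 + 2 * \<mu> * g1 0 - g3 0 * 0 ^ (N + 2) / 2 - 0 * l) (at 0)"
    by (intro tendsto_intros Q Q' D cont g g1 g3 l) auto
  moreover have "\<forall>\<^sub>F z in at 0. Q' (inverse z) * z ^ (N - 1) * g z + 2 * (Q (inverse z) * z ^ N) * g1 z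
       - g3 z * z ^ (N + 2) / 2 - D (inverse z) * z ^ (N - 1) * z powi (- m) = 0"
    using eq eventually_at_in_open[OF S]
  proof eventually_elim
    case (elim z)
    have z: "z \<noteq> 0"
      using elim by simp
    obtain N' where N': "N = Suc N'"
      using N by (cases N) auto
    have pw: "z powi m * z powi (- m) = 1"
      using z by (simp add: power_int_minus)
    have pws: "z powi (m + 1) = z powi m * z" "z powi (m + 1 + 1 + 1) = z powi m * z ^ 3"
      using power_int_add[of z m 1] power_int_add[of z m 3] z by (simp_all add: add.assoc)
    have A3: "(deriv ^^ 3) A (inverse z) = g3 z * z powi (m + 1 + 1 + 1)"
      using g3(2)[OF elim(2)] by (simp add: numeral_3_eq_3)
    have "D (inverse z) * z ^ N' * z powi (- m) = (Q' (inverse z) * (g z * z powi m) + 2 * Q (inverse z) * (g1 z * (z powi m * z))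
        - g3 z * (z powi m * z ^ 3) / 2) * z ^ N' * z powi (- m)"
      unfolding elim(1) A[OF elim(2)] g1(3)[OF elim(2)] A3 pws ..
    also have "\<dots> = (Q' (inverse z) * z ^ N' * g z + 2 * (Q (inverse z) * (z * z ^ N')) * g1 z - g3 z * (z ^ 3 * z ^ N') / 2)
        * (z powi m * z powi (- m))"
      by (simp add: algebra_simps)
    also have "\<dots> = Q' (inverse z) * z ^ (N - 1) * g z + 2 * (Q (inverse z) * z ^ N) * g1 z - g3 z * z ^ (N + 2) / 2"
      unfolding pw N' by (simp add: power3_eq_cube mult_ac)
    finally show ?case
      by (simp add: N')
  qed
  ultimately have "of_nat N * \<mu> * g 0 + 2 * \<mu> * g1 0 - g3 0 * 0 ^ (N + 2) / 2 - 0 * l = 0"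
    using tendsto_unique[OF at_neq_bot _ tendsto_eventually] by blast
  then have "\<mu> * g 0 * (of_nat N - 2 * of_int m) = 0"
    unfolding g1(2) by (simp add: algebra_simps)
  then have "of_int (int N - 2 * m) = (0 :: complex)"
    using \<mu> g(2) by simp
  then show ?thesis
    by (simp only: of_int_eq_0_iff)
qed

section \<open>Limits at infinity and local behaviour of solutions\<close>

lemma bigo_power_tendsto_0:
  assumes "f \<in> O[at_infinity](\<lambda>x::complex. x ^ k)"
  shows "((\<lambda>x. f x / x ^ Suc k) \<longlongrightarrow> 0) at_infinity"
proof -
  have "((\<lambda>x::complex. 1 / x) \<longlongrightarrow> 0) at_infinity"
    by (auto intro!: tendsto_divide_0[OF tendsto_const] filterlim_ident)
  then have "(\<lambda>x::complex. 1 / x) \<in> o[at_infinity](\<lambda>_. 1)"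
    by (intro smalloI_tendsto) auto
  with assms have "(\<lambda>x. f x * (1 / x)) \<in> o[at_infinity](\<lambda>x. x ^ k * 1)"
    by (rule landau_o.big_small_mult)
  then have "((\<lambda>x. f x * (1 / x) / (x ^ k * 1)) \<longlongrightarrow> 0) at_infinity"
    by (rule smalloD_tendsto)
  then show ?thesis
    by (simp add: mult.commute)
qed

lemma tendsto_inverse_at_0:
  assumes "((\<lambda>x::complex. f x / x ^ k) \<longlongrightarrow> l) at_infinity"
  shows "((\<lambda>z. f (inverse z) * z ^ k) \<longlongrightarrow> l) (at 0)"
  using filterlim_compose[OF assms filterlim_inverse_at_infinity]
  by (simp add: power_inverse field_simps)

context oscillator
begin

lemma Qf_at_infinity: "((\<lambda>z. Qf (inverse z) * z ^ (2 * n + 1)) \<longlongrightarrow> 1 / lam ^ 2) (at 0)"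
  and dQf_at_infinity: "((\<lambda>z. dQf (inverse z) * z ^ (2 * n + 1 - 1)) \<longlongrightarrow> of_nat (2 * n + 1) * (1 / lam ^ 2)) (at 0)"
  and Qdot_at_infinity: "((\<lambda>z. Qdot w (inverse z) * z ^ (2 * n + 1 - 1)) \<longlongrightarrow> 0) (at 0)"
proof -
  let ?O = "O[at_infinity](\<lambda>x::complex. x ^ (2 * n - 1))"
  have pole1: "(\<lambda>x. e / (x - z)) \<in> ?O" for e z :: complex
    using pole_bigo[of e z 1] by simp
  have pole2: "(\<lambda>x. e / (c * (x - z) ^ m)) \<in> ?O" for e z c :: complex and m
    using pole_bigo[of "e / c" z m] by simp
  have poly: "f \<in> ?O" if "polyfun_less n f" for f
  proof -
    have "f \<in> O[at_infinity](\<lambda>x. x ^ (n - 1))"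
      using polyfun_less_bigo[of "n - 1" f] that n_pos by simp
    then show ?thesis
      by (rule landau_o.big_trans[OF _ power_bigo_power_at_infinity]) simp
  qed
  have mono: "(\<lambda>x. c * x ^ k) \<in> ?O" if "k \<le> 2 * n - 1" for c :: complex and k
    using that by (intro cmult_bigo power_bigo_power_at_infinity)
  have div: "(\<lambda>x. f x / c) \<in> ?O" if "f \<in> ?O" for f :: "complex \<Rightarrow> complex" and c
    using cmult_bigo[OF that, of "1 / c"] by simp
  have "(\<lambda>x. (\<Sum>j=1..n. a j * x ^ (n + j - 1)) / lam ^ 2
     + (\<Sum>i=1..n. 3 / (4 * (x - q i) ^ 2) + u i / (x - q i)) + G x) \<in> ?O"
    by (intro sum_in_bigo big_sum_in_bigo div mono pole1 pole2 poly polyfun_less_lowP) auto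
  then have "(\<lambda>x. Qf x - 1 / lam ^ 2 * x ^ (2 * n + 1)) \<in> ?O"
    by (simp add: Qf_eq[abs_def] topP_def add_divide_distrib add.assoc)
  then have "(\<lambda>x. Qf x - 1 / lam ^ 2 * x ^ (2 * n + 1)) \<in> O[at_infinity](\<lambda>x. x ^ (2 * n))"
    by (rule landau_o.big_trans[OF _ power_bigo_power_at_infinity]) simp
  from bigo_power_tendsto_0[OF this]
  have "((\<lambda>x. (Qf x - 1 / lam ^ 2 * x ^ (2 * n + 1)) / x ^ (2 * n + 1) + 1 / lam ^ 2) \<longlongrightarrow> 0 + 1 / lam ^ 2) at_infinity"
    by (intro tendsto_add tendsto_const) (simp only: Suc_eq_plus1)
  moreover have "\<forall>\<^sub>F x in at_infinity. (Qf x - 1 / lam ^ 2 * x ^ (2 * n + 1)) / x ^ (2 * n + 1) + 1 / lam ^ 2 = Qf x / x ^ (2 * n + 1)"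
    using eventually_not_equal_at_infinity[of 0] by eventually_elim (simp add: diff_divide_distrib)
  ultimately have "((\<lambda>x. Qf x / x ^ (2 * n + 1)) \<longlongrightarrow> 1 / lam ^ 2) at_infinity"
    using tendsto_cong by fastforce
  then show "((\<lambda>z. Qf (inverse z) * z ^ (2 * n + 1)) \<longlongrightarrow> 1 / lam ^ 2) (at 0)"
    by (rule tendsto_inverse_at_0)
  have "(\<lambda>x. (\<Sum>j=1..n. (a j * of_nat (n + j - 1)) * x ^ (n + j - 2)) / lam ^ 2
     - (\<Sum>k=1..n. 3 / (2 * (x - q k) ^ 3) + u k / (x - q k) ^ 2) + deriv G x) \<in> ?O"
    by (intro sum_in_bigo big_sum_in_bigo div mono pole_bigo pole2 poly polyfun_less_lowP polyfun_less_deriv) auto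
  then have "(\<lambda>x. dQf x - of_nat (2 * n + 1) * (1 / lam ^ 2) * x ^ (2 * n)) \<in> ?O"
    by (simp add: dQf_def[abs_def] dtopP_def add_divide_distrib mult.assoc algebra_simps)
  from bigo_power_tendsto_0[OF this]
  have "((\<lambda>x. (dQf x - of_nat (2 * n + 1) * (1 / lam ^ 2) * x ^ (2 * n)) / x ^ (2 * n) + of_nat (2 * n + 1) * (1 / lam ^ 2)) \<longlongrightarrow> 0 + of_nat (2 * n + 1) * (1 / lam ^ 2)) at_infinity"
    using n_pos by (intro tendsto_add tendsto_const) simp
  moreover have "\<forall>\<^sub>F x in at_infinity. (dQf x - of_nat (2 * n + 1) * (1 / lam ^ 2) * x ^ (2 * n)) / x ^ (2 * n) + of_nat (2 * n + 1) * (1 / lam ^ 2) = dQf x / x ^ (2 * n)"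
    using eventually_not_equal_at_infinity[of 0] by eventually_elim (simp add: diff_divide_distrib)
  ultimately have "((\<lambda>x. dQf x / x ^ (2 * n)) \<longlongrightarrow> of_nat (2 * n + 1) * (1 / lam ^ 2)) at_infinity"
    using tendsto_cong by fastforce
  then show "((\<lambda>z. dQf (inverse z) * z ^ (2 * n + 1 - 1)) \<longlongrightarrow> of_nat (2 * n + 1) * (1 / lam ^ 2)) (at 0)"
    using tendsto_inverse_at_0 by simp
  have "Qdot w \<in> ?O"
    unfolding Qdot_def[abs_def] da_def dpol_def
    by (intro sum_in_bigo big_sum_in_bigo div mono pole1 pole_bigo pole2 poly polyfun_less_sum_lagr) auto
  from bigo_power_tendsto_0[OF this] have "((\<lambda>x. Qdot w x / x ^ (2 * n)) \<longlongrightarrow> 0) at_infinity"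
    using n_pos by simp
  then show "((\<lambda>z. Qdot w (inverse z) * z ^ (2 * n + 1 - 1)) \<longlongrightarrow> 0) (at 0)"
    using tendsto_inverse_at_0 by simp
qed

text \<open>The scalar equation for \<open>A\<close>, divided by -2. The closed form
  \<open>dQf\<close> stands for the derivative of the potential, with which it agrees away from the
  nodes.\<close>

definition isomon_eq :: "tvec \<Rightarrow> (complex \<Rightarrow> complex) \<Rightarrow> complex \<Rightarrow> bool" where
  "isomon_eq w A x \<longleftrightarrow> Qdot w x = dQf x * A x + 2 * Qf x * deriv A x - (deriv ^^ 3) A x / 2"

lemma nodes_ev: "\<forall>\<^sub>F x in at z. x \<notin> q ` {1..n}"
proof -
  have "z \<notin> q ` ({1..n} - {i. q i = z})"
    by auto
  then have "\<forall>\<^sub>F x in at z. x \<notin> q ` ({1..n} - {i. q i = z}) \<and> x \<noteq> z"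
    by (intro eventually_conj eventually_avoiding_nodes eventually_neq_at_within)
  then show ?thesis
    by eventually_elim auto
qed

text \<open>With \<open>kappa = 0\<close> the indicial polynomial \<open>m (m - 1) (m - 2)\<close>
  has no negative root. The conclusion is a limit because the value of a meromorphic function at a
  single point is arbitrary.\<close>

lemma solution_at_regular_point:
  assumes mero: "A meromorphic_on {z}" and eq: "\<forall>\<^sub>F x in at z. isomon_eq w A x" and z: "z \<notin> q ` {1..n}"
  shows "\<exists>c. (A \<longlongrightarrow> c) (at z)"
proof (cases "\<forall>\<^sub>F x in at z. A x = 0")
  case True
  then show ?thesis
    using tendsto_eventually by blast
next
  case False
  obtain g m S where S: "open S" "z \<in> S" and g: "g holomorphic_on S" "g z \<noteq> 0"
    and A: "\<And>x. x \<in> S - {z} \<Longrightarrow> A x = g x * (x - z) powi m"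
    by (rule meromorphic_factor[OF mero False]) (rule that)
  have cont: "(f \<longlongrightarrow> f z) (at z)" if "f holomorphic_on T" "open T" "z \<in> T" for f T
    using that by (meson continuous_on_eq_continuous_at holomorphic_on_imp_continuous_on isCont_def)
  have lim: "((\<lambda>x. f x * (x - z) ^ k) \<longlongrightarrow> f z * (z - z) ^ k) (at z)" if "f holomorphic_on - q ` {1..n}" for f k
    using that z nodes_open by (intro tendsto_intros cont[of f "- q ` {1..n}"]) auto
  have "m \<ge> 0"
  proof (rule ccontr)
    assume "\<not> m \<ge> 0"
    then have m: "m < 0"
      by simp
    have "4 * 0 * (of_int m - 1) = (of_int (m * (m - 1) * (m - 2)) :: complex)"
    proof (rule indicial_equation[OF S g A m])
      show "((\<lambda>x. Qf x * (x - z)\<^sup>2) \<longlongrightarrow> 0) (at z)"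
        using lim[OF Qf_holomorphic, of 2] by simp
      show "((\<lambda>x. dQf x * (x - z) ^ 3) \<longlongrightarrow> - 2 * 0) (at z)"
        using lim[OF dQf_holomorphic, of 3] by simp
      show "((\<lambda>x. Qdot w x * (x - z) ^ 3) \<longlongrightarrow> Qdot w z * (z - z) ^ 3) (at z)"
        by (rule lim[OF Qdot_holomorphic])
    qed (use eq in \<open>simp_all add: isomon_eq_def\<close>)
    then have "m * (m - 1) * (m - 2) = 0"
      by (metis mult_zero_left mult_zero_right of_int_eq_0_iff)
    then show False
      using m by simp
  qed
  have "((\<lambda>x. g x * (x - z) ^ nat m) \<longlongrightarrow> g z * (z - z) ^ nat m) (at z)"
    by (intro tendsto_intros cont[OF g(1) S])
  moreover have "\<forall>\<^sub>F x in at z. g x * (x - z) ^ nat m = A x"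
    using eventually_at_in_open[OF S] by eventually_elim (use \<open>m \<ge> 0\<close> A in \<open>simp add: power_int_def\<close>)
  ultimately show ?thesis
    using Lim_transform_eventually by blast
qed

text \<open>With \<open>kappa = 3/4\<close> the only negative exponent is -1. A first-order pole is
  thus all that has to be subtracted.\<close>

lemma solution_at_node:
  assumes mero: "A meromorphic_on {q i}" and eq: "\<forall>\<^sub>F x in at (q i). isomon_eq w A x" and i: "i \<in> {1..n}"
  shows "\<exists>\<alpha> c. ((\<lambda>x. A x - \<alpha> / (x - q i)) \<longlongrightarrow> c) (at (q i))"
proof (cases "\<forall>\<^sub>F x in at (q i). A x = 0")
  case True
  then show ?thesis
    using tendsto_eventually by (intro exI[of _ 0]) auto
next
  case False
  define z where "z = q i"
  obtain g m S where S: "open S" "z \<in> S" and g: "g holomorphic_on S" "g z \<noteq> 0"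
    and A: "\<And>x. x \<in> S - {z} \<Longrightarrow> A x = g x * (x - z) powi m"
    by (rule meromorphic_factor[OF mero False, folded z_def]) (rule that)
  have cont: "(f \<longlongrightarrow> f z) (at z)" if "f holomorphic_on S" for f
    using that S by (meson continuous_on_eq_continuous_at holomorphic_on_imp_continuous_on isCont_def)
  have K: "(K i \<longlongrightarrow> u i ^ 2) (at z)"
    using K_has_field_derivative[OF node_notin[OF i], THEN DERIV_isCont] K_at[OF i] by (simp add: isCont_def z_def)
  have K': "(dK i \<longlongrightarrow> c1 i) (at z)"
    using dK_isCont[OF i] by (simp add: isCont_def dK_at z_def)
  have L: "(Ldot w i \<longlongrightarrow> Ldot w i (q i)) (at z)"
    using Ldot_isCont[OF node_notin[OF i]] by (simp add: isCont_def z_def)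
  have ne: "\<forall>\<^sub>F x in at z. x - z \<noteq> 0"
    using eventually_neq_at_within[of z z UNIV] by eventually_elim simp
  have "m \<ge> - 1"
  proof (rule ccontr)
    assume "\<not> m \<ge> - 1"
    then have m: "m < - 1"
      by simp
    have "4 * (3 / 4) * (of_int m - 1) = (of_int (m * (m - 1) * (m - 2)) :: complex)"
    proof (rule indicial_equation[OF S g A])
      have "((\<lambda>x. 3 / 4 + u i * (x - z) + K i x * (x - z) ^ 2) \<longlongrightarrow> 3 / 4 + u i * (z - z) + u i ^ 2 * (z - z) ^ 2) (at z)"
        by (intro tendsto_intros K)
      moreover have "\<forall>\<^sub>F x in at z. 3 / 4 + u i * (x - z) + K i x * (x - z) ^ 2 = Qf x * (x - z)\<^sup>2"
        using ne
      proof eventually_elim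
        case (elim x)
        have "3 / 4 + c * y + d * y ^ 2 = (3 / (4 * y ^ 2) + c / y + d) * y ^ 2" if "y \<noteq> 0" for c d y :: complex
          using that by (simp add: field_simps power2_eq_square)
        from this[OF elim] show ?case
          by (simp only: Qf_split[OF i] z_def)
      qed
      ultimately show "((\<lambda>x. Qf x * (x - z)\<^sup>2) \<longlongrightarrow> 3 / 4) (at z)"
        using Lim_transform_eventually by fastforce
      have "((\<lambda>x. - 3 / 2 - u i * (x - z) + dK i x * (x - z) ^ 3) \<longlongrightarrow> - 3 / 2 - u i * (z - z) + c1 i * (z - z) ^ 3) (at z)"
        by (intro tendsto_intros K')
      moreover have "\<forall>\<^sub>F x in at z. - 3 / 2 - u i * (x - z) + dK i x * (x - z) ^ 3 = dQf x * (x - z) ^ 3"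
        using ne
      proof eventually_elim
        case (elim x)
        have "- 3 / 2 - c * y + d * y ^ 3 = (- 3 / (2 * y ^ 3) - c / y ^ 2 + d) * y ^ 3" if "y \<noteq> 0" for c d y :: complex
          using that by (simp add: field_simps power2_eq_square power3_eq_cube)
        from this[OF elim] show ?case
          by (simp only: dQf_split[OF i] z_def)
      qed
      ultimately show "((\<lambda>x. dQf x * (x - z) ^ 3) \<longlongrightarrow> - 2 * (3 / 4)) (at z)"
        using Lim_transform_eventually by fastforce
      have "((\<lambda>x. 3 * w (Cq i) / 2 + u i * w (Cq i) * (x - z) + du w i * (x - z) ^ 2 + Ldot w i x * (x - z) ^ 3) \<longlongrightarrow>
        3 * w (Cq i) / 2 + u i * w (Cq i) * (z - z) + du w i * (z - z) ^ 2 + Ldot w i (q i) * (z - z) ^ 3) (at z)"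
        by (intro tendsto_intros L) auto
      moreover have "\<forall>\<^sub>F x in at z. 3 * w (Cq i) / 2 + u i * w (Cq i) * (x - z) + du w i * (x - z) ^ 2 + Ldot w i x * (x - z) ^ 3
          = Qdot w x * (x - z) ^ 3"
        using ne
      proof eventually_elim
        case (elim x)
        have "3 * e / 2 + f * y + g * y ^ 2 + l * y ^ 3 = (3 * e / (2 * y ^ 3) + f / y ^ 2 + g / y + l) * y ^ 3"
          if "y \<noteq> 0" for y e f g l :: complex
          using that by (simp add: field_simps power2_eq_square power3_eq_cube)
        from this[OF elim] show ?case
          by (simp only: Qdot_split[OF i] dpol_def z_def)
      qed
      ultimately show "((\<lambda>x. Qdot w x * (x - z) ^ 3) \<longlongrightarrow>
          3 * w (Cq i) / 2 + u i * w (Cq i) * (z - z) + du w i * (z - z) ^ 2 + Ldot w i (q i) * (z - z) ^ 3) (at z)"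
        by (rule Lim_transform_eventually)
    qed (use eq m in \<open>simp_all add: isomon_eq_def z_def\<close>)
    then have "(of_int (3 * (m - 1)) :: complex) = of_int (m * (m - 1) * (m - 2))"
      by simp
    then have "3 * (m - 1) = m * (m - 1) * (m - 2)"
      by (simp only: of_int_eq_iff)
    \<comment> \<open>The cubic indicial equation factored; below -1 it has no root.\<close>
    then have "(m - 1) * (m - 3) * (m + 1) = 0"
      by (simp add: algebra_simps)
    then show False
      using m by simp
  qed
  show ?thesis
  proof (cases "m = - 1")
    case True
    have "((\<lambda>x. (g x - g z) / (x - z)) \<longlongrightarrow> deriv g z) (at z)"
      using holomorphic_derivI[OF g(1) S] by (simp add: has_field_derivative_iff)
    moreover have "\<forall>\<^sub>F x in at z. (g x - g z) / (x - z) = A x - g z / (x - z)"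
      using eventually_at_in_open[OF S] by eventually_elim (use True A in \<open>simp add: power_int_def diff_divide_distrib divide_inverse left_diff_distrib\<close>)
    ultimately have "((\<lambda>x. A x - g z / (x - z)) \<longlongrightarrow> deriv g z) (at z)"
      by (rule Lim_transform_eventually)
    then show ?thesis
      unfolding z_def by blast
  next
    case False
    then have m: "m \<ge> 0"
      using \<open>m \<ge> - 1\<close> by simp
    have "((\<lambda>x. g x * (x - z) ^ nat m) \<longlongrightarrow> g z * (z - z) ^ nat m) (at z)"
      by (intro tendsto_intros cont[OF g(1)])
    moreover have "\<forall>\<^sub>F x in at z. g x * (x - z) ^ nat m = A x - 0 / (x - z)"
      using eventually_at_in_open[OF S] by eventually_elim (use m A in \<open>simp add: power_int_def\<close>)
    ultimately have "((\<lambda>x. A x - 0 / (x - z)) \<longlongrightarrow> g z * (z - z) ^ nat m) (at z)"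
      by (rule Lim_transform_eventually)
    then show ?thesis
      unfolding z_def by blast
  qed
qed

text \<open>A nonvanishing limit or a pole at infinity would make the odd degree
  \<open>2 n + 1\<close> equal to the even number \<open>2 * m\<close>.\<close>

lemma solution_at_infinity:
  assumes mero: "(\<lambda>z. A (inverse z)) meromorphic_on {0}" and eq: "\<forall>\<^sub>F z in at 0. isomon_eq w A (inverse z)"
    and ana: "\<forall>\<^sub>F z in at 0. A analytic_on {inverse z}"
  shows "(A \<longlongrightarrow> 0) at_infinity"
proof -
  have "((\<lambda>z. A (inverse z)) \<longlongrightarrow> 0) (at 0)"
  proof (cases "\<forall>\<^sub>F z in at 0. A (inverse z) = 0")
    case True
    then show ?thesis
      by (rule tendsto_eventually)
  next
    case False
    obtain g m S where S: "open S" "0 \<in> S" and g: "g holomorphic_on S" "g 0 \<noteq> 0"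
      and A: "\<And>z. z \<in> S - {0} \<Longrightarrow> A (inverse z) = g z * (z - 0) powi m"
      by (rule meromorphic_factor[OF mero False]) (rule that)
    obtain T where T: "open T" "0 \<in> T" "\<And>z. z \<in> T - {0} \<Longrightarrow> A analytic_on {inverse z}"
      using ana unfolding eventually_at_topological by blast
    \<comment> \<open>\<open>S\<close> carries the factorisation of \<open>A\<close> and
      \<open>T\<close> its analyticity, which the chain rule in the coordinate at infinity
      requires.\<close>
    have ST: "open (S \<inter> T)" "0 \<in> S \<inter> T" "g holomorphic_on S \<inter> T"
      using S T g holomorphic_on_subset by auto
    have "m > 0"
    proof (rule ccontr)
      assume "\<not> m > 0"
      then have m: "m \<le> 0"
        by simp
      have "int (2 * n + 1) = 2 * m"
      proof (rule indicial_equation_infinity[OF ST g(2) _ m _ _ Qf_at_infinity dQf_at_infinity Qdot_at_infinity])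
        show "\<forall>\<^sub>F z in at 0. Qdot w (inverse z) = dQf (inverse z) * A (inverse z) + 2 * Qf (inverse z) * deriv A (inverse z)
                - (deriv ^^ 3) A (inverse z) / 2"
          using eq by (simp add: isomon_eq_def)
      qed (use A T lam_nz in auto)
      then show False
        by presburger
    qed
    have "(g \<longlongrightarrow> g 0) (at 0)"
      using g(1) S by (meson continuous_on_eq_continuous_at holomorphic_on_imp_continuous_on isCont_def)
    from tendsto_mult[OF this tendsto_powi_pos[OF \<open>m > 0\<close>, of 0]]
    have "((\<lambda>z. g z * (z - 0) powi m) \<longlongrightarrow> 0) (at 0)"
      by simp
    moreover have "\<forall>\<^sub>F z in at 0. g z * (z - 0) powi m = A (inverse z)"
      using eventually_at_in_open[OF S] by eventually_elim (use A in auto)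
    ultimately show ?thesis
      by (rule Lim_transform_eventually)
  qed
  then show ?thesis
    by (simp add: lim_at_infinity_0 o_def)
qed

text \<open>Subtracting the simple poles leaves only removable singularities, so Liouville's theorem
  applies. The equality is claimed only at points of analyticity, since a meromorphic function may
  take arbitrary values at isolated points.\<close>

lemma solution_eq_resolvent:
  assumes mero: "A meromorphic_on UNIV" "(\<lambda>z. A (inverse z)) meromorphic_on {0}"
    and eq: "\<And>z. \<forall>\<^sub>F x in at z. isomon_eq w A x" "\<forall>\<^sub>F z in at 0. isomon_eq w A (inverse z)"
    and ana: "\<forall>\<^sub>F z in at 0. A analytic_on {inverse z}"
  obtains \<alpha> where "\<And>x. A analytic_on {x} \<Longrightarrow> x \<notin> q ` {1..n} \<Longrightarrow> A x = (\<Sum>i=1..n. \<alpha> i / (x - q i))"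
proof -
  have mero_at: "A meromorphic_on {z}" for z
    using mero(1) meromorphic_on_subset by blast
  have "\<forall>i\<in>{1..n}. \<exists>\<alpha> c. ((\<lambda>x. A x - \<alpha> / (x - q i)) \<longlongrightarrow> c) (at (q i))"
    using solution_at_node[OF mero_at eq(1)] by blast
  then obtain \<alpha> where \<alpha>: "\<And>i. i \<in> {1..n} \<Longrightarrow> \<exists>c. ((\<lambda>x. A x - \<alpha> i / (x - q i)) \<longlongrightarrow> c) (at (q i))"
    by metis
  define h where "h = (\<lambda>x. A x - (\<Sum>i=1..n. \<alpha> i / (x - q i)))"
  have sum_lim: "((\<lambda>x. \<Sum>i\<in>I. \<alpha> i / (x - q i)) \<longlongrightarrow> (\<Sum>i\<in>I. \<alpha> i / (z - q i))) (at z)" if "z \<notin> q ` I" for z I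
    using that by (intro tendsto_intros) auto
  have h_mero: "h meromorphic_on UNIV"
    unfolding h_def by (intro meromorphic_intros mero)
  have lim: "\<exists>c. (h \<longlongrightarrow> c) (at z)" for z
  proof (cases "z \<in> q ` {1..n}")
    case True
    then obtain i where i: "i \<in> {1..n}" "z = q i"
      by blast
    obtain c where c: "((\<lambda>x. A x - \<alpha> i / (x - q i)) \<longlongrightarrow> c) (at z)"
      using \<alpha>[OF i(1)] i(2) by blast
    have "((\<lambda>x. A x - \<alpha> i / (x - q i) - (\<Sum>k\<in>{1..n} - {i}. \<alpha> k / (x - q k))) \<longlongrightarrow> c - (\<Sum>k\<in>{1..n} - {i}. \<alpha> k / (z - q k))) (at z)"
      using node_notin[OF i(1)] i(2) by (intro tendsto_diff c sum_lim) simp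
    moreover have "A x - \<alpha> i / (x - q i) - (\<Sum>k\<in>{1..n} - {i}. \<alpha> k / (x - q k)) = h x" for x
      unfolding h_def using i(1) by (subst (2) sum.remove[of _ i]) (auto simp: algebra_simps)
    ultimately show ?thesis
      by auto
  next
    case False
    then obtain c where "(A \<longlongrightarrow> c) (at z)"
      using solution_at_regular_point[OF mero_at eq(1)] by blast
    then have "(h \<longlongrightarrow> c - (\<Sum>i=1..n. \<alpha> i / (z - q i))) (at z)"
      unfolding h_def by (intro tendsto_diff sum_lim False)
    then show ?thesis
      by blast
  qed
  \<comment> \<open>\<open>remove_sings\<close> replaces arbitrary values of \<open>h\<close> at
    isolated points by its limits, which makes the function entire.\<close>
  define H where "H = remove_sings h"
  have "H analytic_on {z}" for z
  proof -
    have "isolated_singularity_at h z"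
      using h_mero meromorphic_on_isolated_singularity meromorphic_on_subset by blast
    then show ?thesis
      unfolding H_def using lim[of z] remove_sings_analytic_at by blast
  qed
  then have H_hol: "H holomorphic_on UNIV"
    using analytic_imp_holomorphic analytic_on_analytic_at[of H UNIV] by blast
  have h_ana: "h analytic_on {x}" if "A analytic_on {x}" "x \<notin> q ` {1..n}" for x
    unfolding h_def using that by (intro analytic_intros) auto
  then have H_eq: "H x = h x" if "A analytic_on {x}" "x \<notin> q ` {1..n}" for x
    unfolding H_def using that by simp
  have "(h \<longlongrightarrow> 0 - (\<Sum>i=1..n. 0)) at_infinity"
  proof -
    have "((\<lambda>x::complex. \<alpha> i / (x - q i)) \<longlongrightarrow> 0) at_infinity" for i
      using tendsto_add_filterlim_at_infinity[OF tendsto_const[of "- q i"] filterlim_ident]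
      by (intro tendsto_divide_0[OF tendsto_const]) simp
    then show ?thesis
      unfolding h_def by (intro tendsto_diff tendsto_sum solution_at_infinity[OF mero(2) eq(2) ana])
  qed
  then have h_lim: "(h \<longlongrightarrow> 0) at_infinity"
    by simp
  have "\<forall>\<^sub>F x in at_infinity. A analytic_on {x}"
    using ana unfolding at_to_infinity eventually_filtermap by simp
  moreover have "\<forall>\<^sub>F x in at_infinity. x \<notin> q ` {1..n}"
  proof -
    have "\<forall>\<^sub>F x in at_infinity. \<forall>i\<in>{1..n}. x \<noteq> q i"
      by (intro eventually_ball_finite ballI eventually_not_equal_at_infinity) auto
    then show ?thesis
      by eventually_elim auto
  qed
  ultimately have "\<forall>\<^sub>F x in at_infinity. h x = H x"
    by eventually_elim (simp add: H_eq)
  with h_lim have "(H \<longlongrightarrow> 0) at_infinity"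
    by (rule Lim_transform_eventually)
  then have H0: "H x = 0" for x
    using Liouville_weak_0[OF H_hol] by blast
  show thesis
  proof (rule that[of \<alpha>])
    fix x assume "A analytic_on {x}" "x \<notin> q ` {1..n}"
    then have "h x = 0"
      using H_eq H0 by metis
    then show "A x = (\<Sum>i=1..n. \<alpha> i / (x - q i))"
      by (simp add: h_def)
  qed
qed

end

section \<open>Isomonodromic flows\<close>

abbreviation entry :: "complex^2^2 \<Rightarrow> 2 \<Rightarrow> 2 \<Rightarrow> complex" where
  "entry M k l \<equiv> vec_nth (vec_nth M k) l"

text \<open>The (1,1), (1,2) and (2,2) equations determine the matrix from its upper right entry up
  to a multiple of the identity; the (2,1) equation then becomes the third-order scalar
  equation.\<close>

lemma flat_at_companion_iff:
  "flat_at (\<lambda>y s. companion (Q s y)) B x t \<longleftrightarrow>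
     deriv (\<lambda>y. entry (B y t) 1 1) x = entry (B x t) 2 1 - entry (B x t) 1 2 * Q t x \<and>
     deriv (\<lambda>y. entry (B y t) 1 2) x = entry (B x t) 2 2 - entry (B x t) 1 1 \<and>
     deriv (\<lambda>y. entry (B y t) 2 1) x = deriv (\<lambda>s. Q s x) t + Q t x * entry (B x t) 1 1 - entry (B x t) 2 2 * Q t x \<and>
     deriv (\<lambda>y. entry (B y t) 2 2) x = Q t x * entry (B x t) 1 2 - entry (B x t) 2 1"
proof -
  let ?d = "\<lambda>k l. deriv (\<lambda>y. entry (B y t) k l) x"
  have "flat_at (\<lambda>y s. companion (Q s y)) B x t \<longleftrightarrow>
     (deriv (\<lambda>s. 0) t - ?d 1 1 + (0 * entry (B x t) 1 1 + 1 * entry (B x t) 2 1 - (entry (B x t) 1 1 * 0 + entry (B x t) 1 2 * Q t x)) = 0 \<and>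
      deriv (\<lambda>s. 1) t - ?d 1 2 + (0 * entry (B x t) 1 2 + 1 * entry (B x t) 2 2 - (entry (B x t) 1 1 * 1 + entry (B x t) 1 2 * 0)) = 0) \<and>
     (deriv (\<lambda>s. Q s x) t - ?d 2 1 + (Q t x * entry (B x t) 1 1 + 0 * entry (B x t) 2 1 - (entry (B x t) 2 1 * 0 + entry (B x t) 2 2 * Q t x)) = 0 \<and>
      deriv (\<lambda>s. 0) t - ?d 2 2 + (Q t x * entry (B x t) 1 2 + 0 * entry (B x t) 2 2 - (entry (B x t) 2 1 * 1 + entry (B x t) 2 2 * 0)) = 0)"
    unfolding flat_at_def vec_eq_iff forall_2 companion_def matrix_matrix_mult_def sum_2
    by (simp only: vec_lambda_beta vector_add_component vector_minus_component vector_2 zero_index)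
  moreover have "0 - d + (0 * x1 + 1 * x2 - (x3 * 0 + x4 * x5)) = 0 \<longleftrightarrow> d = x2 - x4 * x5" for d x1 x2 x3 x4 x5 :: complex
    by (auto simp: algebra_simps)
  moreover have "0 - d + (0 * x1 + 1 * x2 - (x3 * 1 + x4 * 0)) = 0 \<longleftrightarrow> d = x2 - x3" for d x1 x2 x3 x4 x5 :: complex
    by (auto simp: algebra_simps)
  moreover have "e - d + (x1 * x2 + 0 * x3 - (x4 * 0 + x5 * x6)) = 0 \<longleftrightarrow> d = e + x1 * x2 - x5 * x6" for d e x1 x2 x3 x4 x5 x6 :: complex
    by (auto simp: algebra_simps)
  moreover have "0 - d + (x1 * x2 + 0 * x3 - (x4 * 1 + x5 * 0)) = 0 \<longleftrightarrow> d = x1 * x2 - x4" for d x1 x2 x3 x4 x5 :: complex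
    by (auto simp: algebra_simps)
  ultimately show ?thesis
    by (simp only: deriv_const conj_assoc)
qed

section \<open>Meromorphic functions on the projective line and the matrix of a flow\<close>

lemma meromorphic_on_CP1_intros:
  shows "meromorphic_on_CP1 (\<lambda>x. c)" "meromorphic_on_CP1 (\<lambda>x. x)"
    and "meromorphic_on_CP1 f \<Longrightarrow> meromorphic_on_CP1 g \<Longrightarrow> meromorphic_on_CP1 (\<lambda>x. f x + g x)"
    and "meromorphic_on_CP1 f \<Longrightarrow> meromorphic_on_CP1 g \<Longrightarrow> meromorphic_on_CP1 (\<lambda>x. f x - g x)"
    and "meromorphic_on_CP1 f \<Longrightarrow> meromorphic_on_CP1 g \<Longrightarrow> meromorphic_on_CP1 (\<lambda>x. f x * g x)"
    and "meromorphic_on_CP1 f \<Longrightarrow> meromorphic_on_CP1 g \<Longrightarrow> meromorphic_on_CP1 (\<lambda>x. f x / g x)"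
    and "meromorphic_on_CP1 f \<Longrightarrow> meromorphic_on_CP1 (\<lambda>x. - f x)"
    and "meromorphic_on_CP1 f \<Longrightarrow> meromorphic_on_CP1 (\<lambda>x. f x ^ k)"
  unfolding meromorphic_on_CP1_def by (auto intro!: meromorphic_intros)

lemma meromorphic_on_CP1_sum:
  "(\<And>i. i \<in> I \<Longrightarrow> meromorphic_on_CP1 (f i)) \<Longrightarrow> meromorphic_on_CP1 (\<lambda>x. \<Sum>i\<in>I. f i x)"
  unfolding meromorphic_on_CP1_def by (auto intro!: meromorphic_intros)

lemma polyfun_less_meromorphic_on_CP1:
  assumes "polyfun_less n f"
  shows "meromorphic_on_CP1 f"
proof -
  obtain r where "f = poly r"
    using assms unfolding polyfun_less_def by auto
  then have "f = (\<lambda>x. \<Sum>i\<le>degree r. coeff r i * x ^ i)"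
    by (auto simp: poly_altdef)
  then show ?thesis
    by (auto intro!: meromorphic_on_CP1_intros meromorphic_on_CP1_sum)
qed

lemma Q_pot_meromorphic_on_CP1: "meromorphic_on_CP1 (Q_pot n lam P)"
proof -
  obtain a b q v p where P: "P = (a, b, q, v, p)"
    by (cases P)
  show ?thesis
    unfolding P Q_pot_eq[abs_def] topP_def
    by (intro meromorphic_on_CP1_intros meromorphic_on_CP1_sum
          polyfun_less_meromorphic_on_CP1[OF polyfun_less_lowP])
qed

lemma isolated_singularity_imp_eventually_analytic:
  assumes "isolated_singularity_at f z"
  shows "\<forall>\<^sub>F x in at z. f analytic_on {x}"
proof -
  obtain r where r: "r > 0" "f analytic_on ball z r - {z}"
    using assms by (auto simp: isolated_singularity_at_def)
  have "\<forall>\<^sub>F x in at z. x \<in> ball z r - {z}"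
    using r(1) by (intro eventually_at_in_open) auto
  then show ?thesis
    by eventually_elim (use r(2) analytic_on_subset in blast)
qed

lemma meromorphic_on_CP1_eventually_analytic:
  assumes "meromorphic_on_CP1 f"
  shows "\<forall>\<^sub>F x in at z. f analytic_on {x}" "\<forall>\<^sub>F z in at 0. f analytic_on {inverse z}"
proof -
  have "isolated_singularity_at f z"
    using assms meromorphic_on_isolated_singularity meromorphic_on_subset
    unfolding meromorphic_on_CP1_def by blast
  then show "\<forall>\<^sub>F x in at z. f analytic_on {x}"
    by (rule isolated_singularity_imp_eventually_analytic)
  have "isolated_singularity_at (\<lambda>z. f (inverse z)) 0"
    using assms meromorphic_on_isolated_singularity unfolding meromorphic_on_CP1_def by blast
  then have "\<forall>\<^sub>F z in at 0. (\<lambda>z. f (inverse z)) analytic_on {z}"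
    by (rule isolated_singularity_imp_eventually_analytic)
  then show "\<forall>\<^sub>F z in at 0. f analytic_on {inverse z}"
    using eventually_neq_at_within[of 0 0 UNIV]
  proof eventually_elim
    case (elim z)
    have "inverse analytic_on {inverse z}"
      using elim by (intro analytic_intros) auto
    moreover have "(\<lambda>z. f (inverse z)) analytic_on inverse ` {inverse z}"
      using elim by simp
    ultimately have "(\<lambda>z. f (inverse z)) \<circ> inverse analytic_on {inverse z}"
      by (rule analytic_on_compose)
    then show ?case
      by (simp add: o_def)
  qed
qed

text \<open>For \<open>k = 1\<close> this is \<open>A\<close>; up to the factors -1, 2 and -6, the
  cases \<open>k = 2, 3, 4\<close> are its first three derivatives.\<close>

definition pole_sum :: "nat \<Rightarrow> (nat \<Rightarrow> complex) \<Rightarrow> (nat \<Rightarrow> complex) \<Rightarrow> nat \<Rightarrow> complex \<Rightarrow> complex" where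
  "pole_sum n q \<alpha> k x = (\<Sum>i=1..n. \<alpha> i / (x - q i) ^ k)"

lemma pole_sum_has_field_derivative:
  assumes "x \<notin> q ` {1..n}"
  shows "(pole_sum n q \<alpha> k has_field_derivative - of_nat k * pole_sum n q \<alpha> (Suc k) x) (at x)"
proof -
  have 1: "((\<lambda>x. c / (x - z) ^ k) has_field_derivative - of_nat k * (c / (x - z) ^ Suc k)) (at x)"
    if "x \<noteq> z" for c z
  proof (cases k)
    case (Suc m)
    have 1: "((\<lambda>x. c / (x - z) ^ k) has_field_derivative
       - (c * (of_nat k * (x - z) ^ (k - 1))) / ((x - z) ^ k * (x - z) ^ k)) (at x)"
      using that by (auto intro!: derivative_eq_intros)
    also have "- (c * (of_nat k * (x - z) ^ (k - 1))) / ((x - z) ^ k * (x - z) ^ k)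
        = - of_nat k * (c / (x - z) ^ Suc k)"
    proof -
      have "- (c * (of_nat k * y ^ (k - 1))) / (y ^ k * y ^ k) = - of_nat k * (c / y ^ Suc k)" if "y \<noteq> 0" for y
        using that by (simp add: Suc field_simps)
      then show ?thesis
        using that by simp
    qed
    finally show ?thesis .
  qed auto
  have "((\<lambda>x. \<Sum>i=1..n. \<alpha> i / (x - q i) ^ k) has_field_derivative
      (\<Sum>i=1..n. - of_nat k * (\<alpha> i / (x - q i) ^ Suc k))) (at x)"
  proof (intro DERIV_sum)
    fix i assume "i \<in> {1..n}"
    then have "x \<noteq> q i"
      using assms by blast
    then show "((\<lambda>x. \<alpha> i / (x - q i) ^ k) has_field_derivative - of_nat k * (\<alpha> i / (x - q i) ^ Suc k)) (at x)"
      by (rule 1)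
  qed
  then show ?thesis
    by (simp only: pole_sum_def[abs_def] sum_distrib_left)
qed

lemma pole_sum_meromorphic_on_CP1: "meromorphic_on_CP1 (pole_sum n q \<alpha> k)"
  unfolding pole_sum_def[abs_def] by (intro meromorphic_on_CP1_intros meromorphic_on_CP1_sum)

text \<open>The matrix \<open>B\<close> determined by its upper right entry \<open>A = \<Sum>\<^sub>i \<alpha>\<^sub>i / (x - q\<^sub>i)\<close>.\<close>
definition flow_matrix :: "nat \<Rightarrow> complex \<Rightarrow> (nat \<Rightarrow> complex) \<Rightarrow> complex \<Rightarrow> point \<Rightarrow> complex^2^2" where
  "flow_matrix n lam \<alpha> x P =
     (let A = (\<lambda>k. pole_sum n (\<lambda>i. coord_val (Cq i) P) \<alpha> k x)
      in vector [vector [A 2 / 2, A 1], vector [Q_pot n lam P x * A 1 - A 3, - A 2 / 2]])"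

lemma flow_matrix_components:
  "entry (flow_matrix n lam \<alpha> x P) 1 1 = pole_sum n (\<lambda>i. coord_val (Cq i) P) \<alpha> 2 x / 2"
  "entry (flow_matrix n lam \<alpha> x P) 1 2 = pole_sum n (\<lambda>i. coord_val (Cq i) P) \<alpha> 1 x"
  "entry (flow_matrix n lam \<alpha> x P) 2 1 = Q_pot n lam P x * pole_sum n (\<lambda>i. coord_val (Cq i) P) \<alpha> 1 x
       - pole_sum n (\<lambda>i. coord_val (Cq i) P) \<alpha> 3 x"
  "entry (flow_matrix n lam \<alpha> x P) 2 2 = - pole_sum n (\<lambda>i. coord_val (Cq i) P) \<alpha> 2 x / 2"
  by (simp_all add: flow_matrix_def Let_def)

lemma flow_matrix_meromorphic_on_CP1: "meromorphic_on_CP1 (\<lambda>x. entry (flow_matrix n lam \<alpha> x P) k l)"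
proof -
  have "\<forall>k l. meromorphic_on_CP1 (\<lambda>x. entry (flow_matrix n lam \<alpha> x P) k l)"
    unfolding forall_2 flow_matrix_components
    by (intro conjI meromorphic_on_CP1_intros pole_sum_meromorphic_on_CP1 Q_pot_meromorphic_on_CP1)
  then show ?thesis
    by blast
qed

section \<open>Flatness and the scalar equation\<close>

context oscillator
begin

lemma sum_vE: "(\<Sum>i=1..n. \<alpha> i * vE i x)
    = dQf x * pole_sum n q \<alpha> 1 x - 2 * Qf x * pole_sum n q \<alpha> 2 x + 3 * pole_sum n q \<alpha> 4 x"
proof -
  have "(\<Sum>i=1..n. \<alpha> i * vE i x) = (\<Sum>i=1..n. dQf x * (\<alpha> i / (x - q i) ^ 1)
      - 2 * Qf x * (\<alpha> i / (x - q i) ^ 2) + 3 * (\<alpha> i / (x - q i) ^ 4))"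
    by (intro sum.cong) (simp_all add: vE_def algebra_simps del: Q_pot.simps)
  then show ?thesis
    by (simp only: pole_sum_def sum.distrib sum_subtractf sum_distrib_left)
qed

text \<open>The matrix is prescribed only at the parameter \<open>t\<close>, because the
  coefficients \<open>\<alpha>\<close> of a vector field may change from point to point along the
  curve.\<close>

lemma flat_at_flow_matrix:
  assumes vel: "has_velocity n \<gamma> t w" and pt: "\<gamma> t = pt" and x: "x \<notin> q ` {1..n}"
    and w: "Qdot w x = (\<Sum>i=1..n. \<alpha> i * vE i x)"
    and B: "\<And>y. B y (\<gamma> t) = flow_matrix n lam \<alpha> y (\<gamma> t)"
  shows "flat_at (\<lambda>y s. companion (Q_pot n lam (\<gamma> s) y)) (\<lambda>y s. B y (\<gamma> s)) x t"
proof -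
  have dQ: "deriv (\<lambda>s. Q_pot n lam (\<gamma> s) x) t = Qdot w x"
    by (rule DERIV_imp_deriv[OF Q_pot_has_field_derivative[OF vel pt x]])
  note ps = pole_sum_has_field_derivative[OF x]
  have 1: "deriv (\<lambda>y. pole_sum n q \<alpha> 2 y / 2) x = - of_nat 2 * pole_sum n q \<alpha> (Suc 2) x / 2"
    by (intro DERIV_imp_deriv DERIV_cdivide ps)
  have 2: "deriv (\<lambda>y. pole_sum n q \<alpha> 1 y) x = - of_nat 1 * pole_sum n q \<alpha> (Suc 1) x"
    by (intro DERIV_imp_deriv ps)
  have 3: "deriv (\<lambda>y. Qf y * pole_sum n q \<alpha> 1 y - pole_sum n q \<alpha> 3 y) x
      = dQf x * pole_sum n q \<alpha> 1 x + - of_nat 1 * pole_sum n q \<alpha> (Suc 1) x * Qf x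
        - - of_nat 3 * pole_sum n q \<alpha> (Suc 3) x"
    by (intro DERIV_imp_deriv DERIV_diff DERIV_mult ps Qf_has_field_derivative x)
  have 4: "deriv (\<lambda>y. - pole_sum n q \<alpha> 2 y / 2) x = - (- of_nat 2 * pole_sum n q \<alpha> (Suc 2) x) / 2"
    by (intro DERIV_imp_deriv DERIV_cdivide DERIV_minus ps)
  have q: "(\<lambda>i. coord_val (Cq i) (a, b, q, v, p)) = q"
    by simp
  show ?thesis
    unfolding flat_at_companion_iff dQ w sum_vE pt B[unfolded pt] flow_matrix_components q 1 2 3 4
    by (simp add: eval_nat_numeral algebra_simps del: Q_pot.simps)
qed

text \<open>Elimination of the other entries: \<open>A' = B22 - B11\<close>,
  \<open>A'' = 2 (Q A - B21)\<close>, and \<open>B21' = dQ/dt - Q A'\<close>. The trace of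
  \<open>B\<close> drops out. A whole neighbourhood is used because the equations are differentiated
  in \<open>x\<close>.\<close>

lemma isomon_eq_of_flat:
  assumes O: "open O'" "x \<in> O'" and dQ: "\<And>y. y \<in> O' \<Longrightarrow> deriv (\<lambda>s. Qs s y) t = Qdot w y"
    and Q: "\<And>y. Qs t y = Qf y" and nodes: "\<And>y. y \<in> O' \<Longrightarrow> y \<notin> q ` {1..n}"
    and ana: "\<And>y k l. y \<in> O' \<Longrightarrow> (\<lambda>y. entry (B y t) k l) analytic_on {y}"
    and flat: "\<And>y. y \<in> O' \<Longrightarrow> flat_at (\<lambda>y s. companion (Qs s y)) B y t"
  shows "isomon_eq w (\<lambda>y. entry (B y t) 1 2) x"
proof -
  define A where "A = (\<lambda>y. entry (B y t) 1 2)"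
  note eqs = flat[unfolded flat_at_companion_iff Q]
  have hfd: "((\<lambda>y. entry (B y t) k l) has_field_derivative deriv (\<lambda>y. entry (B y t) k l) y) (at y)" if "y \<in> O'" for k l y
    using ana[OF that] analytic_on_imp_differentiable_at DERIV_deriv_iff_field_differentiable by blast
  have cong: "deriv f y = deriv g y" if "\<And>y. y \<in> O' \<Longrightarrow> f y = g y" "y \<in> O'" for f g :: "complex \<Rightarrow> complex" and y
    using eventually_nhds_in_open[OF O(1) that(2)] by (intro deriv_cong_ev) (auto elim!: eventually_mono simp: that)
  have A1: "deriv A y = entry (B y t) 2 2 - entry (B y t) 1 1" if "y \<in> O'" for y
    using eqs[OF that] by (simp add: A_def)
  have A2: "deriv (deriv A) y = 2 * (Qf y * A y - entry (B y t) 2 1)" if "y \<in> O'" for y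
  proof -
    have "deriv (deriv A) y = deriv (\<lambda>y. entry (B y t) 2 2 - entry (B y t) 1 1) y"
      by (intro cong A1 that)
    also have "\<dots> = deriv (\<lambda>y. entry (B y t) 2 2) y - deriv (\<lambda>y. entry (B y t) 1 1) y"
      by (intro DERIV_imp_deriv DERIV_diff hfd that)
    also have "\<dots> = (Qf y * A y - entry (B y t) 2 1) - (entry (B y t) 2 1 - A y * Qf y)"
      using eqs[OF that] unfolding A_def by (simp only:)
    finally show ?thesis
      by (simp add: algebra_simps del: Q_pot.simps)
  qed
  have "deriv (deriv (deriv A)) x = deriv (\<lambda>y. 2 * (Qf y * A y - entry (B y t) 2 1)) x"
    by (intro cong A2 O)
  also have "\<dots> = 2 * (dQf x * A x + deriv A x * Qf x - deriv (\<lambda>y. entry (B y t) 2 1) x)"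
    unfolding A_def
    by (intro DERIV_imp_deriv DERIV_cmult DERIV_diff DERIV_mult hfd Qf_has_field_derivative nodes O)
  also have "deriv (\<lambda>y. entry (B y t) 2 1) x = Qdot w x - Qf x * deriv A x"
    using eqs[OF O(2)] dQ[OF O(2)] unfolding A1[OF O(2)] by (simp add: algebra_simps del: Q_pot.simps)
  finally have "(deriv ^^ 3) A x = 2 * (dQf x * A x + deriv A x * Qf x - (Qdot w x - Qf x * deriv A x))"
    by (simp add: numeral_3_eq_3 del: Q_pot.simps)
  then have "(deriv ^^ 3) A x / 2 = dQf x * A x + deriv A x * Qf x - (Qdot w x - Qf x * deriv A x)"
    by (simp del: Q_pot.simps)
  then show ?thesis
    unfolding isomon_eq_def A_def[symmetric] by (simp add: algebra_simps del: Q_pot.simps)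
qed

text \<open>Analyticity at \<open>x\<close> extends to a neighbourhood, where the formula for
  \<open>A\<close> holds identically and can be differentiated three times.\<close>

lemma isomon_eq_resolvent:
  assumes A: "A analytic_on {x}" and eq: "isomon_eq w A x" and x: "x \<notin> q ` {1..n}"
    and res: "\<And>x. A analytic_on {x} \<Longrightarrow> x \<notin> q ` {1..n} \<Longrightarrow> A x = (\<Sum>i=1..n. \<alpha> i / (x - q i))"
  shows "Qdot w x = (\<Sum>i=1..n. \<alpha> i * vE i x)"
proof -
  obtain S where S: "open S" "x \<in> S" "A analytic_on S"
    using A by (metis analytic_at analytic_on_open singletonI)
  define O' where "O' = S \<inter> - q ` {1..n}"
  have O: "open O'" "x \<in> O'"
    using S x nodes_open by (auto simp: O'_def)
  have nodes: "y \<notin> q ` {1..n}" if "y \<in> O'" for y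
    using that by (simp add: O'_def)
  have cong: "deriv f y = deriv g y" if "\<And>y. y \<in> O' \<Longrightarrow> f y = g y" "y \<in> O'" for f g :: "complex \<Rightarrow> complex" and y
    using eventually_nhds_in_open[OF O(1) that(2)] by (intro deriv_cong_ev) (auto elim!: eventually_mono simp: that)
  have A0: "A y = pole_sum n q \<alpha> 1 y" if "y \<in> O'" for y
    using res[of y] S(3) that analytic_on_subset[of A S "{y}"] by (auto simp: O'_def pole_sum_def)
  have A1: "deriv A y = - of_nat 1 * pole_sum n q \<alpha> (Suc 1) y" if "y \<in> O'" for y
  proof -
    have "deriv A y = deriv (pole_sum n q \<alpha> 1) y"
      by (intro cong A0 that)
    also have "\<dots> = - of_nat 1 * pole_sum n q \<alpha> (Suc 1) y"
      by (intro DERIV_imp_deriv pole_sum_has_field_derivative nodes that)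
    finally show ?thesis .
  qed
  have A2: "deriv (deriv A) y = - of_nat 1 * (- of_nat (Suc 1) * pole_sum n q \<alpha> (Suc (Suc 1)) y)" if "y \<in> O'" for y
  proof -
    have "deriv (deriv A) y = deriv (\<lambda>y. - of_nat 1 * pole_sum n q \<alpha> (Suc 1) y) y"
      by (intro cong A1 that)
    also have "\<dots> = - of_nat 1 * (- of_nat (Suc 1) * pole_sum n q \<alpha> (Suc (Suc 1)) y)"
      by (intro DERIV_imp_deriv DERIV_cmult pole_sum_has_field_derivative nodes that)
    finally show ?thesis .
  qed
  have A3: "deriv (deriv (deriv A)) x = - of_nat 1 * (- of_nat (Suc 1) * (- of_nat (Suc (Suc 1)) * pole_sum n q \<alpha> (Suc (Suc (Suc 1))) x))"
  proof -
    have "deriv (deriv (deriv A)) x = deriv (\<lambda>y. - of_nat 1 * (- of_nat (Suc 1) * pole_sum n q \<alpha> (Suc (Suc 1)) y)) x"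
      by (intro cong A2 O)
    also have "\<dots> = - of_nat 1 * (- of_nat (Suc 1) * (- of_nat (Suc (Suc 1)) * pole_sum n q \<alpha> (Suc (Suc (Suc 1))) x))"
      by (intro DERIV_imp_deriv DERIV_cmult pole_sum_has_field_derivative nodes O)
    finally show ?thesis .
  qed
  show ?thesis
    using eq unfolding isomon_eq_def sum_vE A0[OF O(2)] A1[OF O(2)]
    by (simp add: numeral_3_eq_3 A3 eval_nat_numeral del: Q_pot.simps)
qed

end

lemma has_velocity_imp_in_X: "has_velocity n \<gamma> t w \<Longrightarrow> \<gamma> t \<in> X_mfd n"
  unfolding has_velocity_def using eventually_nhds_x_imp_x by fast

lemma flow_combination_isomonodromic:
  assumes n: "n > 0" and lam: "lam \<noteq> 0" and vf: "vector_field n W"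
    and W: "\<And>P. P \<in> X_mfd n \<Longrightarrow> W P = (\<Sum>i=1..n. f i P *\<^sub>T U_flow n lam i P) + (\<Sum>i=1..n. g i P *\<^sub>T V_flow n lam i P)"
  shows "isomonodromic n lam W"
proof -
  \<comment> \<open>The factor \<open>lam\<close> enters because \<open>V_i\<close> belongs to
    \<open>A = lam / (x - q_i)\<close>; the \<open>U_i\<close> do not change the potential and
    contribute nothing.\<close>
  define B where "B = (\<lambda>x P. flow_matrix n lam (\<lambda>i. lam * g i P) x P)"
  have "flat_at (\<lambda>y s. companion (Q_pot n lam (\<gamma> s) y)) (\<lambda>y s. B y (\<gamma> s)) x t"
    if vel: "has_velocity n \<gamma> t (W (\<gamma> t))" and x: "\<forall>i\<in>{1..n}. x \<noteq> coord_val (Cq i) (\<gamma> t)" for \<gamma> t x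
  proof -
    obtain a b q v p where pt: "\<gamma> t = (a, b, q, v, p)"
      by (cases "\<gamma> t")
    have X: "(a, b, q, v, p) \<in> X_mfd n"
      using has_velocity_imp_in_X[OF vel] pt by simp
    interpret oscillator n lam a b q v p
      using n lam X by unfold_locales
    have x': "x \<notin> q ` {1..n}"
      using x by (auto simp: pt)
    have "W pt = (\<lambda>k. (\<Sum>i=1..n. f i pt * U_flow n lam i pt k) + (\<Sum>i=1..n. g i pt * V_flow n lam i pt k))"
      unfolding W[OF X] by (simp add: fun_eq_iff sum_tvec_apply vscale_apply)
    then have "Qdot (W pt) x = (\<Sum>i=1..n. f i pt * Qdot (U_flow n lam i pt) x) + (\<Sum>i=1..n. g i pt * Qdot (V_flow n lam i pt) x)"
      by (simp only: Qdot_add Qdot_sum)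
    also have "(\<Sum>i=1..n. f i pt * Qdot (U_flow n lam i pt) x) = 0"
      by (intro sum.neutral ballI) (simp add: Qdot_U_flow)
    also have "(\<Sum>i=1..n. g i pt * Qdot (V_flow n lam i pt) x) = (\<Sum>i=1..n. lam * g i pt * vE i x)"
      by (intro sum.cong refl) (simp only: Qdot_V_flow[OF _ x'] mult_ac)
    finally have "Qdot (W (\<gamma> t)) x = (\<Sum>i=1..n. lam * g i (\<gamma> t) * vE i x)"
      by (simp only: pt add_0)
    then show ?thesis
      by (rule flat_at_flow_matrix[OF vel pt x']) (simp add: B_def)
  qed
  then show ?thesis
    unfolding isomonodromic_def using vf
    by (intro conjI exI[of _ B]) (auto simp: B_def flow_matrix_meromorphic_on_CP1)
qed

text \<open>One curve through \<open>P\<close> with velocity \<open>W P\<close> suffices: there the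
  upper right entry of \<open>B\<close> solves the scalar equation, and its residues at the nodes
  give the coefficients of the \<open>V_i\<close>.\<close>

lemma isomonodromic_imp_flow_combination:
  assumes n: "n > 0" and lam: "lam \<noteq> 0" and iso: "isomonodromic n lam W" and P: "P \<in> X_mfd n"
  shows "\<exists>f g. W P = (\<Sum>i=1..n. f i *\<^sub>T U_flow n lam i P) + (\<Sum>i=1..n. g i *\<^sub>T V_flow n lam i P)"
proof -
  obtain a b q v p where P_eq: "P = (a, b, q, v, p)"
    by (cases P)
  interpret oscillator n lam a b q v p
    using n lam P P_eq by unfold_locales auto
  obtain B where mero: "\<And>k l. meromorphic_on_CP1 (\<lambda>x. entry (B x P) k l)"
    and flat: "\<And>\<gamma> t x. has_velocity n \<gamma> t (W (\<gamma> t)) \<Longrightarrow> (\<forall>i\<in>{1..n}. x \<noteq> coord_val (Cq i) (\<gamma> t)) \<Longrightarrow>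
       (\<forall>k l. (\<lambda>y. entry (B y (\<gamma> t)) k l) analytic_on {x}) \<Longrightarrow>
       flat_at (\<lambda>y s. companion (Q_pot n lam (\<gamma> s) y)) (\<lambda>y s. B y (\<gamma> s)) x t"
    using iso P unfolding isomonodromic_def by blast
  have supp: "W P c = 0" if "c \<notin> coords n" for c
    using iso P that unfolding isomonodromic_def vector_field_def by blast
  obtain \<gamma> where \<gamma>: "\<gamma> 0 = pt" "has_velocity n \<gamma> 0 (W P)"
    by (rule velocity_curve_exists[of "W P"]) (rule supp, assumption, rule that)
  \<comment> \<open>The points where flatness is available. They avoid the nodes and all
    singularities of \<open>B\<close>, yet fill a punctured neighbourhood of every point, infinity
    included.\<close>
  define H where "H = (\<lambda>x. x \<notin> q ` {1..n} \<and> (\<forall>k l. (\<lambda>y. entry (B y P) k l) analytic_on {x}))"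
  define A where "A = (\<lambda>y. entry (B y P) 1 2)"
  have H_at: "\<forall>\<^sub>F x in at z. H x" for z
    unfolding H_def forall_2 using mero
    by (intro eventually_conj nodes_ev meromorphic_on_CP1_eventually_analytic)
  have nodes_inf: "\<forall>\<^sub>F z in at 0. inverse z \<notin> q ` {1..n}"
  proof -
    have "\<forall>\<^sub>F x in at_infinity. \<forall>i\<in>{1..n}. x \<noteq> q i"
      by (intro eventually_ball_finite ballI eventually_not_equal_at_infinity) auto
    then have "\<forall>\<^sub>F z in at 0. \<forall>i\<in>{1..n}. inverse z \<noteq> q i"
      using eventually_compose_filterlim[OF _ filterlim_inverse_at_infinity] by fast
    then show ?thesis
      by eventually_elim auto
  qed
  have H_inf: "\<forall>\<^sub>F z in at 0. H (inverse z)"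
    unfolding H_def forall_2 using mero
    by (intro eventually_conj nodes_inf meromorphic_on_CP1_eventually_analytic)
  have eq: "isomon_eq (W P) A x" if "H x" for x
  proof -
    have "\<forall>k l. \<exists>S. open S \<and> x \<in> S \<and> (\<lambda>y. entry (B y P) k l) analytic_on S"
      using that unfolding H_def by (metis analytic_at analytic_on_open)
    then obtain S where S: "\<And>k l. open (S k l)" "\<And>k l. x \<in> S k l" "\<And>k l. (\<lambda>y. entry (B y P) k l) analytic_on S k l"
      by metis
    define O' where "O' = - q ` {1..n} \<inter> (\<Inter>k. \<Inter>l. S k l)"
    have "isomon_eq (W P) (\<lambda>y. entry (B y (\<gamma> 0)) 1 2) x"
    proof (rule isomon_eq_of_flat[where O' = O' and Qs = "\<lambda>s. Q_pot n lam (\<gamma> s)"])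
      show "open O'"
        unfolding O'_def using S(1) nodes_open by (intro open_Int open_INT) auto
      show "x \<in> O'"
        using that S(2) by (auto simp: O'_def H_def)
      fix y assume y: "y \<in> O'"
      then show nodes: "y \<notin> q ` {1..n}"
        by (auto simp: O'_def)
      show "deriv (\<lambda>s. Q_pot n lam (\<gamma> s) y) 0 = Qdot (W P) y"
        by (rule DERIV_imp_deriv[OF Q_pot_has_field_derivative[OF \<gamma>(2,1) nodes]])
      have ana: "(\<lambda>y. entry (B y (\<gamma> 0)) k l) analytic_on {y}" for k l
        unfolding \<gamma>(1) P_eq[symmetric]
        by (rule analytic_on_subset[OF S(3)[of k l]]) (use y in \<open>auto simp: O'_def\<close>)
      then show "(\<lambda>y. entry (B y (\<gamma> 0)) k l) analytic_on {y}" for k l .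
      show "flat_at (\<lambda>y s. companion (Q_pot n lam (\<gamma> s) y)) (\<lambda>y s. B y (\<gamma> s)) y 0"
        using nodes ana \<gamma> by (intro flat) (auto simp: P_eq)
    qed (simp only: \<gamma>(1))
    then show ?thesis
      unfolding A_def \<gamma>(1) P_eq .
  qed
  have A_ana: "A analytic_on {x}" if "H x" for x
    using that unfolding H_def A_def by blast
  obtain \<alpha> where \<alpha>: "\<And>x. A analytic_on {x} \<Longrightarrow> x \<notin> q ` {1..n} \<Longrightarrow> A x = (\<Sum>i=1..n. \<alpha> i / (x - q i))"
  proof (rule solution_eq_resolvent[of A "W P"])
    show "A meromorphic_on UNIV" "(\<lambda>z. A (inverse z)) meromorphic_on {0}"
      using mero unfolding meromorphic_on_CP1_def A_def by blast+
    show "\<forall>\<^sub>F x in at z. isomon_eq (W P) A x" for z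
      using H_at[of z] by eventually_elim (rule eq)
    show "\<forall>\<^sub>F z in at 0. isomon_eq (W P) A (inverse z)"
      using H_inf by eventually_elim (rule eq)
    show "\<forall>\<^sub>F z in at 0. A analytic_on {inverse z}"
      using H_inf by eventually_elim (rule A_ana)
  qed (rule that)
  have Qdot_H: "Qdot (W P) x = (\<Sum>i=1..n. \<alpha> i * vE i x)" if "H x" for x
    using isomon_eq_resolvent[OF A_ana[OF that] eq[OF that] _ \<alpha>] that unfolding H_def by blast
  \<comment> \<open>Both sides are holomorphic away from the nodes, so the identity extends by
    continuity to the points where \<open>B\<close> is singular.\<close>
  have Qdot_eq: "Qdot (W P) x = (\<Sum>i=1..n. \<alpha> i * vE i x)" if x: "x \<notin> q ` {1..n}" for x
  proof -
    have cont: "(h \<longlongrightarrow> h x) (at x)" if "h holomorphic_on - q ` {1..n}" for h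
      using that x nodes_open
      by (metis ComplI continuous_on_eq_continuous_at holomorphic_on_imp_continuous_on isCont_def)
    have "(Qdot (W P) \<longlongrightarrow> Qdot (W P) x) (at x)"
      by (rule cont[OF Qdot_holomorphic])
    moreover have "\<forall>\<^sub>F y in at x. Qdot (W P) y = (\<Sum>i=1..n. \<alpha> i * vE i y)"
      using H_at[of x] by eventually_elim (rule Qdot_H)
    ultimately have "((\<lambda>y. \<Sum>i=1..n. \<alpha> i * vE i y) \<longlongrightarrow> Qdot (W P) x) (at x)"
      by (rule Lim_transform_eventually)
    moreover have "((\<lambda>y. \<Sum>i=1..n. \<alpha> i * vE i y) \<longlongrightarrow> (\<Sum>i=1..n. \<alpha> i * vE i x)) (at x)"
      by (rule cont) (intro holomorphic_intros vE_holomorphic)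
    ultimately show ?thesis
      using tendsto_unique[OF at_neq_bot] by blast
  qed
  show ?thesis
    unfolding P_eq
    by (intro exI, rule flow_combination) (erule supp[unfolded P_eq], erule Qdot_eq[unfolded P_eq])
qed

section \<open>Linear independence of the frame\<close>

lemma independent_image:
  fixes w :: "'i \<Rightarrow> tvec"
  assumes I: "finite I" and zero: "\<And>c i. (\<Sum>i\<in>I. c i *\<^sub>T w i) = 0 \<Longrightarrow> i \<in> I \<Longrightarrow> c i = 0"
  shows "inj_on w I" "tangent.independent (w ` I)"
proof -
  show inj: "inj_on w I"
  proof (rule inj_onI, rule ccontr)
    fix i j assume ij: "i \<in> I" "j \<in> I" "w i = w j" "i \<noteq> j"
    \<comment> \<open>Equal vectors at two different indices would give a nontrivial relation with
      coefficients 1 and -1.\<close>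
    define c where "c = (\<lambda>k. if k = i then 1 else if k = j then - 1 else 0 :: complex)"
    have "(\<Sum>k\<in>I. c k *\<^sub>T w k) = (\<Sum>k\<in>{i, j}. c k *\<^sub>T w k)"
      using I ij by (intro sum.mono_neutral_right) (auto simp: c_def vscale_def)
    also have "\<dots> = 0"
      using ij by (auto simp: c_def vscale_def fun_eq_iff)
    finally have "c i = 0"
      using zero ij by blast
    then show False
      by (simp add: c_def)
  qed
  show "tangent.independent (w ` I)"
  proof
    assume "tangent.dependent (w ` I)"
    then obtain u v where u: "v \<in> w ` I" "u v \<noteq> 0" "(\<Sum>v\<in>w ` I. u v *\<^sub>T v) = 0"
      using tangent.dependent_finite[of "w ` I"] I by auto
    have "(\<Sum>i\<in>I. u (w i) *\<^sub>T w i) = 0"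
      using u(3) by (simp add: sum.reindex[OF inj])
    then show False
      using zero[of "\<lambda>i. u (w i)"] u(1,2) by blast
  qed
qed

text \<open>Indexing by a disjoint sum makes one family of the \<open>U_i\<close> and
  \<open>V_i\<close>. Its injectivity then excludes coincidences within and between the two halves,
  which gives the cardinality of the set.\<close>

lemma flow_frame_independent:
  assumes n: "n > 0" and lam: "lam \<noteq> 0" and P: "P \<in> X_mfd n"
  shows "card (flow_frame n lam P) = 2 * n" "tangent.independent (flow_frame n lam P)"
proof -
  obtain a b q v p where P_eq: "P = (a, b, q, v, p)"
    by (cases P)
  interpret oscillator n lam a b q v p
    using n lam P P_eq by unfold_locales auto
  define w where "w = case_sum (\<lambda>i. U_flow n lam i P) (\<lambda>i. V_flow n lam i P)"
  let ?I = "{1..n} <+> {1..n}"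
  have frame: "flow_frame n lam P = w ` ?I"
    by (auto simp: flow_frame_def w_def Plus_def image_Un image_image)
  have zero: "c i = 0" if "(\<Sum>i\<in>?I. c i *\<^sub>T w i) = 0" "i \<in> ?I" for c i
  proof -
    have "(\<Sum>i=1..n. c (Inl i) *\<^sub>T U_flow n lam i pt) + (\<Sum>i=1..n. c (Inr i) *\<^sub>T V_flow n lam i pt) = 0"
      using that(1) by (simp add: sum.Plus o_def w_def P_eq)
    then show ?thesis
      using flow_frame_coefficients_0[of "\<lambda>i. c (Inl i)" "\<lambda>i. c (Inr i)"] that(2) by blast
  qed
  show "card (flow_frame n lam P) = 2 * n" "tangent.independent (flow_frame n lam P)"
  proof -
    have "inj_on w ?I" "tangent.independent (w ` ?I)"
      by (rule independent_image; (rule zero)?; simp)+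
    then show "card (flow_frame n lam P) = 2 * n" "tangent.independent (flow_frame n lam P)"
      unfolding frame by (simp_all add: card_image card_Plus)
  qed
qed

lemma vector_field_flow:
  assumes "n > 0" "lam \<noteq> 0" "i \<in> {1..n}"
  shows "vector_field n (U_flow n lam i)" "vector_field n (V_flow n lam i)"
proof -
  have "U_flow n lam i P c = 0 \<and> V_flow n lam i P c = 0" if "P \<in> X_mfd n" "c \<notin> coords n" for P c
  proof -
    obtain a b q v p where P_eq: "P = (a, b, q, v, p)"
      by (cases P)
    interpret oscillator n lam a b q v p
      using assms that(1) P_eq by unfold_locales auto
    show ?thesis
      using flow_frame_support[OF assms(3) that(2)] P_eq by simp
  qed
  then show "vector_field n (U_flow n lam i)" "vector_field n (V_flow n lam i)"
    by (auto simp: vector_field_def)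
qed

lemma sum_indicator_vscale:
  fixes i n :: nat
  assumes "i \<in> {1..n}"
  shows "(\<Sum>j=1..n. (if j = i then 1 else 0) *\<^sub>T w j) = w i"
proof
  fix k
  have "(\<Sum>j=1..n. (if j = i then 1 else 0) * w j k) = (\<Sum>j=1..n. if j = i then w j k else 0)"
    by (intro sum.cong) auto
  also have "\<dots> = w i k"
    using assms by (subst sum.delta) auto
  finally show "(\<Sum>j=1..n. (if j = i then 1 else 0) *\<^sub>T w j) k = w i k"
    by (simp only: sum_tvec_apply vscale_apply)
qed

lemma zero_vscale: "(\<Sum>j\<in>I. 0 *\<^sub>T w j) = 0"
  by (intro sum.neutral ballI) (simp add: vscale_def fun_eq_iff)

theorem proposition7p1:
  fixes n :: nat and lam :: complex
  assumes "n \<ge> 1" and "lam \<noteq> 0"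
  shows "(\<forall>i\<in>{1..n}. isomonodromic n lam (U_flow n lam i) \<and> isomonodromic n lam (V_flow n lam i)) \<and>
         (\<forall>P\<in>X_mfd n. card (flow_frame n lam P) = 2 * n \<and> tangent.independent (flow_frame n lam P)) \<and>
         (\<forall>W. isomonodromic n lam W \<longleftrightarrow>
            (\<exists>f g :: nat \<Rightarrow> point \<Rightarrow> complex. vector_field n W \<and>
               (\<forall>P\<in>X_mfd n. W P = (\<Sum>i=1..n. f i P *\<^sub>T U_flow n lam i P)
                                 + (\<Sum>i=1..n. g i P *\<^sub>T V_flow n lam i P))))"
proof (intro conjI ballI allI iffI)
  have n: "n > 0"
    using assms(1) by simp
  note flow_iso = flow_combination_isomonodromic[OF n assms(2)]
  show "isomonodromic n lam (U_flow n lam i)" if "i \<in> {1..n}" for i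
    by (rule flow_iso[where f = "\<lambda>j P. if j = i then 1 else 0" and g = "\<lambda>j P. 0"])
       (simp_all only: vector_field_flow[OF n assms(2) that] sum_indicator_vscale[OF that] zero_vscale add_0_right)
  show "isomonodromic n lam (V_flow n lam i)" if "i \<in> {1..n}" for i
    by (rule flow_iso[where g = "\<lambda>j P. if j = i then 1 else 0" and f = "\<lambda>j P. 0"])
       (simp_all only: vector_field_flow[OF n assms(2) that] sum_indicator_vscale[OF that] zero_vscale add_0)
  show "card (flow_frame n lam P) = 2 * n" "tangent.independent (flow_frame n lam P)" if "P \<in> X_mfd n" for P
    using flow_frame_independent[OF n assms(2) that] by blast+
  fix W
  show "\<exists>f g :: nat \<Rightarrow> point \<Rightarrow> complex. vector_field n W \<and>
      (\<forall>P\<in>X_mfd n. W P = (\<Sum>i=1..n. f i P *\<^sub>T U_flow n lam i P) + (\<Sum>i=1..n. g i P *\<^sub>T V_flow n lam i P))"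
    if iso: "isomonodromic n lam W"
  proof -
    \<comment> \<open>The coefficients are chosen point by point; \<open>R\<close> packs the
      expansion into a relation so that the choice is made for the pair of coefficient families at
      once.\<close>
    define R where "R = (\<lambda>P f g. W P = (\<Sum>i=1..n. f i *\<^sub>T U_flow n lam i P) + (\<Sum>i=1..n. g i *\<^sub>T V_flow n lam i P))"
    have "\<exists>f g. R P f g" if "P \<in> X_mfd n" for P
      unfolding R_def by (rule isomonodromic_imp_flow_combination[OF n assms(2) iso that])
    then obtain f g where "\<And>P. P \<in> X_mfd n \<Longrightarrow> R P (f P) (g P)"
      by metis
    moreover have "vector_field n W"
      using iso by (simp add: isomonodromic_def)
    ultimately show ?thesis
      by - (rule exI[of _ "\<lambda>i P. f P i"], rule exI[of _ "\<lambda>i P. g P i"], unfold R_def, rule conjI, assumption, rule ballI)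
  qed
  show "isomonodromic n lam W"
    if "\<exists>f g :: nat \<Rightarrow> point \<Rightarrow> complex. vector_field n W \<and>
      (\<forall>P\<in>X_mfd n. W P = (\<Sum>i=1..n. f i P *\<^sub>T U_flow n lam i P) + (\<Sum>i=1..n. g i P *\<^sub>T V_flow n lam i P))"
    using that flow_iso by blast
qed

end
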